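(* Let $(\vartheta_0,D)$ be one of the pairs $(0.729,2)$, $(0.616,6)$, $(0.554,8)$, $(0.515,12)$, and suppose some $\vartheta>\vartheta_0$ satisfies both conditions (A) and (B) below. Then there exists a positive even integer $d\le D+2$ such that $\lambda(p+d)=-1$ for infinitely many primes $p$.
   Context: $\Omega(n)$ is the number of prime factors of $n$ counted with multiplicity and $\lambda(n)=(-1)^{\Omega(n)}$. Condition (A): for every $\varepsilon>0$, $A>0$, $\sum_{q\le N^{\vartheta-\varepsilon}}\max_{a:(a,q)=1}\bigl|\sum_{p\le N,\,p\equiv a\ (\mathrm{mod}\ q)}\log p-\frac{N}{\varphi(q)}\bigr|\ll_{\varepsilon,A}\frac{N}{(\log N)^A}$ ($p$ over primes). Condition (B): for every $\varepsilon>0$, $A>0$, $\sum_{q\le N^{\vartheta-\varepsilon}}\max_{y\le N}\max_a\bigl|\sum_{n\le y,\,n\equiv a\ (\mathrm{mod}\ q)}\lambda(n)\bigr|\ll_{\varepsilon,A}\frac{N}{(\log N)^A}$. *)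

theory Defs
  imports "HOL-Analysis.Analysis" "HOL-Library.Landau_Symbols" "HOL-Number_Theory.Number_Theory"
begin

definition bigOmega :: "nat \<Rightarrow> nat" where
  "bigOmega n = size (prime_factorization n)"

definition liouville :: "nat \<Rightarrow> int" where
  "liouville n = (-1) ^ bigOmega n"

definition moduli :: "nat \<Rightarrow> real \<Rightarrow> nat set" where
  "moduli N e = {q. 1 \<le> q \<and> real q \<le> real N powr e}"

definition condA :: "real \<Rightarrow> bool" where
  "condA \<theta> \<longleftrightarrow> (\<forall>\<epsilon>>0. \<forall>A>0.
     (\<lambda>N::nat. \<Sum>q\<in>moduli N (\<theta> - \<epsilon>).
        Max ((\<lambda>a. \<bar>(\<Sum>p | prime p \<and> p \<le> N \<and> [p = a] (mod q). ln (real p))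
                     - real N / real (totient q)\<bar>) ` {a. a < q \<and> coprime a q}))
     \<in> O(\<lambda>N. real N / (ln (real N)) powr A))"

definition condB :: "real \<Rightarrow> bool" where
  "condB \<theta> \<longleftrightarrow> (\<forall>\<epsilon>>0. \<forall>A>0.
     (\<lambda>N::nat. \<Sum>q\<in>moduli N (\<theta> - \<epsilon>).
        Max ((\<lambda>(y, a). \<bar>real_of_int (\<Sum>n | 1 \<le> n \<and> n \<le> y \<and> [n = a] (mod q). liouville n)\<bar>)
               ` ({..N} \<times> {..<q})))
     \<in> O(\<lambda>N. real N / (ln (real N)) powr A))"

end

theory Submission
  imports Defs "HOL-Real_Asymp.Real_Asymp"
begin

text \<open>
  Suppose that \<open>\<lambda>(p + d) = 1\<close> for all large primes \<open>p\<close> and all even \<open>0 < d \<le> D + 2\<close>, and let \<open>H\<close> be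
  the admissible tuple \<open>{0, 2}\<close>, \<open>{0, 2, 6}\<close>, \<open>{0, 2, 6, 8}\<close> or \<open>{0, 2, 6, 8, 12}\<close> of diameter \<open>D\<close>.
  For large \<open>n\<close> at most one of the numbers \<open>n + h\<close> with \<open>h \<in> H\<close> is then prime, because \<open>\<lambda>(p) = -1\<close>
  for primes, and if one of them is prime then \<open>\<lambda>(n + D + 2) = 1\<close>.  So for every nonnegative weight
  \<open>w\<close> the mass \<open>w\<close> gives to the event that some \<open>n + h\<close> is prime is at most the mass it gives to the
  event \<open>\<lambda>(n + D + 2) = 1\<close>.

  Take for \<open>w\<close> the Goldston--Pintz--Yildirim weight: the square of a divisor sum over squarefree
  divisors \<open>\<le> R\<close> of the product of the \<open>n + h\<close>, where \<open>R\<^sup>2\<close> is the \<open>\<theta>0\<close>-th power of \<open>N\<close>.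
  Condition (B) shows that \<open>\<lambda>(n + D + 2)\<close> has mean \<open>0\<close> with respect to \<open>w\<close>, so the second event
  carries half of the total mass; condition (A) gives the first event a proportion
  \<open>\<theta>0 k J / (2 I)\<close>, where \<open>k\<close> is the size of \<open>H\<close> and \<open>I\<close>, \<open>J\<close> are the integrals of the squares of the
  sieve cutoff and of its antiderivative.  With the cutoff \<open>1 + 2 b (1 - log d / log R)\<close> and
  \<open>b = 1/2, 3/2, 3, 4\<close> for \<open>k = 2, 3, 4, 5\<close> this exceeds one half in all four cases.

  Squarefree numbers are represented by their sets of prime factors, so that Selberg's
  diagonalization is Moebius inversion on finite sets and sums over multiplicative functions are
  estimated by adding one prime at a time.
\<close>

subsection \<open>Powers of logarithms\<close>

text \<open>No asymptotic formula is proved: the comparison needs only an upper bound for the total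
  mass and a lower bound for the prime mass. The weights are therefore prescribed through Selberg's
  diagonal variables. Both masses then become sums of squares with nonnegative coefficients, into
  which one-sided estimates can be inserted term by term. The sums that remain are compared with
  sums of powers of log(y/n)/n over integers n, so nothing about the distribution of primes enters
  except (A).

  The obstacle is sharpness of these crude comparisons at small primes. It is met by fixing n modulo
  the product W of the primes up to a constant D0, in a class where no n + h has a factor in common
  with W. For primes above D0 the coefficients k/(p - k) and k/p agree up to a total factor exp(2
  k^2/D0), which is close to 1, and no singular series arises. The powers of phi(W)/W coincide on
  both sides and cancel. D0 is fixed before N grows, inside the slack of the strict numerical
  inequality.\<close>

text \<open>The truncation at 1 carries the size condition of a divisor sum: evaluated at x/d the
  value vanishes unless d <= x, and \<open>plog 0\<close> is the indicator of that condition. Unlike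
  a restricted index set, it is monotone in x, which most estimates below exploit.\<close>

definition plog :: "nat \<Rightarrow> real \<Rightarrow> real" where
  "plog m x = (if 1 \<le> x then ln x ^ m else 0)"

lemma plog_nonneg [simp]: "0 \<le> plog m x"
  by (simp add: plog_def)

lemma mono_plog: "mono (plog m)"
  by (rule monoI) (auto simp: plog_def intro!: power_mono)

lemma power_Suc_diff_le:
  fixes A B :: real
  assumes "0 \<le> B" "B \<le> A"
  shows "A ^ Suc m - B ^ Suc m \<le> real (Suc m) * A ^ m * (A - B)"
proof (induction m)
  case (Suc m)
  have "A ^ Suc (Suc m) - B ^ Suc (Suc m) = A * (A ^ Suc m - B ^ Suc m) + B ^ Suc m * (A - B)"
    by (simp add: algebra_simps)
  also have "\<dots> \<le> A * (real (Suc m) * A ^ m * (A - B)) + A ^ Suc m * (A - B)"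
    using assms Suc by (intro add_mono mult_left_mono mult_right_mono power_mono) auto
  also have "\<dots> = real (Suc (Suc m)) * A ^ Suc m * (A - B)"
    by (simp add: algebra_simps)
  finally show ?case .
qed simp

lemma power_Suc_diff_ge:
  fixes A B :: real
  assumes "0 \<le> B" "B \<le> A"
  shows "real (Suc m) * B ^ m * (A - B) \<le> A ^ Suc m - B ^ Suc m"
proof (induction m)
  case (Suc m)
  have "real (Suc (Suc m)) * B ^ Suc m * (A - B)
      = B * (real (Suc m) * B ^ m * (A - B)) + B ^ Suc m * (A - B)"
    by (simp add: algebra_simps)
  also have "\<dots> \<le> A * (A ^ Suc m - B ^ Suc m) + B ^ Suc m * (A - B)"
    using assms Suc by (intro add_mono mult_mono) auto
  also have "\<dots> = A ^ Suc (Suc m) - B ^ Suc (Suc m)"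
    by (simp add: algebra_simps)
  finally show ?case .
qed simp

lemma ln_Suc_diff_le: "n \<ge> 1 \<Longrightarrow> ln (real (Suc n)) - ln (real n) \<le> 1 / real n"
  using ln_diff_le[of "real (Suc n)" "real n"] by simp

lemma ln_Suc_diff_ge: "n \<ge> 1 \<Longrightarrow> 1 / real (Suc n) \<le> ln (real (Suc n)) - ln (real n)"
  using ln_diff_le[of "real n" "real (Suc n)"] by (simp add: field_simps)

text \<open>A discrete form of the fact that log(y/t)^(m+1) has derivative -(m+1) log(y/t)^m / t.
  Telescoping it replaces a comparison of sums with integrals.\<close>

lemma plog_diff_le:
  assumes n: "n \<ge> 1" and y: "0 < y"
  shows "plog (Suc m) (y / real n) - plog (Suc m) (y / real (Suc n))
          \<le> real (Suc m) * (plog m (y / real n) / real n)"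
proof (cases "1 \<le> y / real n")
  case False
  moreover have "y / real (Suc n) \<le> y / real n"
    using n y by (intro divide_left_mono) auto
  ultimately show ?thesis by (simp add: plog_def)
next
  case True
  define A where "A = ln (y / real n)"
  \<comment> \<open>The positive part covers n <= y < n + 1, where the second \<open>plog\<close> is
    truncated to 0 although its logarithm is negative.\<close>
  define B where "B = max 0 (ln (y / real (Suc n)))"
  have A0: "0 \<le> A" using True by (simp add: A_def)
  have AB: "A - ln (y / real (Suc n)) = ln (real (Suc n)) - ln (real n)"
    using n y by (simp add: A_def ln_div del: of_nat_Suc)
  have "0 \<le> ln (real (Suc n)) - ln (real n)" using n by simp
  then have B: "0 \<le> B" "B \<le> A" using AB A0 by (auto simp: B_def)
  have d: "A - B \<le> 1 / real n"
    using AB ln_Suc_diff_le[OF n] by (auto simp: B_def)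
  have pB: "plog (Suc m) (y / real (Suc n)) = B ^ Suc m"
    using y by (auto simp: plog_def B_def max_def simp del: of_nat_Suc)
  have "A ^ Suc m - B ^ Suc m \<le> real (Suc m) * A ^ m * (A - B)"
    by (rule power_Suc_diff_le[OF B])
  also have "\<dots> \<le> real (Suc m) * A ^ m * (1 / real n)"
    using d A0 by (intro mult_left_mono) auto
  finally show ?thesis
    using True pB by (simp add: plog_def A_def)
qed

lemma plog_diff_ge:
  assumes n: "n \<ge> 1" and y: "0 < y"
  shows "real (Suc m) * (plog m (y / real (Suc n)) / real (Suc n))
         \<le> plog (Suc m) (y / real n) - plog (Suc m) (y / real (Suc n))"
proof (cases "1 \<le> y / real (Suc n)")
  case False
  then show ?thesis by (simp add: plog_def)
next
  case True
  define A where "A = ln (y / real n)"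
  define B where "B = ln (y / real (Suc n))"
  have le: "y / real (Suc n) \<le> y / real n"
    using n y by (intro divide_left_mono) auto
  have AB: "A - B = ln (real (Suc n)) - ln (real n)"
    using n y by (simp add: A_def B_def ln_div del: of_nat_Suc)
  have "0 \<le> ln (real (Suc n)) - ln (real n)" using n by simp
  then have B: "0 \<le> B" "B \<le> A" using AB True by (auto simp: B_def)
  have d: "1 / real (Suc n) \<le> A - B"
    using AB ln_Suc_diff_ge[OF n] by simp
  have "real (Suc m) * B ^ m * (1 / real (Suc n)) \<le> real (Suc m) * B ^ m * (A - B)"
    using d B by (intro mult_left_mono) auto
  also have "\<dots> \<le> A ^ Suc m - B ^ Suc m"
    by (rule power_Suc_diff_ge[OF B])
  finally have "real (Suc m) * (B ^ m / real (Suc n)) \<le> A ^ Suc m - B ^ Suc m" by simp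
  moreover have "1 \<le> y / real n" using True le by linarith
  ultimately show ?thesis
    using True by (simp add: plog_def A_def B_def)
qed

text \<open>The condition y < M + 1 makes the last telescoped term vanish. The bound has no error
  term, so it can later be iterated without loss.\<close>

lemma plog_sum_ge:
  assumes y: "0 \<le> y" and M: "y < real (Suc M)"
  shows "plog (Suc m) y / real (Suc m) \<le> (\<Sum>n=1..M. plog m (y / real n) / real n)"
proof (cases "y = 0")
  case True
  then show ?thesis by (simp add: plog_def sum_nonneg)
next
  case False
  with y have y: "0 < y" by simp
  have *: "plog (Suc m) y - plog (Suc m) (y / real (Suc M))
          \<le> (\<Sum>n=1..M. real (Suc m) * (plog m (y / real n) / real n))" for M
  proof (induction M)
    case (Suc M)
    show ?case
      using Suc plog_diff_le[of "Suc M" y m] y by simp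
  qed simp
  have "plog (Suc m) (y / real (Suc M)) = 0"
    using M by (simp add: plog_def field_simps)
  with *[of M] have "plog (Suc m) y \<le> real (Suc m) * (\<Sum>n=1..M. plog m (y / real n) / real n)"
    unfolding sum_distrib_left by linarith
  then show ?thesis by (simp add: divide_le_eq mult.commute)
qed

text \<open>Telescoping from this side controls only the terms with n >= 2; the term n = 1 survives
  as \<open>plog m y\<close>, of lower order, and is later absorbed by rescaling y.\<close>

lemma plog_sum_le:
  assumes y: "0 \<le> y"
  shows "(\<Sum>n=1..M. plog m (y / real n) / real n) \<le> plog m y + plog (Suc m) y / real (Suc m)"
proof (cases "M = 0 \<or> y = 0")
  case True
  then show ?thesis by (auto simp: plog_def)
next
  case False
  with y have y: "0 < y" by simp
  have *: "(\<Sum>n=1..Suc M. real (Suc m) * (plog m (y / real n) / real n))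
         \<le> real (Suc m) * plog m y + plog (Suc m) y - plog (Suc m) (y / real (Suc M))" for M
  proof (induction M)
    case (Suc M)
    show ?case
      using Suc plog_diff_ge[of "Suc M" y m] y by simp
  qed simp
  have "Suc (M - 1) = M" using False by simp
  with *[of "M - 1"] have "(\<Sum>n=1..M. real (Suc m) * (plog m (y / real n) / real n))
      \<le> real (Suc m) * plog m y + plog (Suc m) y - plog (Suc m) (y / real M)"
    by simp
  then have "real (Suc m) * (\<Sum>n=1..M. (plog m (y / real n) / real n))
      \<le> real (Suc m) * plog m y + plog (Suc m) y - plog (Suc m) (y / real M)"
    by (simp add: sum_distrib_left)
  also have "\<dots> \<le> real (Suc m) * plog m y + plog (Suc m) y" by simp
  finally show ?thesis by (simp add: field_simps)
qed

subsection \<open>Sums of multiplicative functions over squarefree numbers\<close>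

abbreviation rprod :: "nat set \<Rightarrow> real" where
  "rprod S \<equiv> (\<Prod>p\<in>S. real p)"

text \<open>S stands for the squarefree number \<open>rprod S\<close>, and a is extended
  multiplicatively. As the cut at x sits inside f, the index set is a full power set and adding a
  prime is a two-term recursion.\<close>

definition subset_sum :: "(nat \<Rightarrow> real) \<Rightarrow> nat set \<Rightarrow> (real \<Rightarrow> real) \<Rightarrow> real \<Rightarrow> real" where
  "subset_sum a P f x = (\<Sum>S\<in>Pow P. (\<Prod>p\<in>S. a p) * f (x / rprod S))"

lemma sum_Pow_insert:
  fixes g :: "'a set \<Rightarrow> 'b::comm_monoid_add"
  assumes "finite P" "p \<notin> P"
  shows "sum g (Pow (insert p P)) = sum g (Pow P) + (\<Sum>S\<in>Pow P. g (insert p S))"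
proof -
  have "inj_on (insert p) (Pow P)"
    using assms by (auto simp: inj_on_def)
  moreover have "Pow P \<inter> insert p ` Pow P = {}" using assms by auto
  ultimately show ?thesis
    using assms by (simp add: Pow_insert sum.union_disjoint sum.reindex)
qed

lemma subset_sum_empty [simp]: "subset_sum a {} f x = f x"
  by (simp add: subset_sum_def)

lemma subset_sum_insert:
  assumes "finite P" "p \<notin> P"
  shows "subset_sum a (insert p P) f x = subset_sum a P f x + a p * subset_sum a P f (x / real p)"
proof -
  have *: "(\<Prod>q\<in>insert p S. a q) * f (x / (\<Prod>q\<in>insert p S. real q))
      = a p * ((\<Prod>q\<in>S. a q) * f (x / real p / (\<Prod>q\<in>S. real q)))" if "S \<in> Pow P" for S
  proof -
    have "finite S" "p \<notin> S" using that assms finite_subset by auto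
    then show ?thesis by (simp add: mult.assoc)
  qed
  show ?thesis
    unfolding subset_sum_def sum_Pow_insert[OF assms] by (simp add: * sum_distrib_left)
qed

lemma subset_sum_zero:
  assumes "finite P"
  shows "subset_sum (\<lambda>_. 0) P f x = f x"
  using assms by (induction P arbitrary: x) (auto simp: subset_sum_insert)

lemma subset_sum_cong:
  assumes "\<And>p. p \<in> P \<Longrightarrow> a p = b p"
  shows "subset_sum a P f x = subset_sum b P f x"
  unfolding subset_sum_def using assms
  by (intro sum.cong refl) (metis (no_types, lifting) PowD prod.cong subsetD)

lemma subset_sum_nonneg:
  assumes "\<And>p. p \<in> P \<Longrightarrow> 0 \<le> a p" "\<And>x. 0 \<le> f x"
  shows "0 \<le> subset_sum a P f x"
  unfolding subset_sum_def using assms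
  by (intro sum_nonneg mult_nonneg_nonneg prod_nonneg) auto

lemma subset_sum_mono_arg:
  assumes "\<And>p. p \<in> P \<Longrightarrow> 0 \<le> a p" "mono f" "x \<le> y"
  shows "subset_sum a P f x \<le> subset_sum a P f y"
  unfolding subset_sum_def using assms
  by (intro sum_mono mult_left_mono prod_nonneg monoD[OF \<open>mono f\<close>] divide_right_mono) auto

lemma subset_sum_mono_coeff:
  assumes "\<And>p. p \<in> P \<Longrightarrow> 0 \<le> a p \<and> a p \<le> b p" "\<And>x. 0 \<le> f x"
  shows "subset_sum a P f x \<le> subset_sum b P f x"
  unfolding subset_sum_def using assms
  by (intro sum_mono mult_right_mono prod_mono) auto

lemma subset_sum_mono_set:
  assumes "finite P" "Q \<subseteq> P" "\<And>p. p \<in> P \<Longrightarrow> 0 \<le> a p" "\<And>x. 0 \<le> f x"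
  shows "subset_sum a Q f x \<le> subset_sum a P f x"
  unfolding subset_sum_def using assms
  by (intro sum_mono2 mult_nonneg_nonneg prod_nonneg) auto

lemma subset_sum_divide_le:
  assumes "\<And>p. p \<in> P \<Longrightarrow> 0 \<le> a p" "mono f" "0 \<le> x" "1 \<le> d"
  shows "subset_sum a P f (x / d) \<le> subset_sum a P f x"
proof (rule subset_sum_mono_arg)
  show "x / d \<le> x" using assms divide_left_mono[of 1 d x] by simp
qed (use assms in auto)

text \<open>Expanding the product of \<open>a p + b p\<close> assigns each prime of a squarefree
  number to one of two coprime factors, hence the inner sum over \<open>P - S\<close>. Splitting off
  one summand in this way raises the dimension of a sum by one.\<close>

lemma subset_sum_add:
  assumes "finite P"
  shows "subset_sum (\<lambda>p. a p + b p) P f x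
       = (\<Sum>S\<in>Pow P. (\<Prod>p\<in>S. a p) * subset_sum b (P - S) f (x / rprod S))"
  using assms
proof (induction P arbitrary: x)
  case (insert p P)
  have 1: "(\<Prod>q\<in>S. a q) * subset_sum b (insert p P - S) f (x / (\<Prod>q\<in>S. real q))
     = (\<Prod>q\<in>S. a q) * subset_sum b (P - S) f (x / (\<Prod>q\<in>S. real q))
      + b p * ((\<Prod>q\<in>S. a q) * subset_sum b (P - S) f (x / real p / (\<Prod>q\<in>S. real q)))"
    if "S \<in> Pow P" for S
  proof -
    have "insert p P - S = insert p (P - S)" using that insert by auto
    then show ?thesis
      using insert by (simp add: subset_sum_insert algebra_simps)
  qed
  have 2: "(\<Prod>q\<in>insert p S. a q) * subset_sum b (insert p P - insert p S) f (x / (\<Prod>q\<in>insert p S. real q))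
      = a p * ((\<Prod>q\<in>S. a q) * subset_sum b (P - S) f (x / real p / (\<Prod>q\<in>S. real q)))"
    if "S \<in> Pow P" for S
  proof -
    have "finite S" "p \<notin> S" "insert p P - insert p S = P - S"
      using that insert finite_subset by auto
    then show ?thesis by (simp add: mult.assoc)
  qed
  have "(\<Sum>S\<in>Pow (insert p P). (\<Prod>q\<in>S. a q) * subset_sum b (insert p P - S) f (x / (\<Prod>q\<in>S. real q)))
     = (\<Sum>S\<in>Pow P. (\<Prod>q\<in>S. a q) * subset_sum b (P - S) f (x / (\<Prod>q\<in>S. real q))
           + b p * ((\<Prod>q\<in>S. a q) * subset_sum b (P - S) f (x / real p / (\<Prod>q\<in>S. real q))))
      + (\<Sum>S\<in>Pow P. a p * ((\<Prod>q\<in>S. a q) * subset_sum b (P - S) f (x / real p / (\<Prod>q\<in>S. real q))))"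
    unfolding sum_Pow_insert[OF insert.hyps(1,2)] by (intro arg_cong2[of _ _ _ _ "(+)"] sum.cong refl 1 2)
  then show ?case
    by (simp add: insert.IH insert.hyps subset_sum_insert sum.distrib distrib_right
        flip: sum_distrib_left)
qed simp

text \<open>A monotone f allows x/p to be replaced by x in every term containing some
  \<open>\<rho> p\<close>, so changing the coefficients costs only an Euler product.\<close>

lemma subset_sum_perturb:
  assumes "finite P" "\<And>p. p \<in> P \<Longrightarrow> 0 \<le> a p \<and> 0 \<le> \<rho> p \<and> 1 \<le> p"
    and f: "mono f" "\<And>x. 0 \<le> f x" and "0 \<le> x"
  shows "subset_sum (\<lambda>p. a p + \<rho> p) P f x \<le> (\<Prod>p\<in>P. 1 + \<rho> p) * subset_sum a P f x"
  using assms(1,2,5)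
proof (induction P arbitrary: x)
  case (insert p P)
  let ?C = "\<Prod>p\<in>P. 1 + \<rho> p"
  have C: "0 \<le> ?C" using insert by (intro prod_nonneg) (auto intro: add_nonneg_nonneg)
  have x': "0 \<le> x / real p" using insert by simp
  have 1: "subset_sum a P f (x / real p) \<le> subset_sum a (insert p P) f x"
  proof -
    have "subset_sum a P f (x / real p) \<le> subset_sum a P f x"
      using insert f by (intro subset_sum_divide_le) auto
    also have "\<dots> \<le> subset_sum a (insert p P) f x"
      using insert f by (intro subset_sum_mono_set) auto
    finally show ?thesis .
  qed
  have "subset_sum (\<lambda>p. a p + \<rho> p) (insert p P) f x
     = subset_sum (\<lambda>p. a p + \<rho> p) P f x + (a p + \<rho> p) * subset_sum (\<lambda>p. a p + \<rho> p) P f (x / real p)"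
    by (simp add: subset_sum_insert insert)
  also have "\<dots> \<le> ?C * subset_sum a P f x + (a p + \<rho> p) * (?C * subset_sum a P f (x / real p))"
    using insert x' by (intro add_mono mult_left_mono insert.IH) (auto intro: add_nonneg_nonneg)
  also have "\<dots> = ?C * (subset_sum a (insert p P) f x + \<rho> p * subset_sum a P f (x / real p))"
    by (simp add: subset_sum_insert insert algebra_simps)
  also have "\<dots> \<le> ?C * (subset_sum a (insert p P) f x + \<rho> p * subset_sum a (insert p P) f x)"
    using C 1 insert by (intro mult_left_mono add_mono) auto
  also have "\<dots> = (\<Prod>p\<in>insert p P. 1 + \<rho> p) * subset_sum a (insert p P) f x"
    using insert by (simp add: algebra_simps)
  finally show ?case .
qed simp

section \<open>Coefficients 1/(p - 1) and sums over all integers\<close>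

abbreviation totient_sum :: "nat set \<Rightarrow> (real \<Rightarrow> real) \<Rightarrow> real \<Rightarrow> real" where
  "totient_sum \<equiv> subset_sum (\<lambda>p. 1 / (real p - 1))"

text \<open>For monotone f, deleting a prime q loses at most the factor 1 + 1/(q - 1), the inverse
  of 1 - 1/q. Applied to the primes up to D0 this is the source of phi(W)/W in the lower
  bounds.\<close>

lemma subset_sum_remove:
  assumes "finite P" "\<And>p. p \<in> P \<Longrightarrow> 1 < p" "Q \<subseteq> P"
    and f: "mono f" "\<And>x. 0 \<le> f x" and x: "0 \<le> x"
  shows "(\<Prod>p\<in>Q. 1 - 1 / real p) * totient_sum P f x
          \<le> totient_sum (P - Q) f x"
proof -
  have "finite Q" using assms finite_subset by auto
  then show ?thesis using assms(3)
  proof (induction Q)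
    case (insert q Q)
    let ?a = "\<lambda>p::nat. 1 / (real p - 1)"
    let ?P = "P - insert q Q"
    have eq: "P - Q = insert q ?P" using insert by auto
    have fin: "finite ?P" and nin: "q \<notin> ?P" using assms by auto
    have pos: "0 \<le> ?a p" if "p \<in> P" for p using assms(2)[OF that] by simp
    have q: "1 < q" using assms insert by auto
    have "(\<Prod>p\<in>Q. 1 - 1 / real p) * subset_sum ?a P f x \<le> subset_sum ?a (P - Q) f x"
      using insert by simp
    also have "\<dots> = subset_sum ?a ?P f x + ?a q * subset_sum ?a ?P f (x / real q)"
      unfolding eq by (rule subset_sum_insert[OF fin nin])
    also have "\<dots> \<le> subset_sum ?a ?P f x + ?a q * subset_sum ?a ?P f x"
      using q pos x f by (intro add_mono mult_left_mono subset_sum_divide_le) auto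
    also have "\<dots> = (1 + ?a q) * subset_sum ?a ?P f x" by (simp add: algebra_simps)
    finally have *: "(\<Prod>p\<in>Q. 1 - 1 / real p) * subset_sum ?a P f x \<le> (1 + ?a q) * subset_sum ?a ?P f x" .
    have "(\<Prod>p\<in>insert q Q. 1 - 1 / real p) * subset_sum ?a P f x
       = (1 - 1 / real q) * ((\<Prod>p\<in>Q. 1 - 1 / real p) * subset_sum ?a P f x)"
      using insert by simp
    also have "\<dots> \<le> (1 - 1 / real q) * ((1 + ?a q) * subset_sum ?a ?P f x)"
      using q by (intro mult_left_mono[OF *]) simp
    also have "\<dots> = subset_sum ?a ?P f x"
      using q by (simp add: field_simps)
    finally show ?case .
  qed simp
qed

text \<open>
  \<open>1 / (p - 1)\<close> is the sum of \<open>1 / p\<^sup>j\<close> over \<open>j \<ge> 1\<close>, so each squarefree number collects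
  all integers with the same set of prime factors.
\<close>

lemma smooth_sum_le_subset_sum:
  assumes "finite P" "\<And>p. p \<in> P \<Longrightarrow> prime p" "finite X"
    and "\<And>n. n \<in> X \<Longrightarrow> 0 < n \<and> prime_factors n \<subseteq> P"
    and f: "mono f" "\<And>x. 0 \<le> f x" and "0 \<le> x"
  shows "(\<Sum>n\<in>X. f (x / real n) / real n) \<le> totient_sum P f x"
  using assms(1-4,7)
proof (induction P arbitrary: X x)
  case empty
  have "X \<subseteq> {1}"
  proof
    fix n assume "n \<in> X"
    with empty have "0 < n" "prime_factors n = {}" by auto
    then show "n \<in> {1}" by (simp add: set_mset_eq_empty_iff prime_factorization_empty_iff)
  qed
  then have "X = {} \<or> X = {1}" by auto
  then show ?case using f by auto
next
  case (insert p P)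
  let ?a = "\<lambda>p::nat. 1 / (real p - 1)"
  have p: "prime p" using insert by simp
  then have p: "prime p" "1 < p" using prime_gt_1_nat[of p] by auto
  have apos: "0 \<le> ?a q" if "q \<in> P" for q
    using that insert.prems(1)[of q] prime_gt_1_nat[of q] by simp
  \<comment> \<open>Only one factor p is divided out at a time and the quotients may again be
    multiples of p; induction on a bound B for the elements ends this descent.\<close>
  have main: "(\<Sum>n\<in>X. f (x / real n) / real n) \<le> subset_sum ?a P f x + ?a p * subset_sum ?a P f (x / real p)"
    if "finite X" "\<And>n. n \<in> X \<Longrightarrow> 0 < n \<and> prime_factors n \<subseteq> insert p P" "\<And>n. n \<in> X \<Longrightarrow> n < B" "0 \<le> x" for B X x
    using that
  proof (induction B arbitrary: X x rule: less_induct)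
    case (less B)
    show ?case
    proof (cases "X = {}")
      case True
      then show ?thesis
        using f apos p by (auto intro!: add_nonneg_nonneg divide_nonneg_nonneg mult_nonneg_nonneg subset_sum_nonneg)
    next
      case False
      define X0 where "X0 = {n\<in>X. \<not> p dvd n}"
      define Y where "Y = {m. p * m \<in> X}"
      have X: "X = X0 \<union> (\<lambda>m. p * m) ` Y" "X0 \<inter> (\<lambda>m. p * m) ` Y = {}"
        by (auto simp: X0_def Y_def)
      have inj: "inj_on (\<lambda>m. p * m) Y" using p by (auto simp: inj_on_def)
      have finY: "finite Y"
        using finite_imageD[OF _ inj] less.prems(1) X(1) by (metis finite_Un)
      have Bpos: "0 < B" using False less.prems(3) by (metis equals0I not_less_zero zero_less_iff_neq_zero)
      have fac: "prime_factors m \<subseteq> insert p P \<and> 0 < m \<and> m < B \<and> p * m < B" if "m \<in> Y" for m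
      proof -
        have pm: "p * m \<in> X" using that by (simp add: Y_def)
        then have "0 < p * m" "prime_factors (p * m) \<subseteq> insert p P" "p * m < B"
          using less.prems(2)[OF pm] less.prems(3)[OF pm] by blast+
        moreover from this have "m < B" using p
          by (metis le_less_trans mult_le_mono1 nat_mult_1 less_imp_le)
        moreover have "prime_factors m \<subseteq> prime_factors (p * m)"
          using \<open>0 < p * m\<close> by (intro dvd_prime_factors) auto
        ultimately show ?thesis using Bpos by auto
      qed
      have "(\<Sum>n\<in>X0. f (x / real n) / real n) \<le> subset_sum ?a P f x"
      proof (rule insert.IH)
        fix n assume "n \<in> X0"
        then have "n \<in> X" "\<not> p dvd n" by (auto simp: X0_def)
        then show "0 < n \<and> prime_factors n \<subseteq> P" using less.prems(2)[of n] by (auto simp: prime_factors_dvd)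
      qed (use insert less.prems X0_def in auto)
      moreover have "(\<Sum>n\<in>(\<lambda>m. p * m) ` Y. f (x / real n) / real n) \<le> ?a p * subset_sum ?a P f (x / real p)"
      proof -
        have "(\<Sum>n\<in>(\<lambda>m. p * m) ` Y. f (x / real n) / real n)
            = 1 / real p * (\<Sum>m\<in>Y. f (x / real p / real m) / real m)"
          by (simp add: sum.reindex[OF inj] sum_distrib_left)
        also have "\<dots> \<le> 1 / real p * (subset_sum ?a P f (x / real p) + ?a p * subset_sum ?a P f (x / real p / real p))"
        proof (intro mult_left_mono less.IH[of "B - 1"])
          show "B - 1 < B" using Bpos by simp
          show "n < B - 1" if "n \<in> Y" for n
          proof -
            have "2 * n \<le> p * n" using p by (intro mult_le_mono1) simp
            then show ?thesis using fac[OF that] by linarith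
          qed
        qed (use finY fac less.prems in auto)
        \<comment> \<open>This sums the geometric series over powers of p, through 1/p * (1 + 1/(p -
          1)) = 1/(p - 1).\<close>
        also have "\<dots> \<le> 1 / real p * (subset_sum ?a P f (x / real p) + ?a p * subset_sum ?a P f (x / real p))"
          using p apos f less.prems by (intro mult_left_mono add_mono subset_sum_divide_le) auto
        also have "\<dots> = ?a p * subset_sum ?a P f (x / real p)"
          using p by (simp add: field_simps)
        finally show ?thesis .
      qed
      ultimately show ?thesis
        unfolding X(1) using X(2) finY less.prems(1)
        by (subst sum.union_disjoint) (auto simp: X0_def)
    qed
  qed
  have "(\<Sum>n\<in>X. f (x / real n) / real n) \<le> subset_sum ?a P f x + ?a p * subset_sum ?a P f (x / real p)"
    by (rule main[where B = "Suc (Max X)"]) (use insert in \<open>auto simp: less_Suc_eq_le\<close>)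
  then show ?case by (simp add: subset_sum_insert insert)
qed


section \<open>Upper bounds for squarefree sums coprime to a modulus\<close>

text \<open>Write n = j W + r and replace n by the smaller j W: each j is met once in each of the
  phi(W) reduced classes. The n < W, where j = 0, are bounded trivially and give W of the factor W +
  1; the remaining unit bounds the lower-order term of the sum over j.\<close>

lemma coprime_plog_sum_le:
  assumes W: "W \<ge> 1" and X: "finite X" "\<And>n. n \<in> X \<Longrightarrow> n \<ge> 1 \<and> coprime n W" and y: "0 \<le> y"
  shows "(\<Sum>n\<in>X. plog m (y / real n) / real n)
      \<le> (real W + 1) * plog m y + real (totient W) / real W * (plog (Suc m) y / real (Suc m))"
proof -
  let ?g = "\<lambda>n. plog m (y / real n) / real n"
  define X0 where "X0 = {n\<in>X. n < W}"
  define X1 where "X1 = {n\<in>X. W \<le> n}"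
  define Rs where "Rs = {r. r < W \<and> coprime r W}"
  define M where "M = Max (insert 0 X)"
  have cardR: "card Rs = totient W"
  proof (cases "W = 1")
    case True
    \<comment> \<open>For W = 1 the reduced residue below W is 0, while \<open>totatives\<close>
      represents it by 1; only the cardinalities agree.\<close>
    then have "Rs = {0}" by (auto simp: Rs_def)
    then show ?thesis using True by simp
  next
    case False
    then have "Rs = totatives W"
      using W by (auto simp: Rs_def totatives_def order.order_iff_strict intro!: Nat.gr0I)
    then show ?thesis by (simp add: totient_def)
  qed
  have le_y: "plog m (y / d) \<le> plog m y" if "1 \<le> d" for d
    using that y divide_left_mono[of 1 d y] by (intro monoD[OF mono_plog]) simp
  have "sum ?g X0 \<le> (\<Sum>n\<in>X0. plog m y)"
  proof (rule sum_mono)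
    fix n assume "n \<in> X0"
    then have n: "1 \<le> real n" using X(2)[of n] by (auto simp: X0_def)
    have "?g n \<le> plog m (y / real n) / 1"
      using n by (intro divide_left_mono) auto
    then show "?g n \<le> plog m y" using le_y[OF n] by simp
  qed
  also have "\<dots> = real (card X0) * plog m y" by simp
  also have "\<dots> \<le> real W * plog m y"
  proof (intro mult_right_mono)
    have "card X0 \<le> card {..<W}" by (intro card_mono) (auto simp: X0_def)
    then show "real (card X0) \<le> real W" by simp
  qed simp
  finally have 0: "sum ?g X0 \<le> real W * plog m y" .
  have "sum ?g X1 \<le> (\<Sum>(j, r)\<in>{1..M} \<times> Rs. plog m (y / real W / real j) / (real W * real j))"
  proof (rule sum_le_included[where i = "\<lambda>(j, r). j * W + r"])
    show "\<forall>x\<in>X1. \<exists>z\<in>{1..M} \<times> Rs. (case z of (j, r) \<Rightarrow> j * W + r) = x \<and>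
          ?g x \<le> (case z of (j, r) \<Rightarrow> plog m (y / real W / real j) / (real W * real j))"
    proof
      fix n assume n: "n \<in> X1"
      then have n': "n \<in> X" "W \<le> n" "coprime n W" using X by (auto simp: X1_def)
      have j1: "1 \<le> n div W" using n' W by (simp add: Suc_leI div_greater_zero_iff)
      have "n div W \<le> n" by simp
      also have "n \<le> M" using n' X by (auto simp: M_def)
      finally have jM: "n div W \<le> M" .
      have "n mod W \<in> Rs" using n' W by (auto simp: Rs_def)
      moreover have "?g n \<le> plog m (y / real W / real (n div W)) / (real W * real (n div W))"
      proof -
        have le: "real W * real (n div W) \<le> real n"
          by (metis div_times_less_eq_dividend mult.commute of_nat_le_iff of_nat_mult)
        have pos: "0 < real W * real (n div W)" using j1 W by simp
        have "plog m (y / real n) \<le> plog m (y / (real W * real (n div W)))"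
          using le pos y by (intro monoD[OF mono_plog] divide_left_mono) auto
        then show ?thesis using le pos by (intro frac_le) auto
      qed
      ultimately show "\<exists>z\<in>{1..M} \<times> Rs. (case z of (j, r) \<Rightarrow> j * W + r) = n \<and>
          ?g n \<le> (case z of (j, r) \<Rightarrow> plog m (y / real W / real j) / (real W * real j))"
        using j1 jM by (intro bexI[of _ "(n div W, n mod W)"]) auto
    qed
  qed (use X in \<open>auto simp: X1_def Rs_def\<close>)
  also have "\<dots> = (\<Sum>j=1..M. real (card Rs) * (plog m (y / real W / real j) / (real W * real j)))"
    by (simp flip: sum.cartesian_product)
  also have "\<dots> = real (totient W) / real W * (\<Sum>j=1..M. plog m (y / real W / real j) / real j)"
    by (simp add: cardR sum_distrib_left)
  also have "\<dots> \<le> real (totient W) / real W * (plog m (y / real W) + plog (Suc m) (y / real W) / real (Suc m))"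
    using y by (intro mult_left_mono plog_sum_le) auto
  also have "\<dots> \<le> real (totient W) / real W * (plog m y + plog (Suc m) y / real (Suc m))"
    using W y divide_left_mono[of 1 "real W" y]
    by (intro mult_left_mono add_mono divide_right_mono monoD[OF mono_plog]) auto
  also have "\<dots> = real (totient W) / real W * plog m y + real (totient W) / real W * (plog (Suc m) y / real (Suc m))"
    by (simp add: algebra_simps)
  also have "\<dots> \<le> 1 * plog m y + real (totient W) / real W * (plog (Suc m) y / real (Suc m))"
    using W by (intro add_mono mult_right_mono) (auto simp: totient_le)
  finally have 1: "sum ?g X1 \<le> 1 * plog m y + real (totient W) / real W * (plog (Suc m) y / real (Suc m))" .
  have "X = X0 \<union> X1" "X0 \<inter> X1 = {}" by (auto simp: X0_def X1_def)
  moreover have "finite X0" "finite X1" using X by (auto simp: X0_def X1_def)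
  ultimately have "sum ?g X = sum ?g X0 + sum ?g X1"
    using sum.union_disjoint[of X0 X1 ?g] by simp
  then show ?thesis using 0 1 by (simp add: algebra_simps)
qed

text \<open>Convexity of powers hides a lower-order error term in a rescaling of the argument. The
  upper bound thus stays a single \<open>plog\<close> and can be iterated.\<close>

lemma plog_shift_ge:
  assumes "0 \<le> K" "0 \<le> y"
  shows "plog (Suc m) y + real (Suc m) * K * plog m y \<le> plog (Suc m) (y * exp K)"
proof (cases "1 \<le> y")
  case True
  have "1 * 1 \<le> y * exp K" using True assms by (intro mult_mono) auto
  moreover have "ln (y * exp K) = ln y + K" using True by (simp add: ln_mult)
  moreover have "real (Suc m) * ln y ^ m * (ln y + K - ln y) \<le> (ln y + K) ^ Suc m - ln y ^ Suc m"
    using True assms by (intro power_Suc_diff_ge) auto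
  ultimately show ?thesis using True by (simp add: plog_def algebra_simps)
qed (simp add: plog_def)

lemma prime_factors_prod_primes:
  fixes S :: "nat set"
  assumes "finite S" "\<And>p. p \<in> S \<Longrightarrow> prime p"
  shows "prime_factors (\<Prod>S) = S"
  using assms
proof (induction S)
  case (insert p S)
  have "0 \<notin> S" using insert.prems not_prime_0 by blast
  then have "\<Prod>S \<noteq> 0" using insert by (auto simp: prod_zero_iff)
  moreover have "prime p" using insert.prems by simp
  moreover from this have "p \<noteq> 0" by auto
  ultimately show ?case using insert
    by (simp add: prime_factorization_mult prime_factorization_prime)
qed simp

lemma inj_on_prod_primes:
  fixes P :: "nat set"
  assumes "finite P" "\<And>p. p \<in> P \<Longrightarrow> prime p"
  shows "inj_on \<Prod> (Pow P)"
proof (rule inj_onI)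
  fix S T assume *: "S \<in> Pow P" "T \<in> Pow P" "\<Prod>S = \<Prod>T"
  have pf: "prime_factors (\<Prod>U) = U" if "U \<in> Pow P" for U
    using that assms finite_subset[of U P] by (intro prime_factors_prod_primes) auto
  have "S = prime_factors (\<Prod>S)" by (rule pf[OF *(1), symmetric])
  also have "\<dots> = T" unfolding *(3) by (rule pf[OF *(2)])
  finally show "S = T" .
qed

lemma prod_primes_pos:
  fixes S :: "nat set"
  assumes "\<And>p. p \<in> S \<Longrightarrow> prime p"
  shows "0 < \<Prod>S"
  using assms prime_gt_0_nat by (intro prod_pos) auto

lemma prod_primes_ge_1:
  fixes S :: "nat set"
  assumes "\<And>p. p \<in> S \<Longrightarrow> prime p"
  shows "1 \<le> rprod S"
  using assms prime_ge_1_nat by (intro prod_ge_1) auto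

text \<open>Distinct S give distinct integers coprime to W, so squarefreeness is simply dropped. K
  is any constant large enough to express the error W + 1 as a shift of the logarithm.\<close>

lemma subset_sum_inverse_le:
  assumes P: "finite P" "\<And>p. p \<in> P \<Longrightarrow> prime p \<and> coprime p W"
    and W: "W \<ge> 1" and K: "real W + 1 \<le> real (totient W) / real W * K" and y: "0 \<le> y"
  shows "subset_sum (\<lambda>p. 1 / real p) P (plog m) y
       \<le> real (totient W) / real W / real (Suc m) * plog (Suc m) (y * exp K)"
proof -
  let ?c = "real (totient W) / real W"
  have c: "0 < ?c" using W by simp
  have K0: "0 \<le> K"
  proof (rule ccontr)
    assume "\<not> 0 \<le> K"
    then have "?c * K < 0" using c by (intro mult_pos_neg) auto
    then show False using K by simp
  qed
  have inj: "inj_on \<Prod> (Pow P)" using P by (intro inj_on_prod_primes) auto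
  have "subset_sum (\<lambda>p. 1 / real p) P (plog m) y = (\<Sum>S\<in>Pow P. plog m (y / real (\<Prod>S)) / real (\<Prod>S))"
    unfolding subset_sum_def by (intro sum.cong refl) (simp add: prod_dividef)
  also have "\<dots> = (\<Sum>n\<in>\<Prod> ` Pow P. plog m (y / real n) / real n)"
    by (subst sum.reindex[OF inj]) simp
  also have "\<dots> \<le> (real W + 1) * plog m y + ?c * (plog (Suc m) y / real (Suc m))"
  proof (rule coprime_plog_sum_le[OF W _ _ y])
    fix n assume "n \<in> \<Prod> ` Pow P"
    then obtain S where S: "S \<subseteq> P" "n = \<Prod>S" by auto
    have "0 < n" unfolding S using S P by (intro prod_primes_pos) auto
    moreover have "coprime n W" unfolding S using S P by (intro prod_coprime_left) auto
    ultimately show "n \<ge> 1 \<and> coprime n W" by simp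
  qed (use P in auto)
  also have "\<dots> \<le> ?c * K * plog m y + ?c * (plog (Suc m) y / real (Suc m))"
    using K by (intro add_mono mult_right_mono) auto
  also have "\<dots> = ?c / real (Suc m) * (plog (Suc m) y + real (Suc m) * K * plog m y)"
    by (simp add: distrib_left del: of_nat_Suc)
  also have "\<dots> \<le> ?c / real (Suc m) * plog (Suc m) (y * exp K)"
    using c by (intro mult_left_mono plog_shift_ge K0 y) auto
  finally show ?thesis .
qed

lemma fact_ratio_step:
  fixes c X :: real
  shows "c / real (Suc m) * (c ^ \<kappa> * (fact (Suc m) / fact (Suc m + \<kappa>)) * X)
       = c ^ Suc \<kappa> * (fact m / fact (m + Suc \<kappa>)) * X"
proof -
  have "(fact (Suc m) :: real) / real (Suc m) = fact m" by (simp add: fact_Suc del: of_nat_Suc)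
  then have "c * c ^ \<kappa> * (fact (Suc m) / real (Suc m)) / fact (Suc m + \<kappa>) * X
      = c ^ Suc \<kappa> * (fact m / fact (m + Suc \<kappa>)) * X"
    by (simp del: fact_Suc)
  then show ?thesis by (simp only: times_divide_eq_left times_divide_eq_right mult_ac divide_divide_eq_left)
qed

text \<open>Induction on the dimension: with (\<kappa>+1)/p = \<kappa>/p + 1/p the inner sum is
  one-dimensional. Each round gives one factor phi(W)/W, raises the power of the logarithm by one
  while dividing by the new exponent, and adds K to the shift.\<close>

lemma subset_sum_plog_le:
  assumes P: "finite P" "\<And>p. p \<in> P \<Longrightarrow> prime p \<and> coprime p W"
    and W: "W \<ge> 1" and K: "real W + 1 \<le> real (totient W) / real W * K" and x: "0 \<le> x"
  shows "subset_sum (\<lambda>p. real \<kappa> / real p) P (plog m) x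
       \<le> (real (totient W) / real W) ^ \<kappa> * (fact m / fact (m + \<kappa>)) * plog (m + \<kappa>) (x * exp (real \<kappa> * K))"
  using x
proof (induction \<kappa> arbitrary: m x)
  case 0
  show ?case using P by (simp add: subset_sum_zero)
next
  case (Suc \<kappa>)
  let ?c = "real (totient W) / real W"
  have c: "0 < ?c" using W by simp
  have "subset_sum (\<lambda>p. real (Suc \<kappa>) / real p) P (plog m) x
      = subset_sum (\<lambda>p. real \<kappa> / real p + 1 / real p) P (plog m) x"
    by (simp add: add_divide_distrib add.commute)
  also have "\<dots> = (\<Sum>S\<in>Pow P. (\<Prod>p\<in>S. real \<kappa> / real p)
               * subset_sum (\<lambda>p. 1 / real p) (P - S) (plog m) (x / rprod S))"
    by (rule subset_sum_add[OF P(1)])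
  also have "\<dots> \<le> (\<Sum>S\<in>Pow P. (\<Prod>p\<in>S. real \<kappa> / real p)
               * (?c / real (Suc m) * plog (Suc m) (x * exp K / rprod S)))"
  proof (intro sum_mono mult_left_mono prod_nonneg)
    fix S assume "S \<in> Pow P"
    have "subset_sum (\<lambda>p. 1 / real p) (P - S) (plog m) (x / rprod S)
       \<le> ?c / real (Suc m) * plog (Suc m) (x / rprod S * exp K)"
      using P W K Suc.prems by (intro subset_sum_inverse_le) (auto intro!: divide_nonneg_nonneg prod_nonneg)
    then show "subset_sum (\<lambda>p. 1 / real p) (P - S) (plog m) (x / rprod S)
       \<le> ?c / real (Suc m) * plog (Suc m) (x * exp K / rprod S)" by (simp add: mult.commute)
  qed auto
  also have "\<dots> = ?c / real (Suc m) * subset_sum (\<lambda>p. real \<kappa> / real p) P (plog (Suc m)) (x * exp K)"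
    unfolding subset_sum_def sum_distrib_left by (intro sum.cong refl) (simp only: mult_ac)
  also have "\<dots> \<le> ?c / real (Suc m) * (?c ^ \<kappa> * (fact (Suc m) / fact (Suc m + \<kappa>))
         * plog (Suc m + \<kappa>) (x * exp K * exp (real \<kappa> * K)))"
    using c Suc.prems by (intro mult_left_mono Suc.IH) auto
  also have "\<dots> = ?c ^ Suc \<kappa> * (fact m / fact (m + Suc \<kappa>)) * plog (m + Suc \<kappa>) (x * exp (real (Suc \<kappa>) * K))"
    unfolding fact_ratio_step by (simp add: distrib_right exp_add mult.assoc add.commute)
  finally show ?case .
qed

text \<open>
  The coefficient \<open>(p / (p - 1))\<^sup>\<kappa> - 1\<close> is exactly what \<open>\<kappa>\<close>-fold iteration of the one-dimensional lower
  bound produces, which is why there is no error term.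
\<close>

lemma subset_sum_plog_ge:
  assumes Q: "Q \<subseteq> {p. prime p \<and> p \<le> M}" and x: "0 \<le> x" "x < real (Suc M)"
  shows "(\<Prod>p\<in>Q. 1 - 1 / real p) ^ \<kappa> * (fact m / fact (m + \<kappa>)) * plog (m + \<kappa>) x
     \<le> subset_sum (\<lambda>p. (real p / (real p - 1)) ^ \<kappa> - 1) ({p. prime p \<and> p \<le> M} - Q) (plog m) x"
  using x
proof (induction \<kappa> arbitrary: m x)
  case 0
  show ?case by (simp add: subset_sum_zero)
next
  case (Suc \<kappa>)
  define P0 where "P0 = {p::nat. prime p \<and> p \<le> M}"
  define P where "P = P0 - Q"
  define c where "c = (\<Prod>p\<in>Q. 1 - 1 / real p)"
  let ?A = "\<lambda>\<kappa> p. (real p / (real p - 1)) ^ \<kappa> - 1"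
  have fin: "finite P0" "finite P" "finite Q"
    using Q finite_subset[of Q] by (auto simp: P0_def P_def)
  have gt1: "1 < real p" if "p \<in> P0" for p
    using that prime_gt_1_nat[of p] by (simp add: P0_def)
  have QP: "Q \<subseteq> P0" using Q by (simp add: P0_def)
  have frac0: "0 \<le> 1 - 1 / real p" if "p \<in> P0" for p
    using gt1[OF that] by simp
  have c0: "0 \<le> c" unfolding c_def using QP frac0 by (intro prod_nonneg) auto
  have A0: "0 \<le> ?A \<kappa> p" if "p \<in> P0" for p
    using gt1[OF that] by (simp add: one_le_power)
  have *: "(\<Prod>p\<in>S. 1 - 1 / real p) * c * (plog (Suc m) (x / rprod S) / real (Suc m))
        \<le> totient_sum (P - S) (plog m) (x / rprod S)"
    if S: "S \<in> Pow P" for S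
  proof -
    let ?y = "x / rprod S"
    have S': "S \<subseteq> P0" "S \<inter> Q = {}" "finite S" using S fin finite_subset by (auto simp: P_def)
    have y0: "0 \<le> ?y" using Suc.prems by (auto intro!: divide_nonneg_nonneg prod_nonneg)
    have "?y \<le> x" using Suc.prems prod_primes_ge_1[of S] S'
      divide_left_mono[of 1 "rprod S" x] by (auto simp: P0_def subset_iff)
    then have yM: "?y < real (Suc M)" using Suc.prems by linarith
    have "plog (Suc m) ?y / real (Suc m) \<le> (\<Sum>n=1..M. plog m (?y / real n) / real n)"
      by (rule plog_sum_ge[OF y0 yM])
    also have "\<dots> \<le> totient_sum P0 (plog m) ?y"
    proof (rule smooth_sum_le_subset_sum[OF _ _ _ _ mono_plog plog_nonneg y0])
      fix n assume "n \<in> {1..M}"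
      then show "0 < n \<and> prime_factors n \<subseteq> P0"
        by (auto simp: P0_def dest: dvd_imp_le)
          (meson dvd_imp_le in_prime_factors_imp_dvd le_trans less_eq_Suc_le)
    qed (auto simp: P0_def)
    finally have "(\<Prod>p\<in>S \<union> Q. 1 - 1 / real p) * (plog (Suc m) ?y / real (Suc m))
        \<le> (\<Prod>p\<in>S \<union> Q. 1 - 1 / real p) * totient_sum P0 (plog m) ?y"
      using QP S' frac0 by (intro mult_left_mono prod_nonneg) auto
    also have "\<dots> \<le> totient_sum (P0 - (S \<union> Q)) (plog m) ?y"
      using Q S' gt1 fin by (intro subset_sum_remove[OF _ _ _ mono_plog plog_nonneg y0]) (auto simp: P0_def)
    also have "P0 - (S \<union> Q) = P - S" by (auto simp: P_def)
    also have "(\<Prod>p\<in>S \<union> Q. 1 - 1 / real p) = (\<Prod>p\<in>S. 1 - 1 / real p) * c"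
      unfolding c_def by (rule prod.union_disjoint) (use S' fin in auto)
    finally show ?thesis .
  qed
  have "c ^ Suc \<kappa> * (fact m / fact (m + Suc \<kappa>)) * plog (m + Suc \<kappa>) x
     = c / real (Suc m) * (c ^ \<kappa> * (fact (Suc m) / fact (Suc m + \<kappa>)) * plog (Suc m + \<kappa>) x)"
    unfolding fact_ratio_step by simp
  also have "\<dots> \<le> c / real (Suc m) * subset_sum (?A \<kappa>) P (plog (Suc m)) x"
    unfolding c_def P_def P0_def using Suc.prems c0 by (intro mult_left_mono Suc.IH) (auto simp: c_def)
  \<comment> \<open>The factor p/(p - 1) put into each coefficient pays for the loss (1 - 1/p)
    incurred when the primes of S are removed from the inner sum.\<close>
  also have "\<dots> = (\<Sum>S\<in>Pow P. (\<Prod>p\<in>S. ?A \<kappa> p * (real p / (real p - 1)))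
        * ((\<Prod>p\<in>S. 1 - 1 / real p) * c * (plog (Suc m) (x / rprod S) / real (Suc m))))"
    unfolding subset_sum_def sum_distrib_left
  proof (intro sum.cong refl)
    fix S assume "S \<in> Pow P"
    then have "(\<Prod>p\<in>S. ?A \<kappa> p * (real p / (real p - 1))) * (\<Prod>p\<in>S. 1 - 1 / real p) = (\<Prod>p\<in>S. ?A \<kappa> p)"
      unfolding prod.distrib[symmetric]
    proof (intro prod.cong refl)
      fix p assume "S \<in> Pow P" "p \<in> S"
      then have "1 < real p" using gt1 by (auto simp: P_def)
      then have "real p / (real p - 1) * (1 - 1 / real p) = 1" by (simp add: field_simps)
      then show "?A \<kappa> p * (real p / (real p - 1)) * (1 - 1 / real p) = ?A \<kappa> p"
        by (simp only: mult.assoc mult_1_right)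
    qed
    then show "c / real (Suc m) * ((\<Prod>p\<in>S. ?A \<kappa> p) * plog (Suc m) (x / rprod S))
      = (\<Prod>p\<in>S. ?A \<kappa> p * (real p / (real p - 1)))
        * ((\<Prod>p\<in>S. 1 - 1 / real p) * c * (plog (Suc m) (x / rprod S) / real (Suc m)))"
      by (simp add: mult_ac)
  qed
  also have "\<dots> \<le> (\<Sum>S\<in>Pow P. (\<Prod>p\<in>S. ?A \<kappa> p * (real p / (real p - 1)))
        * totient_sum (P - S) (plog m) (x / rprod S))"
  proof (intro sum_mono mult_left_mono * prod_nonneg)
    fix S p assume "S \<in> Pow P" "p \<in> S"
    then have "p \<in> P0" by (auto simp: P_def)
    then show "0 \<le> ?A \<kappa> p * (real p / (real p - 1))"
      using A0[of p] gt1[of p] by (intro mult_nonneg_nonneg) auto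
  qed auto
  also have "\<dots> = subset_sum (\<lambda>p. ?A \<kappa> p * (real p / (real p - 1)) + 1 / (real p - 1)) P (plog m) x"
    by (rule subset_sum_add[OF fin(2), symmetric])
  also have "\<dots> = subset_sum (?A (Suc \<kappa>)) P (plog m) x"
  proof (rule subset_sum_cong)
    fix p assume "p \<in> P"
    then have "1 < real p" using gt1 by (auto simp: P_def)
    then have "1 / (real p - 1) = real p / (real p - 1) - 1" by (simp add: field_simps)
    then show "?A \<kappa> p * (real p / (real p - 1)) + 1 / (real p - 1) = ?A (Suc \<kappa>) p"
      by (simp only: power_Suc left_diff_distrib) simp
  qed
  finally show ?case by (simp only: c_def P_def P0_def)
qed

subsection \<open>Selberg's diagonalization\<close>

lemma sum_Pow_prod:
  fixes g :: "'a \<Rightarrow> real"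
  assumes "finite A"
  shows "(\<Sum>T\<in>Pow A. \<Prod>p\<in>T. g p) = (\<Prod>p\<in>A. 1 + g p)"
  using assms
proof (induction A)
  case (insert p A)
  have "(\<Sum>T\<in>Pow A. \<Prod>p\<in>insert p T. g p) = (\<Sum>T\<in>Pow A. g p * (\<Prod>p\<in>T. g p))"
  proof (intro sum.cong refl)
    fix T assume "T \<in> Pow A"
    then have "finite T" "p \<notin> T" using insert finite_subset by auto
    then show "(\<Prod>p\<in>insert p T. g p) = g p * (\<Prod>p\<in>T. g p)" by simp
  qed
  then show ?case
    unfolding sum_Pow_insert[OF insert.hyps(1,2)] using insert
    by (simp add: distrib_right flip: sum_distrib_left)
qed simp

lemma sum_supersets:
  fixes F :: "'a set \<Rightarrow> 'b::comm_monoid_add"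
  assumes "V \<subseteq> P"
  shows "sum F {S\<in>Pow P. V \<subseteq> S} = (\<Sum>U\<in>Pow (P - V). F (V \<union> U))"
proof (rule sum.reindex_bij_witness[where i = "\<lambda>U. V \<union> U" and j = "\<lambda>S. S - V"])
qed (use assms in \<open>auto simp: Un_absorb1\<close>)

lemma sum_between_prod:
  fixes g :: "'a \<Rightarrow> real"
  assumes "finite M" "V \<subseteq> M"
  shows "(\<Sum>S | V \<subseteq> S \<and> S \<subseteq> M. \<Prod>p\<in>S. g p) = (\<Prod>p\<in>V. g p) * (\<Prod>p\<in>M - V. 1 + g p)"
proof -
  have fin: "finite V" using assms finite_subset by auto
  have "{S. V \<subseteq> S \<and> S \<subseteq> M} = {S\<in>Pow M. V \<subseteq> S}" by auto
  then have "(\<Sum>S | V \<subseteq> S \<and> S \<subseteq> M. \<Prod>p\<in>S. g p) = (\<Sum>U\<in>Pow (M - V). \<Prod>p\<in>V \<union> U. g p)"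
    using sum_supersets[OF assms(2)] by simp
  also have "\<dots> = (\<Sum>U\<in>Pow (M - V). (\<Prod>p\<in>V. g p) * (\<Prod>p\<in>U. g p))"
  proof (intro sum.cong refl prod.union_disjoint)
    fix U assume "U \<in> Pow (M - V)"
    then show "finite U" "V \<inter> U = {}" using assms finite_subset[of U M] by auto
  qed (rule fin)
  also have "\<dots> = (\<Prod>p\<in>V. g p) * (\<Prod>p\<in>M - V. 1 + g p)"
    using assms by (simp add: sum_Pow_prod flip: sum_distrib_left)
  finally show ?thesis .
qed

text \<open>Selberg's weights recovered from prescribed diagonal variables y: the sum runs over the
  multiples V of S, and the signs of -1/\<omega> supply the Moebius function. In the application
  \<omega>(p) = k/p is the proportion of classes hit, and a(p) = k/(p - k) is \<omega>/(1 -
  \<omega>).\<close>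

definition sieve_weight ::
    "(nat \<Rightarrow> real) \<Rightarrow> (nat \<Rightarrow> real) \<Rightarrow> (nat set \<Rightarrow> real) \<Rightarrow> nat set \<Rightarrow> nat set \<Rightarrow> real" where
  "sieve_weight \<omega> a y P S = (\<Prod>p\<in>S. - 1 / \<omega> p) * (\<Sum>V | S \<subseteq> V \<and> V \<subseteq> P. y V * (\<Prod>p\<in>V. a p))"

text \<open>Moebius inversion tested against a second density. If \<omega>' = \<omega>, every
  nonempty U has a zero factor and y(V) comes back up to a product over V; for the density of
  primes, a(1 - \<omega>'/\<omega>) will be 1/(p - 1).\<close>

lemma sieve_weight_superset_sum:
  assumes P: "finite P" "V \<subseteq> P"
  shows "(\<Sum>S | V \<subseteq> S \<and> S \<subseteq> P. sieve_weight \<omega> a y P S * (\<Prod>p\<in>S. \<omega>' p))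
    = (\<Prod>p\<in>V. - (\<omega>' p / \<omega> p) * a p) * (\<Sum>U\<in>Pow (P - V). y (V \<union> U) * (\<Prod>p\<in>U. a p * (1 - \<omega>' p / \<omega> p)))"
proof -
  let ?g = "\<lambda>p. - (\<omega>' p / \<omega> p)"
  have finP: "finite {S. V \<subseteq> S \<and> S \<subseteq> P}" for V
    using P by (auto intro: finite_subset[of _ "Pow P"])
  have "(\<Sum>S | V \<subseteq> S \<and> S \<subseteq> P. sieve_weight \<omega> a y P S * (\<Prod>p\<in>S. \<omega>' p))
     = (\<Sum>S | V \<subseteq> S \<and> S \<subseteq> P. \<Sum>M | S \<subseteq> M \<and> M \<subseteq> P. (\<Prod>p\<in>S. ?g p) * (y M * (\<Prod>p\<in>M. a p)))"
  proof (intro sum.cong refl)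
    fix S
    have eq: "(\<Prod>p\<in>S. ?g p) = (\<Prod>p\<in>S. - 1 / \<omega> p) * (\<Prod>p\<in>S. \<omega>' p)"
      by (simp flip: prod.distrib)
    show "sieve_weight \<omega> a y P S * (\<Prod>p\<in>S. \<omega>' p)
        = (\<Sum>M | S \<subseteq> M \<and> M \<subseteq> P. (\<Prod>p\<in>S. ?g p) * (y M * (\<Prod>p\<in>M. a p)))"
      unfolding sieve_weight_def sum_distrib_left[symmetric] eq by (simp only: mult_ac)
  qed
  \<comment> \<open>After the swap, the sum over S between V and M is a product of the factors 1 -
    \<omega>'/\<omega> over M - V.\<close>
  also have "\<dots> = (\<Sum>M | V \<subseteq> M \<and> M \<subseteq> P. \<Sum>S | V \<subseteq> S \<and> S \<subseteq> M. (\<Prod>p\<in>S. ?g p) * (y M * (\<Prod>p\<in>M. a p)))"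
  proof -
    have "(\<Sum>S | V \<subseteq> S \<and> S \<subseteq> P. \<Sum>M | M \<in> {M. V \<subseteq> M \<and> M \<subseteq> P} \<and> S \<subseteq> M. (\<Prod>p\<in>S. ?g p) * (y M * (\<Prod>p\<in>M. a p)))
       = (\<Sum>M | V \<subseteq> M \<and> M \<subseteq> P. \<Sum>S | S \<in> {S. V \<subseteq> S \<and> S \<subseteq> P} \<and> S \<subseteq> M. (\<Prod>p\<in>S. ?g p) * (y M * (\<Prod>p\<in>M. a p)))"
      by (rule sum.swap_restrict) (use finP in auto)
    moreover have "{M. M \<in> {M. V \<subseteq> M \<and> M \<subseteq> P} \<and> S \<subseteq> M} = {M. S \<subseteq> M \<and> M \<subseteq> P}"
      if "S \<in> {S. V \<subseteq> S \<and> S \<subseteq> P}" for S using that by auto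
    moreover have "{S. S \<in> {S. V \<subseteq> S \<and> S \<subseteq> P} \<and> S \<subseteq> M} = {S. V \<subseteq> S \<and> S \<subseteq> M}"
      if "M \<in> {S. V \<subseteq> S \<and> S \<subseteq> P}" for M using that by auto
    ultimately show ?thesis by (smt (verit, ccfv_SIG) sum.cong)
  qed
  also have "\<dots> = (\<Sum>M | V \<subseteq> M \<and> M \<subseteq> P. ((\<Prod>p\<in>V. ?g p) * (\<Prod>p\<in>M - V. 1 + ?g p)) * (y M * (\<Prod>p\<in>M. a p)))"
  proof (intro sum.cong refl)
    fix M assume "M \<in> {M. V \<subseteq> M \<and> M \<subseteq> P}"
    then have "finite M" "V \<subseteq> M" using P finite_subset by auto
    then show "(\<Sum>S | V \<subseteq> S \<and> S \<subseteq> M. (\<Prod>p\<in>S. ?g p) * (y M * (\<Prod>p\<in>M. a p)))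
       = ((\<Prod>p\<in>V. ?g p) * (\<Prod>p\<in>M - V. 1 + ?g p)) * (y M * (\<Prod>p\<in>M. a p))"
      unfolding sum_distrib_right[symmetric] by (simp only: sum_between_prod)
  qed
  also have "\<dots> = (\<Sum>M\<in>{S\<in>Pow P. V \<subseteq> S}. ((\<Prod>p\<in>V. ?g p) * (\<Prod>p\<in>M - V. 1 + ?g p)) * (y M * (\<Prod>p\<in>M. a p)))"
    by (intro sum.cong) auto
  also have "(\<Sum>M\<in>{S\<in>Pow P. V \<subseteq> S}. ((\<Prod>p\<in>V. ?g p) * (\<Prod>p\<in>M - V. 1 + ?g p)) * (y M * (\<Prod>p\<in>M. a p)))
     = (\<Sum>U\<in>Pow (P - V). ((\<Prod>p\<in>V. ?g p) * (\<Prod>p\<in>(V \<union> U) - V. 1 + ?g p)) * (y (V \<union> U) * (\<Prod>p\<in>V \<union> U. a p)))"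
    by (rule sum_supersets[OF P(2)])
  also have "\<dots> = (\<Sum>U\<in>Pow (P - V). (\<Prod>p\<in>V. ?g p * a p) * (y (V \<union> U) * (\<Prod>p\<in>U. a p * (1 - \<omega>' p / \<omega> p))))"
  proof (intro sum.cong refl)
    fix U assume "U \<in> Pow (P - V)"
    then have U: "finite U" "V \<inter> U = {}" "finite V" "(V \<union> U) - V = U"
      using P finite_subset[of U P] finite_subset[of V P] by auto
    then have "(\<Prod>p\<in>V \<union> U. a p) = (\<Prod>p\<in>V. a p) * (\<Prod>p\<in>U. a p)"
      by (intro prod.union_disjoint) auto
    then show "((\<Prod>p\<in>V. ?g p) * (\<Prod>p\<in>(V \<union> U) - V. 1 + ?g p)) * (y (V \<union> U) * (\<Prod>p\<in>V \<union> U. a p))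
       = (\<Prod>p\<in>V. ?g p * a p) * (y (V \<union> U) * (\<Prod>p\<in>U. a p * (1 - \<omega>' p / \<omega> p)))"
      unfolding U(4) prod.distrib by simp
  qed
  finally show ?thesis by (simp only: sum_distrib_left)
qed

text \<open>A multiplicative f at an lcm is f(S) f(T) / f(gcd). Expanding 1/f over the subsets of
  the intersection separates S from T.\<close>

lemma prod_union_inverse:
  fixes f :: "'a \<Rightarrow> real"
  assumes fin: "finite S" "finite T" and nz: "\<And>p. p \<in> S \<inter> T \<Longrightarrow> f p \<noteq> 0"
  shows "(\<Prod>p\<in>S \<union> T. f p) = (\<Prod>p\<in>S. f p) * (\<Prod>p\<in>T. f p) * (\<Sum>V\<in>Pow (S \<inter> T). \<Prod>p\<in>V. 1 / f p - 1)"
proof -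
  have "(\<Sum>V\<in>Pow (S \<inter> T). \<Prod>p\<in>V. 1 / f p - 1) = (\<Prod>p\<in>S \<inter> T. 1 / f p)"
    using fin by (subst sum_Pow_prod) auto
  moreover have "(\<Prod>p\<in>S \<inter> T. f p) * (\<Prod>p\<in>S \<inter> T. 1 / f p) = 1"
    unfolding prod.distrib[symmetric] using nz by (intro prod.neutral) auto
  moreover have "(\<Prod>p\<in>S \<union> T. f p) * (\<Prod>p\<in>S \<inter> T. f p) = (\<Prod>p\<in>S. f p) * (\<Prod>p\<in>T. f p)"
    using fin by (rule prod.union_inter)
  ultimately show ?thesis by (metis mult.assoc mult.right_neutral)
qed

text \<open>The density of the form may differ from the one that defines the weights, so the same
  weights serve both the total mass and the prime mass.\<close>

lemma selberg_diagonalization: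
  assumes P: "finite P" and nz: "\<And>p. p \<in> P \<Longrightarrow> \<omega>' p \<noteq> 0"
  shows "(\<Sum>S\<in>Pow P. \<Sum>T\<in>Pow P. sieve_weight \<omega> a y P S * sieve_weight \<omega> a y P T * (\<Prod>p\<in>S \<union> T. \<omega>' p))
    = (\<Sum>V\<in>Pow P. (\<Prod>p\<in>V. (1 / \<omega>' p - 1) * (\<omega>' p / \<omega> p * a p)\<^sup>2)
         * (\<Sum>U\<in>Pow (P - V). y (V \<union> U) * (\<Prod>p\<in>U. a p * (1 - \<omega>' p / \<omega> p)))\<^sup>2)"
proof -
  define l where "l = (\<lambda>S. sieve_weight \<omega> a y P S * (\<Prod>p\<in>S. \<omega>' p))"
  define h where "h = (\<lambda>V. \<Prod>p\<in>V. 1 / \<omega>' p - 1)"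
  have fin: "finite S" if "S \<in> Pow P" for S using that P finite_subset by auto
  have "(\<Sum>S\<in>Pow P. \<Sum>T\<in>Pow P. sieve_weight \<omega> a y P S * sieve_weight \<omega> a y P T * (\<Prod>p\<in>S \<union> T. \<omega>' p))
     = (\<Sum>S\<in>Pow P. \<Sum>T\<in>Pow P. \<Sum>V\<in>Pow P. h V * ((l S * of_bool (V \<subseteq> S)) * (l T * of_bool (V \<subseteq> T))))"
  proof (intro sum.cong refl)
    fix S T assume ST: "S \<in> Pow P" "T \<in> Pow P"
    have "(\<Sum>V\<in>Pow (S \<inter> T). h V) = (\<Sum>V\<in>Pow P. h V * (of_bool (V \<subseteq> S) * of_bool (V \<subseteq> T)))"
      by (rule sum.mono_neutral_cong_left) (use ST P in auto)
    moreover have "(\<Prod>p\<in>S \<union> T. \<omega>' p) = (\<Prod>p\<in>S. \<omega>' p) * (\<Prod>p\<in>T. \<omega>' p) * (\<Sum>V\<in>Pow (S \<inter> T). h V)"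
      unfolding h_def using ST fin nz by (intro prod_union_inverse) auto
    ultimately have "sieve_weight \<omega> a y P S * sieve_weight \<omega> a y P T * (\<Prod>p\<in>S \<union> T. \<omega>' p)
        = l S * l T * (\<Sum>V\<in>Pow P. h V * (of_bool (V \<subseteq> S) * of_bool (V \<subseteq> T)))"
      by (simp add: l_def)
    then show "sieve_weight \<omega> a y P S * sieve_weight \<omega> a y P T * (\<Prod>p\<in>S \<union> T. \<omega>' p)
        = (\<Sum>V\<in>Pow P. h V * ((l S * of_bool (V \<subseteq> S)) * (l T * of_bool (V \<subseteq> T))))"
      by (simp add: sum_distrib_left mult_ac)
  qed
  also have "\<dots> = (\<Sum>S\<in>Pow P. \<Sum>V\<in>Pow P. \<Sum>T\<in>Pow P. h V * ((l S * of_bool (V \<subseteq> S)) * (l T * of_bool (V \<subseteq> T))))"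
    by (intro sum.cong refl sum.swap)
  also have "\<dots> = (\<Sum>V\<in>Pow P. \<Sum>S\<in>Pow P. \<Sum>T\<in>Pow P. h V * ((l S * of_bool (V \<subseteq> S)) * (l T * of_bool (V \<subseteq> T))))"
    by (rule sum.swap)
  also have "\<dots> = (\<Sum>V\<in>Pow P. h V * (\<Sum>S\<in>Pow P. l S * of_bool (V \<subseteq> S))\<^sup>2)"
    unfolding power2_eq_square sum_product by (simp only: sum_distrib_left)
  also have "\<dots> = (\<Sum>V\<in>Pow P. h V * (\<Sum>S | V \<subseteq> S \<and> S \<subseteq> P. l S)\<^sup>2)"
  proof -
    have "(\<Sum>S\<in>Pow P. l S * of_bool (V \<subseteq> S)) = (\<Sum>S | V \<subseteq> S \<and> S \<subseteq> P. l S)" for V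
      by (rule sum.mono_neutral_cong_right) (use P in auto)
    then show ?thesis by (simp only:)
  qed
  also have "\<dots> = (\<Sum>V\<in>Pow P. h V * ((\<Prod>p\<in>V. - (\<omega>' p / \<omega> p) * a p)
         * (\<Sum>U\<in>Pow (P - V). y (V \<union> U) * (\<Prod>p\<in>U. a p * (1 - \<omega>' p / \<omega> p))))\<^sup>2)"
    unfolding l_def using P by (intro sum.cong refl) (simp add: sieve_weight_superset_sum)
  also have "\<dots> = (\<Sum>V\<in>Pow P. (\<Prod>p\<in>V. (1 / \<omega>' p - 1) * (\<omega>' p / \<omega> p * a p)\<^sup>2)
         * (\<Sum>U\<in>Pow (P - V). y (V \<union> U) * (\<Prod>p\<in>U. a p * (1 - \<omega>' p / \<omega> p)))\<^sup>2)"
    unfolding h_def prod.distrib power_mult_distrib prod_power_distrib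
    by (simp add: mult_ac)
  finally show ?thesis .
qed

lemma subset_sum_Un_disjoint:
  assumes "finite S" "finite P" "S \<inter> P = {}"
  shows "subset_sum a (S \<union> P) f x = subset_sum a S (subset_sum a P f) x"
  using assms
proof (induction S arbitrary: x)
  case (insert p S)
  then have "finite (S \<union> P)" "p \<notin> S \<union> P" by auto
  then show ?case using insert by (simp add: subset_sum_insert)
qed simp

text \<open>The relation a/\<omega> = 1 + a turns the prefactor over S into a sum over subsets Q of
  S. Since R/S <= R/Q, this sum and the one over \<open>P - S\<close> merge into a single sum over P
  that does not depend on S.\<close>

lemma abs_sieve_weight_le:
  assumes P: "finite P" "\<And>p. p \<in> P \<Longrightarrow> prime p" and S: "S \<subseteq> P"
    and \<omega>: "\<And>p. p \<in> P \<Longrightarrow> 0 < \<omega> p \<and> 0 \<le> a p \<and> a p / \<omega> p = 1 + a p"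
    and y: "\<And>V. V \<subseteq> P \<Longrightarrow> 0 \<le> y V \<and> y V \<le> B * plog 0 (R / rprod V)"
    and B: "0 \<le> B" and R: "0 \<le> R"
  shows "\<bar>sieve_weight \<omega> a y P S\<bar> \<le> B * subset_sum a P (plog 0) R * plog 0 (R / rprod S)"
proof -
  have finS: "finite S" using P S finite_subset by auto
  have a0: "0 \<le> a p" if "p \<in> P" for p using \<omega>[OF that] by simp
  have split: "(\<Prod>p\<in>S \<union> U. g p) = (\<Prod>p\<in>S. g p) * (\<Prod>p\<in>U. g p)"
    if "U \<in> Pow (P - S)" for U and g :: "nat \<Rightarrow> real"
    using that P finS finite_subset[of U P] by (intro prod.union_disjoint) auto
  have set_eq: "{V. S \<subseteq> V \<and> V \<subseteq> P} = {V\<in>Pow P. S \<subseteq> V}" by auto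
  have eq: "sieve_weight \<omega> a y P S
      = (\<Prod>p\<in>S. - 1 / \<omega> p) * (\<Sum>U\<in>Pow (P - S). y (S \<union> U) * (\<Prod>p\<in>S \<union> U. a p))"
    unfolding sieve_weight_def set_eq by (simp only: sum_supersets[OF S])
  have "\<bar>\<Prod>p\<in>S. - 1 / \<omega> p\<bar> = (\<Prod>p\<in>S. 1 / \<omega> p)"
    unfolding abs_prod using \<omega> S by (intro prod.cong) (auto simp: abs_of_pos)
  then have "\<bar>sieve_weight \<omega> a y P S\<bar> = (\<Prod>p\<in>S. 1 / \<omega> p) * \<bar>\<Sum>U\<in>Pow (P - S). y (S \<union> U) * (\<Prod>p\<in>S \<union> U. a p)\<bar>"
    unfolding eq abs_mult by simp
  also have "\<dots> \<le> (\<Prod>p\<in>S. 1 / \<omega> p) * (\<Sum>U\<in>Pow (P - S).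
       B * plog 0 (R / rprod S / rprod U) * ((\<Prod>p\<in>S. a p) * (\<Prod>p\<in>U. a p)))"
  proof (intro mult_left_mono order_trans[OF sum_abs] sum_mono)
    fix U assume U: "U \<in> Pow (P - S)"
    then have SU: "S \<union> U \<subseteq> P" using S by auto
    have "\<bar>y (S \<union> U) * (\<Prod>p\<in>S \<union> U. a p)\<bar> = y (S \<union> U) * (\<Prod>p\<in>S \<union> U. a p)"
      using y[OF SU] a0 SU by (intro abs_of_nonneg mult_nonneg_nonneg prod_nonneg) auto
    also have "\<dots> \<le> B * plog 0 (R / rprod (S \<union> U)) * (\<Prod>p\<in>S \<union> U. a p)"
      using y[OF SU] a0 SU by (intro mult_right_mono prod_nonneg) auto
    also have "\<dots> = B * plog 0 (R / rprod S / rprod U) * ((\<Prod>p\<in>S. a p) * (\<Prod>p\<in>U. a p))"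
      unfolding split[OF U] by simp
    finally show "\<bar>y (S \<union> U) * (\<Prod>p\<in>S \<union> U. a p)\<bar> \<le> \<dots>" .
  next
    show "0 \<le> (\<Prod>p\<in>S. 1 / \<omega> p)" using \<omega> S by (intro prod_nonneg) force
  qed
  also have "\<dots> = B * (((\<Prod>p\<in>S. 1 / \<omega> p) * (\<Prod>p\<in>S. a p)) * subset_sum a (P - S) (plog 0) (R / rprod S))"
    unfolding subset_sum_def sum_distrib_left by (intro sum.cong refl) (simp only: mult_ac)
  also have "(\<Prod>p\<in>S. 1 / \<omega> p) * (\<Prod>p\<in>S. a p) = (\<Prod>p\<in>S. 1 + a p)"
    unfolding prod.distrib[symmetric] using \<omega> S by (intro prod.cong) (auto simp: subset_iff)
  finally have 1: "\<bar>sieve_weight \<omega> a y P S\<bar>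
      \<le> B * ((\<Prod>p\<in>S. 1 + a p) * subset_sum a (P - S) (plog 0) (R / rprod S))" .
  show ?thesis
  proof (cases "1 \<le> R / rprod S")
    case True
    have "(\<Prod>p\<in>S. 1 + a p) * subset_sum a (P - S) (plog 0) (R / rprod S)
       = (\<Sum>Q\<in>Pow S. (\<Prod>p\<in>Q. a p) * subset_sum a (P - S) (plog 0) (R / rprod S))"
      by (simp add: sum_Pow_prod[OF finS, symmetric] sum_distrib_right)
    also have "\<dots> \<le> subset_sum a S (subset_sum a (P - S) (plog 0)) R"
      unfolding subset_sum_def[of a S]
    proof (intro sum_mono mult_left_mono)
      fix Q assume Q: "Q \<in> Pow S"
      have "rprod S = rprod Q * rprod (S - Q)"
        using prod.subset_diff[of Q S real] Q finS by (simp add: mult.commute)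
      moreover have "1 \<le> rprod (S - Q)" "1 \<le> rprod Q"
        using S P Q by (auto intro!: prod_primes_ge_1)
      ultimately have "R / rprod S \<le> R / rprod Q"
        using R by (intro divide_left_mono) (auto simp: mult_le_cancel_left1)
      then show "subset_sum a (P - S) (plog 0) (R / rprod S)
          \<le> subset_sum a (P - S) (plog 0) (R / rprod Q)"
        using a0 by (intro subset_sum_mono_arg mono_plog) auto
      show "0 \<le> (\<Prod>p\<in>Q. a p)" using Q S a0 by (intro prod_nonneg) auto
    qed
    also have "\<dots> = subset_sum a P (plog 0) R"
      using subset_sum_Un_disjoint[of S "P - S" a "plog 0" R] finS P S by (simp add: Un_absorb1)
    finally show ?thesis
      using 1 True B by (simp add: plog_def) (meson mult_left_mono order_trans)
  next
    case False
    have "subset_sum a (P - S) (plog 0) (R / rprod S) = 0"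
      unfolding subset_sum_def
    proof (intro sum.neutral ballI)
      fix U assume U: "U \<in> Pow (P - S)"
      then have "1 \<le> rprod U"
        using P by (intro prod_primes_ge_1) auto
      then have "R / rprod S / rprod U \<le> R / rprod S / 1"
        using R \<open>1 \<le> rprod U\<close>
        by (intro divide_left_mono divide_nonneg_nonneg prod_nonneg) auto
      then show "(\<Prod>p\<in>U. a p) * plog 0 (R / rprod S / rprod U) = 0"
        using False by (simp add: plog_def)
    qed
    then show ?thesis using 1 False by (simp add: plog_def)
  qed
qed

text \<open>Every element of a union lies in S only, in T only, or in both.\<close>

lemma sum_Pow_union_pairs:
  fixes F :: "'a set \<Rightarrow> real"
  assumes "finite P"
  shows "(\<Sum>S\<in>Pow P. \<Sum>T\<in>Pow P. F (S \<union> T)) = (\<Sum>U\<in>Pow P. 3 ^ card U * F U)"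
  using assms
proof (induction P arbitrary: F)
  case (insert p P)
  have "(\<Sum>S\<in>Pow (insert p P). \<Sum>T\<in>Pow (insert p P). F (S \<union> T))
     = (\<Sum>S\<in>Pow P. \<Sum>T\<in>Pow P. F (S \<union> T)) + 3 * (\<Sum>S\<in>Pow P. \<Sum>T\<in>Pow P. F (insert p (S \<union> T)))"
    unfolding sum_Pow_insert[OF insert.hyps(1,2)] by (simp add: sum.distrib flip: sum_distrib_left)
  also have "\<dots> = (\<Sum>U\<in>Pow P. 3 ^ card U * F U) + (\<Sum>U\<in>Pow P. 3 ^ card (insert p U) * F (insert p U))"
  proof -
    have "3 * (\<Sum>U\<in>Pow P. 3 ^ card U * F (insert p U)) = (\<Sum>U\<in>Pow P. 3 ^ card (insert p U) * F (insert p U))"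
      unfolding sum_distrib_left
    proof (intro sum.cong refl)
      fix U assume "U \<in> Pow P"
      then have "finite U" "p \<notin> U" using insert finite_subset by auto
      then show "3 * (3 ^ card U * F (insert p U)) = 3 ^ card (insert p U) * F (insert p U)" by simp
    qed
    then show ?thesis using insert.IH[of F] insert.IH[of "\<lambda>U. F (insert p U)"] by simp
  qed
  finally show ?case unfolding sum_Pow_insert[OF insert.hyps(1,2)] .
qed simp

text \<open>The weights are supported on numbers up to R, so an lcm of two of them is at most R^2.
  This is what ties R^2 to the level of distribution.\<close>

lemma sieve_remainder_le:
  assumes P: "finite P" "\<And>p. p \<in> P \<Longrightarrow> prime p"
    and l: "\<And>S. S \<subseteq> P \<Longrightarrow> \<bar>l S\<bar> \<le> \<Lambda> * plog 0 (R / rprod S)"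
    and e: "\<And>U. U \<subseteq> P \<Longrightarrow> 0 \<le> e U" and R: "0 \<le> R" and \<Lambda>: "0 \<le> \<Lambda>"
  shows "(\<Sum>S\<in>Pow P. \<Sum>T\<in>Pow P. \<bar>l S * l T\<bar> * e (S \<union> T))
       \<le> \<Lambda>\<^sup>2 * (\<Sum>U | U \<subseteq> P \<and> rprod U \<le> R\<^sup>2. 3 ^ card U * e U)"
proof -
  let ?I = "\<lambda>U. of_bool (rprod U \<le> R\<^sup>2) :: real"
  have "(\<Sum>S\<in>Pow P. \<Sum>T\<in>Pow P. \<bar>l S * l T\<bar> * e (S \<union> T))
     \<le> (\<Sum>S\<in>Pow P. \<Sum>T\<in>Pow P. \<Lambda>\<^sup>2 * (?I (S \<union> T) * e (S \<union> T)))"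
  proof (intro sum_mono)
    fix S T assume ST: "S \<in> Pow P" "T \<in> Pow P"
    have fin: "finite S" "finite T" using ST P finite_subset by auto
    have ge1: "1 \<le> rprod S" "1 \<le> rprod T" "1 \<le> rprod (S \<inter> T)" "1 \<le> rprod (S \<union> T)"
      using ST P by (auto intro!: prod_primes_ge_1)
    have "\<bar>l S * l T\<bar> \<le> \<Lambda> * plog 0 (R / rprod S) * (\<Lambda> * plog 0 (R / rprod T))"
      unfolding abs_mult using ST l \<Lambda> by (intro mult_mono) auto
    also have "\<dots> \<le> \<Lambda>\<^sup>2 * ?I (S \<union> T)"
    proof (cases "rprod S \<le> R \<and> rprod T \<le> R")
      case True
      have "rprod (S \<union> T) * 1 \<le> rprod (S \<union> T) * rprod (S \<inter> T)"
        using ge1 by (intro mult_left_mono) auto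
      also have "\<dots> = rprod S * rprod T" by (rule prod.union_inter[OF fin])
      also have "\<dots> \<le> R * R" using True ge1 R by (intro mult_mono) auto
      finally have "rprod (S \<union> T) \<le> R\<^sup>2" by (simp add: power2_eq_square)
      moreover have "plog 0 z \<le> 1" for z by (simp add: plog_def)
      then have "(\<Lambda> * plog 0 (R / rprod S)) * (\<Lambda> * plog 0 (R / rprod T)) \<le> (\<Lambda> * 1) * (\<Lambda> * 1)"
        using \<Lambda> by (intro mult_mono) auto
      ultimately show ?thesis by (simp add: power2_eq_square)
    next
      case False
      then have "plog 0 (R / rprod S) = 0 \<or> plog 0 (R / rprod T) = 0"
        using ge1 by (auto simp: plog_def le_divide_eq)
      then show ?thesis by auto
    qed
    finally show "\<bar>l S * l T\<bar> * e (S \<union> T) \<le> \<Lambda>\<^sup>2 * (?I (S \<union> T) * e (S \<union> T))"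
      using e[of "S \<union> T"] ST by (simp add: mult.assoc[symmetric] mult_right_mono)
  qed
  also have "\<dots> = (\<Sum>U\<in>Pow P. 3 ^ card U * (\<Lambda>\<^sup>2 * (?I U * e U)))"
    by (rule sum_Pow_union_pairs[OF P(1)])
  also have "\<dots> = \<Lambda>\<^sup>2 * (\<Sum>U\<in>Pow P. ?I U * (3 ^ card U * e U))"
    by (simp add: sum_distrib_left mult_ac)
  also have "(\<Sum>U\<in>Pow P. ?I U * (3 ^ card U * e U)) = (\<Sum>U | U \<subseteq> P \<and> rprod U \<le> R\<^sup>2. 3 ^ card U * e U)"
    by (rule sum.mono_neutral_cong_right) (use P in auto)
  finally show ?thesis .
qed

subsection \<open>Residue classes\<close>

lemma card_residues_coprime_mult:
  fixes M q :: nat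
  assumes "coprime M q" "0 < M" "0 < q"
  shows "card {b. b < M * q \<and> A (b mod M) \<and> B (b mod q)} = card {x. x < M \<and> A x} * card {r. r < q \<and> B r}"
proof -
  have "bij_betw (\<lambda>b. (b mod M, b mod q)) {b. b < M * q \<and> A (b mod M) \<and> B (b mod q)}
          ({x. x < M \<and> A x} \<times> {r. r < q \<and> B r})"
    unfolding bij_betw_def
  proof
    show "inj_on (\<lambda>b. (b mod M, b mod q)) {b. b < M * q \<and> A (b mod M) \<and> B (b mod q)}"
    proof (rule inj_onI)
      fix b c assume bc: "b \<in> {b. b < M * q \<and> A (b mod M) \<and> B (b mod q)}"
        "c \<in> {b. b < M * q \<and> A (b mod M) \<and> B (b mod q)}" "(b mod M, b mod q) = (c mod M, c mod q)"
      then have "[b = c] (mod M)" "[b = c] (mod q)" by (auto simp: cong_def)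
      then have "[b = c] (mod M * q)" using assms coprime_cong_mult_nat by blast
      then show "b = c" using bc by (auto simp: cong_def)
    qed
    show "(\<lambda>b. (b mod M, b mod q)) ` {b. b < M * q \<and> A (b mod M) \<and> B (b mod q)}
        = {x. x < M \<and> A x} \<times> {r. r < q \<and> B r}"
    proof (intro equalityI subsetI)
      fix z assume "z \<in> {x. x < M \<and> A x} \<times> {r. r < q \<and> B r}"
      then obtain x r where z: "z = (x, r)" "x < M" "A x" "r < q" "B r" by auto
      obtain b where b: "b < M * q" "[b = x] (mod M)" "[b = r] (mod q)"
        using binary_chinese_remainder_unique_nat[of M q x r] assms by auto
      then have "b mod M = x" "b mod q = r" using z by (auto simp: cong_def)
      then show "z \<in> (\<lambda>b. (b mod M, b mod q)) ` {b. b < M * q \<and> A (b mod M) \<and> B (b mod q)}"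
        using z b by (intro image_eqI[of _ _ b]) auto
    qed (use assms in auto)
  qed
  then have "card {b. b < M * q \<and> A (b mod M) \<and> B (b mod q)}
     = card ({x. x < M \<and> A x} \<times> {r. r < q \<and> B r})" by (rule bij_betw_same_card)
  then show ?thesis by (simp add: card_cartesian_product)
qed

lemma card_residues_prod_primes:
  fixes W :: nat
  assumes "finite U" "\<And>p. p \<in> U \<Longrightarrow> prime p \<and> coprime p W" and W: "0 < W"
  shows "card {b. b < W * \<Prod>U \<and> A (b mod W) \<and> (\<forall>p\<in>U. B p (b mod p))}
       = card {x. x < W \<and> A x} * (\<Prod>p\<in>U. card {r. r < p \<and> B p r})"
  using assms(1,2)
proof (induction U)
  case empty
  have "{b. b < W \<and> A (b mod W)} = {x. x < W \<and> A x}" by auto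
  then show ?case by simp
next
  case (insert p U)
  have "0 < \<Prod>U" using insert by (intro prod_primes_pos) auto
  then have pos: "0 < W * \<Prod>U" using W by simp
  have p: "prime p" "coprime p W" using insert by auto
  have "coprime (\<Prod>U) p"
  proof (rule prod_coprime_left)
    fix q assume "q \<in> U"
    then show "coprime q p" using insert p by (intro primes_coprime) auto
  qed
  then have cop: "coprime (W * \<Prod>U) p" using p by (simp add: coprime_commute)
  have set_eq: "{b. b < W * \<Prod>(insert p U) \<and> A (b mod W) \<and> (\<forall>q\<in>insert p U. B q (b mod q))}
      = {b. b < (W * \<Prod>U) * p \<and> (A (b mod (W * \<Prod>U) mod W) \<and> (\<forall>q\<in>U. B q (b mod (W * \<Prod>U) mod q))) \<and> B p (b mod p)}"
  proof -
    have "b mod (W * \<Prod>U) mod W = b mod W" for b by (simp add: mod_mod_cancel)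
    moreover have "b mod (W * \<Prod>U) mod q = b mod q" if "q \<in> U" for b q
    proof (rule mod_mod_cancel)
      have "q dvd \<Prod>U" using that insert by (intro dvd_prodI) auto
      then show "q dvd W * \<Prod>U" by (rule dvd_mult)
    qed
    moreover have "W * \<Prod>(insert p U) = W * \<Prod>U * p" using insert by simp
    ultimately show ?thesis by auto
  qed
  have "card {b. b < (W * \<Prod>U) * p \<and> (A (b mod (W * \<Prod>U) mod W) \<and> (\<forall>q\<in>U. B q (b mod (W * \<Prod>U) mod q))) \<and> B p (b mod p)}
      = card {x. x < W * \<Prod>U \<and> A (x mod W) \<and> (\<forall>q\<in>U. B q (x mod q))} * card {r. r < p \<and> B p r}"
    by (rule card_residues_coprime_mult[OF cop pos, where A = "\<lambda>x. A (x mod W) \<and> (\<forall>q\<in>U. B q (x mod q))"])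
      (use p prime_gt_0_nat in auto)
  also have "\<dots> = card {x. x < W \<and> A x} * (\<Prod>p\<in>insert p U. card {r. r < p \<and> B p r})"
    using insert by simp
  finally show ?case unfolding set_eq .
qed

definition hit :: "nat set \<Rightarrow> nat \<Rightarrow> nat \<Rightarrow> bool" where
  "hit H p n \<longleftrightarrow> (\<exists>h\<in>H. p dvd n + h)"

lemma dvd_mod_add_iff: "d dvd n mod d + h \<longleftrightarrow> d dvd n + h" for d n h :: nat
  by (metis dvd_eq_mod_eq_0 mod_add_left_eq)

lemma hit_mod [simp]: "hit H p (n mod p) \<longleftrightarrow> hit H p n"
  by (simp add: hit_def dvd_mod_add_iff)

lemma card_hit:
  assumes "\<And>h. h \<in> H \<Longrightarrow> h < p" "0 < p"
  shows "card {r. r < p \<and> hit H p r} = card H"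
proof -
  \<comment> \<open>The residue of -h; the outer \<open>mod\<close> sends h = 0 to 0 instead of
    p.\<close>
  have "inj_on (\<lambda>h. (p - h) mod p) H"
  proof (rule inj_onI)
    fix h g assume hg: "h \<in> H" "g \<in> H" "(p - h) mod p = (p - g) mod p"
    show "h = g"
      using hg assms(1)[of h] assms(1)[of g] by (cases "h = 0"; cases "g = 0") auto
  qed
  moreover have "{r. r < p \<and> hit H p r} = (\<lambda>h. (p - h) mod p) ` H"
  proof (intro equalityI subsetI)
    fix r assume "r \<in> {r. r < p \<and> hit H p r}"
    then obtain h where h: "r < p" "h \<in> H" "p dvd r + h" by (auto simp: hit_def)
    have "r = (p - h) mod p"
    proof (cases "r + h = 0")
      case False
      then have "p \<le> r + h" using h by (intro dvd_imp_le) auto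
      then have "p dvd r + h - p" using h by simp
      moreover have "r + h - p < p" using h assms(1)[of h] by linarith
      ultimately have "r + h - p = 0" by (metis dvd_imp_le not_gr_zero not_le)
      then show ?thesis using \<open>p \<le> r + h\<close> h assms(1)[of h] by (cases "h = 0") auto
    qed auto
    then show "r \<in> (\<lambda>h. (p - h) mod p) ` H" using h by auto
  next
    fix r assume "r \<in> (\<lambda>h. (p - h) mod p) ` H"
    then obtain h where h: "h \<in> H" "r = (p - h) mod p" by auto
    then have "p dvd r + h" using assms(1)[of h] by (simp add: dvd_mod_add_iff)
    then show "r \<in> {r. r < p \<and> hit H p r}" using h assms by (auto simp: hit_def)
  qed
  ultimately show ?thesis by (simp add: card_image)
qed

text \<open>A prime above all the shifts divides at most one of the numbers r + h, so forbidding the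
  shift i amounts to removing i from the tuple.\<close>

lemma hit_not_dvd_iff:
  assumes "\<And>h. h \<in> H \<Longrightarrow> h < p" "i \<in> H"
  shows "hit H p r \<and> \<not> p dvd r + i \<longleftrightarrow> hit (H - {i}) p r"
proof -
  have "h = i" if "h \<in> H" "p dvd r + h" "p dvd r + i" for h
  proof (rule ccontr)
    assume "h \<noteq> i"
    have "p dvd (r + i) - (r + h)" "p dvd (r + h) - (r + i)"
      using that by (auto simp only: dvd_diff_nat)
    then have "p dvd (if h < i then i - h else h - i)" by simp
    moreover have "0 < (if h < i then i - h else h - i)" "(if h < i then i - h else h - i) < p"
      using \<open>h \<noteq> i\<close> assms(1)[of h] assms(1)[of i] assms(2) that by auto
    ultimately show False by (meson dvd_imp_le not_le)
  qed
  then show ?thesis using assms by (auto simp: hit_def)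
qed

abbreviation sifted :: "nat set \<Rightarrow> nat \<Rightarrow> nat \<Rightarrow> nat set \<Rightarrow> nat set \<Rightarrow> nat set" where
  "sifted H W v X U \<equiv> {n. n \<in> X \<and> n mod W = v \<and> (\<forall>p\<in>U. hit H p n)}"

definition sieve_classes :: "nat set \<Rightarrow> nat \<Rightarrow> nat \<Rightarrow> nat set \<Rightarrow> nat set" where
  "sieve_classes H W v U = {b. b < W * \<Prod>U \<and> b mod W = v \<and> (\<forall>p\<in>U. hit H p b)}"

lemma sum_sieve_classes:
  fixes f :: "nat \<Rightarrow> real"
  assumes "finite X" "finite U" "\<And>p. p \<in> U \<Longrightarrow> prime p" "0 < W"
  shows "(\<Sum>n\<in>sifted H W v X U. f n)
       = (\<Sum>b\<in>sieve_classes H W v U. \<Sum>n | n \<in> X \<and> n mod (W * \<Prod>U) = b. f n)"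
proof -
  let ?q = "W * \<Prod>U"
  let ?S = "sifted H W v X U"
  have "0 < \<Prod>U" using assms by (intro prod_primes_pos) auto
  then have q: "0 < ?q" using assms by simp
  have m1: "n mod ?q mod W = n mod W" for n by (simp add: mod_mod_cancel)
  have m2: "hit H p (n mod ?q) \<longleftrightarrow> hit H p n" if "p \<in> U" for n p
  proof -
    have "p dvd \<Prod>U" using that assms by (intro dvd_prodI) auto
    then have "n mod ?q mod p = n mod p" by (intro mod_mod_cancel dvd_mult)
    then show ?thesis by (metis hit_mod)
  qed
  have "(\<Sum>b\<in>sieve_classes H W v U. \<Sum>n\<in>{n \<in> ?S. n mod ?q = b}. f n) = (\<Sum>n\<in>?S. f n)"
  proof (rule sum.group)
    show "finite (sieve_classes H W v U)" by (auto simp: sieve_classes_def)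
    show "(\<lambda>n. n mod ?q) ` ?S \<subseteq> sieve_classes H W v U"
      using q m1 m2 by (auto simp: sieve_classes_def)
  qed (use assms in auto)
  moreover have "{n \<in> ?S. n mod ?q = b} = {n. n \<in> X \<and> n mod ?q = b}" if "b \<in> sieve_classes H W v U" for b
    using that m1 m2 by (auto simp: sieve_classes_def)
  ultimately show ?thesis by (metis (no_types, lifting) sum.cong)
qed

lemma finite_sieve_classes [simp]: "finite (sieve_classes H W v U)"
  by (auto simp: sieve_classes_def)

lemma card_sieve_classes:
  assumes U: "finite U" "\<And>p. p \<in> U \<Longrightarrow> prime p \<and> coprime p W" and W: "v < W"
    and H: "\<And>p h. p \<in> U \<Longrightarrow> h \<in> H \<Longrightarrow> h < p"
  shows "card (sieve_classes H W v U) = card H ^ card U"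
proof -
  have set_eq: "sieve_classes H W v U = {b. b < W * \<Prod>U \<and> b mod W = v \<and> (\<forall>p\<in>U. hit H p (b mod p))}"
    by (simp add: sieve_classes_def)
  have "card (sieve_classes H W v U) = card {x. x < W \<and> x = v} * (\<Prod>p\<in>U. card {r. r < p \<and> hit H p r})"
    unfolding set_eq by (rule card_residues_prod_primes[OF U]) (use W in auto)
  also have "{x. x < W \<and> x = v} = {v}" using W by auto
  also have "(\<Prod>p\<in>U. card {r. r < p \<and> hit H p r}) = (\<Prod>p\<in>U. card H)"
    using U H prime_gt_0_nat by (intro prod.cong refl card_hit) auto
  finally show ?thesis by simp
qed

text \<open>These are the classes that can contain many n with n + i prime. Coprimality deletes
  exactly one of the k residues at each p in U, leaving k - 1.\<close>

lemma card_coprime_sieve_classes: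
  assumes U: "finite U" "\<And>p. p \<in> U \<Longrightarrow> prime p \<and> coprime p W" and W: "v < W"
    and H: "\<And>p h. p \<in> U \<Longrightarrow> h \<in> H \<Longrightarrow> h < p" and i: "i \<in> H" "finite H" "coprime (v + i) W"
  shows "card {b \<in> sieve_classes H W v U. coprime (b + i) (W * \<Prod>U)} = (card H - 1) ^ card U"
proof -
  have "{b \<in> sieve_classes H W v U. coprime (b + i) (W * \<Prod>U)} = sieve_classes (H - {i}) W v U"
  proof -
    have *: "coprime (b + i) (W * \<Prod>U) \<longleftrightarrow> (\<forall>p\<in>U. \<not> p dvd b + i)" if b: "b mod W = v" for b
    proof -
      have "coprime (b + i) W"
      proof -
        have "(v + i) mod W = (b + i) mod W" unfolding b[symmetric] by (rule mod_add_left_eq)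
        moreover have "W \<noteq> 0" using W by simp
        ultimately show ?thesis using i(3) by (metis coprime_mod_left_iff)
      qed
      moreover have "coprime (b + i) (\<Prod>U) \<longleftrightarrow> (\<forall>p\<in>U. coprime (b + i) p)"
      proof
        assume c: "coprime (b + i) (\<Prod>U)"
        show "\<forall>p\<in>U. coprime (b + i) p"
        proof
          fix p assume "p \<in> U"
          then have "p dvd \<Prod>U" using U by (intro dvd_prodI) auto
          then show "coprime (b + i) p" by (rule coprime_divisors[OF dvd_refl _ c])
        qed
      qed (auto intro: prod_coprime_right)
      moreover have "coprime (b + i) p \<longleftrightarrow> \<not> p dvd b + i" if "p \<in> U" for p
        using U(2)[OF that] by (metis coprime_commute coprime_absorb_left not_prime_unit prime_imp_coprime)
      ultimately show ?thesis by (simp add: coprime_mult_right_iff)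
    qed
    have **: "hit H p b \<and> \<not> p dvd b + i \<longleftrightarrow> hit (H - {i}) p b" if "p \<in> U" for p b
      using H i that by (intro hit_not_dvd_iff) auto
    have "b mod W = v \<and> (\<forall>p\<in>U. hit H p b) \<and> coprime (b + i) (W * \<Prod>U) \<longleftrightarrow> b mod W = v \<and> (\<forall>p\<in>U. hit (H - {i}) p b)" for b
      using *[of b] ** by metis
    then show ?thesis unfolding sieve_classes_def by blast
  qed
  then show ?thesis
    using card_sieve_classes[OF U W, of "H - {i}"] H i by simp
qed

lemma card_residue_class:
  fixes q b N :: nat
  assumes "b < q"
  shows "\<bar>real (card {n. n < N \<and> n mod q = b}) - real N / real q\<bar> \<le> 1"
proof -
  \<comment> \<open>The ceiling of (N - b)/q, written so that natural subtraction is never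
    truncated, as b <= q - 1.\<close>
  define J where "J = (N + q - 1 - b) div q"
  have "{n. n < N \<and> n mod q = b} = (\<lambda>j. j * q + b) ` {..<J}"
  proof (intro equalityI subsetI)
    fix n assume n: "n \<in> {n. n < N \<and> n mod q = b}"
    then have eq: "n = n div q * q + b" by (metis (mono_tags) div_mult_mod_eq mem_Collect_eq)
    then have "(n div q + 1) * q \<le> N + q - 1 - b" using n assms by (simp add: algebra_simps) linarith
    then have "n div q + 1 \<le> J" unfolding J_def using assms
      by (metis div_le_mono nonzero_mult_div_cancel_right not_less0)
    then show "n \<in> (\<lambda>j. j * q + b) ` {..<J}" using eq by auto
  next
    fix n assume "n \<in> (\<lambda>j. j * q + b) ` {..<J}"
    then obtain j where j: "j < J" "n = j * q + b" by auto
    then have "(j + 1) * q \<le> N + q - 1 - b"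
      unfolding J_def by (metis Suc_eq_plus1 Suc_leI div_times_less_eq_dividend mult_le_mono1 order_trans)
    then show "n \<in> {n. n < N \<and> n mod q = b}" using j assms by (auto simp: algebra_simps)
  qed
  moreover have "inj_on (\<lambda>j. j * q + b) {..<J}" using assms by (auto simp: inj_on_def)
  ultimately have c: "card {n. n < N \<and> n mod q = b} = J" by (simp add: card_image)
  have "real (N + q - 1 - b) = real N + real q - 1 - real b" using assms by linarith
  moreover have "real J * real q \<le> real (N + q - 1 - b)"
    unfolding J_def by (metis div_times_less_eq_dividend of_nat_le_iff of_nat_mult)
  moreover have "real (N + q - 1 - b) < (real J + 1) * real q"
  proof -
    have "N + q - 1 - b < (J + 1) * q" unfolding J_def using assms
      by (metis Suc_eq_plus1 dividend_less_div_times mult_Suc not_less0 not_gr_zero add.commute)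
    then show ?thesis by (metis of_nat_less_iff of_nat_mult of_nat_1 of_nat_add)
  qed
  ultimately have "real J * real q \<le> real N + real q" "real N - real q \<le> real J * real q"
    using assms by (auto simp: algebra_simps)
  then have "real J \<le> real N / real q + 1" "real N / real q - 1 \<le> real J"
    using assms by (auto simp: field_simps)
  then show ?thesis unfolding c by linarith
qed

text \<open>Conditions (A) and (B) concern intervals starting at 1. Shifting by h and discarding n
  <= M alters at most h terms at the top and M + h terms at the bottom.\<close>

lemma shifted_class_sum:
  fixes f :: "nat \<Rightarrow> real"
  assumes C: "\<And>m. 1 \<le> m \<Longrightarrow> m \<le> N + h \<Longrightarrow> \<bar>f m\<bar> \<le> C" and b: "b < q" and MN: "M \<le> N"
  shows "\<bar>(\<Sum>n | n \<in> {M<..N} \<and> n mod q = b. f (n + h)) - (\<Sum>m | m \<in> {1..N} \<and> m mod q = (b + h) mod q. f m)\<bar>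
     \<le> (real M + 2 * real h) * C"
proof -
  let ?T1 = "{m. m \<in> {M+h<..N+h} \<and> m mod q = (b + h) mod q}"
  let ?T2 = "{m. m \<in> {1..N} \<and> m mod q = (b + h) mod q}"
  have 1: "(\<Sum>n | n \<in> {M<..N} \<and> n mod q = b. f (n + h)) = (\<Sum>m\<in>?T1. f m)"
  proof (rule sum.reindex_bij_witness[where i = "\<lambda>m. m - h" and j = "\<lambda>n. n + h"])
    fix m assume m: "m \<in> ?T1"
    then have "[m - h + h = b + h] (mod q)" by (auto simp: cong_def)
    then have "[m - h = b] (mod q)" by (simp add: cong_add_rcancel_nat)
    then show "m - h \<in> {n. n \<in> {M<..N} \<and> n mod q = b}" using m b by (auto simp: cong_def)
  next
    fix n assume "n \<in> {n. n \<in> {M<..N} \<and> n mod q = b}"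
    then show "n + h \<in> ?T1" by (auto simp: mod_add_left_eq)
  qed auto
  have 2: "(\<Sum>m\<in>?T1. f m) = (\<Sum>m\<in>?T1 \<inter> ?T2. f m) + (\<Sum>m\<in>?T1 - ?T2. f m)"
    by (rule sum.Int_Diff) simp
  have 3: "(\<Sum>m\<in>?T2. f m) = (\<Sum>m\<in>?T2 \<inter> ?T1. f m) + (\<Sum>m\<in>?T2 - ?T1. f m)"
    by (rule sum.Int_Diff) simp
  have "\<bar>(\<Sum>n | n \<in> {M<..N} \<and> n mod q = b. f (n + h)) - (\<Sum>m\<in>?T2. f m)\<bar>
      \<le> \<bar>\<Sum>m\<in>?T1 - ?T2. f m\<bar> + \<bar>\<Sum>m\<in>?T2 - ?T1. f m\<bar>"
    using 1 2 3 unfolding Int_commute[of ?T2 ?T1] by linarith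
  also have "\<dots> \<le> (\<Sum>m\<in>?T1 - ?T2. C) + (\<Sum>m\<in>?T2 - ?T1. C)"
    by (intro add_mono order_trans[OF sum_abs] sum_mono C) auto
  also have "\<dots> = (real (card (?T1 - ?T2)) + real (card (?T2 - ?T1))) * C" by (simp add: algebra_simps)
  also have "\<dots> \<le> (real h + (real M + real h)) * C"
  proof (cases "N + h = 0")
    case False
    then have "0 \<le> C" using C[of "N + h"] by auto
    have "card (?T1 - ?T2) \<le> card {N<..N+h}" by (intro card_mono) auto
    moreover have "card (?T2 - ?T1) \<le> card {1..M+h}" by (intro card_mono) auto
    ultimately show ?thesis using \<open>0 \<le> C\<close> by (intro mult_right_mono add_mono) auto
  next
    \<comment> \<open>Here the hypothesis bounds no value, so C may be negative; but both sums are
      empty and the factor of C is 0.\<close>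
    case True
    then have e: "?T1 = {}" "?T2 = {}" and "M = 0" "h = 0" using MN by auto
    then show ?thesis unfolding e by simp
  qed
  finally show ?thesis by (simp add: algebra_simps)
qed

lemma sieved_sum_approx:
  fixes f :: "nat \<Rightarrow> real" and l :: "nat set \<Rightarrow> real"
  assumes P: "finite P" and X: "finite X"
    and approx: "\<And>U. U \<subseteq> P \<Longrightarrow> \<bar>(\<Sum>n\<in>sifted H W v X U. f n) - Y * (\<Prod>p\<in>U. \<omega>' p)\<bar> \<le> e U"
  shows "\<bar>(\<Sum>n | n \<in> X \<and> n mod W = v. f n * (\<Sum>S | S \<subseteq> P \<and> (\<forall>p\<in>S. hit H p n). l S)\<^sup>2)
        - Y * (\<Sum>S\<in>Pow P. \<Sum>T\<in>Pow P. l S * l T * (\<Prod>p\<in>S \<union> T. \<omega>' p))\<bar>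
      \<le> (\<Sum>S\<in>Pow P. \<Sum>T\<in>Pow P. \<bar>l S * l T\<bar> * e (S \<union> T))"
proof -
  let ?Z = "{n. n \<in> X \<and> n mod W = v}"
  let ?I = "\<lambda>S n. of_bool (\<forall>p\<in>S. hit H p n) :: real"
  let ?F = "\<lambda>U. \<Sum>n\<in>sifted H W v X U. f n"
  have sq: "(\<Sum>S | S \<subseteq> P \<and> (\<forall>p\<in>S. hit H p n). l S)\<^sup>2
      = (\<Sum>S\<in>Pow P. \<Sum>T\<in>Pow P. l S * l T * ?I (S \<union> T) n)" for n
  proof -
    have "(\<Sum>S | S \<subseteq> P \<and> (\<forall>p\<in>S. hit H p n). l S) = (\<Sum>S\<in>Pow P. l S * ?I S n)"
      by (rule sum.mono_neutral_cong_left) (use P in auto)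
    moreover have "l S * ?I S n * (l T * ?I T n) = l S * l T * ?I (S \<union> T) n" for S T
      by auto
    ultimately show ?thesis by (simp only: power2_eq_square sum_product)
  qed
  have "(\<Sum>n\<in>?Z. f n * (\<Sum>S | S \<subseteq> P \<and> (\<forall>p\<in>S. hit H p n). l S)\<^sup>2)
     = (\<Sum>n\<in>?Z. \<Sum>S\<in>Pow P. \<Sum>T\<in>Pow P. l S * l T * (f n * ?I (S \<union> T) n))"
    unfolding sq sum_distrib_left by (simp only: mult_ac)
  also have "\<dots> = (\<Sum>S\<in>Pow P. \<Sum>n\<in>?Z. \<Sum>T\<in>Pow P. l S * l T * (f n * ?I (S \<union> T) n))"
    by (rule sum.swap)
  also have "\<dots> = (\<Sum>S\<in>Pow P. \<Sum>T\<in>Pow P. \<Sum>n\<in>?Z. l S * l T * (f n * ?I (S \<union> T) n))"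
    by (intro sum.cong refl sum.swap)
  also have "\<dots> = (\<Sum>S\<in>Pow P. \<Sum>T\<in>Pow P. l S * l T * ?F (S \<union> T))"
  proof -
    have "(\<Sum>n\<in>?Z. f n * ?I U n) = ?F U" for U
      by (rule sum.mono_neutral_cong_right) (use X in auto)
    then show ?thesis unfolding sum_distrib_left[symmetric] by (simp only:)
  qed
  finally have "(\<Sum>n\<in>?Z. f n * (\<Sum>S | S \<subseteq> P \<and> (\<forall>p\<in>S. hit H p n). l S)\<^sup>2)
        - Y * (\<Sum>S\<in>Pow P. \<Sum>T\<in>Pow P. l S * l T * (\<Prod>p\<in>S \<union> T. \<omega>' p))
      = (\<Sum>S\<in>Pow P. \<Sum>T\<in>Pow P. l S * l T * (?F (S \<union> T) - Y * (\<Prod>p\<in>S \<union> T. \<omega>' p)))"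
    by (simp add: sum_distrib_left right_diff_distrib sum_subtractf mult_ac)
  also have "\<bar>\<dots>\<bar> \<le> (\<Sum>S\<in>Pow P. \<Sum>T\<in>Pow P. \<bar>l S * l T\<bar> * e (S \<union> T))"
  proof (intro order_trans[OF sum_abs] sum_mono)
    fix S T assume "S \<in> Pow P" "T \<in> Pow P"
    then show "\<bar>l S * l T * (?F (S \<union> T) - Y * (\<Prod>p\<in>S \<union> T. \<omega>' p))\<bar> \<le> \<bar>l S * l T\<bar> * e (S \<union> T)"
      unfolding abs_mult[of "l S * l T"] by (intro mult_left_mono approx) auto
  qed
  finally show ?thesis .
qed

subsection \<open>Discrepancies in arithmetic progressions\<close>

definition prime_discrepancy :: "nat \<Rightarrow> nat \<Rightarrow> real" where
  "prime_discrepancy N q =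
     Max ((\<lambda>a. \<bar>(\<Sum>p | prime p \<and> p \<le> N \<and> [p = a] (mod q). ln (real p))
                     - real N / real (totient q)\<bar>) ` {a. a < q \<and> coprime a q})"

definition liouville_discrepancy :: "nat \<Rightarrow> nat \<Rightarrow> real" where
  "liouville_discrepancy N q =
     Max ((\<lambda>(y, a). \<bar>real_of_int (\<Sum>n | 1 \<le> n \<and> n \<le> y \<and> [n = a] (mod q). liouville n)\<bar>)
               ` ({..N} \<times> {..<q}))"

abbreviation rliouville :: "nat \<Rightarrow> real" where
  "rliouville n \<equiv> real_of_int (liouville n)"

definition log_prime :: "nat \<Rightarrow> real" where
  "log_prime n = (if prime n then ln (real n) else 0)"

lemma log_prime_nonneg [simp]: "0 \<le> log_prime n"
  using prime_ge_1_nat[of n] by (auto simp: log_prime_def)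

lemma abs_liouville [simp]: "\<bar>rliouville n\<bar> = 1"
  by (simp add: liouville_def)

lemma sum_log_prime_eq:
  "(\<Sum>p | prime p \<and> p \<le> N \<and> [p = a] (mod q). ln (real p)) = (\<Sum>m | m \<in> {1..N} \<and> m mod q = a mod q. log_prime m)"
  by (rule sum.mono_neutral_cong_left) (auto simp: log_prime_def cong_def prime_ge_1_nat Suc_leI prime_gt_0_nat)

lemma card_class_atLeastAtMost:
  fixes q b N :: nat
  assumes "b < q"
  shows "\<bar>real (card {m. m \<in> {1..N} \<and> m mod q = b}) - real N / real q\<bar> \<le> 3"
proof -
  let ?A = "{m. m \<in> {1..N} \<and> m mod q = b}" and ?B = "{n. n < Suc N \<and> n mod q = b}"
  have "card ?A \<le> card ?B" by (intro card_mono) auto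
  moreover have "card ?B \<le> card (insert 0 ?A)" by (intro card_mono) auto
  moreover have "card (insert 0 ?A) \<le> Suc (card ?A)" by (rule card_insert_le_m1) auto
  ultimately have "\<bar>real (card ?A) - real (card ?B)\<bar> \<le> 1" by linarith
  moreover have "\<bar>real (card ?B) - real (Suc N) / real q\<bar> \<le> 1" by (rule card_residue_class[OF assms])
  moreover have "real (Suc N) / real q = real N / real q + 1 / real q" by (simp add: add_divide_distrib)
  moreover have "1 / real q \<le> 1" "0 \<le> 1 / real q" using assms by auto
  ultimately show ?thesis by linarith
qed

lemma prime_discrepancy_ge:
  assumes "a < q" "coprime a q"
  shows "\<bar>(\<Sum>m | m \<in> {1..N} \<and> m mod q = a. log_prime m) - real N / real (totient q)\<bar> \<le> prime_discrepancy N q"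
  unfolding prime_discrepancy_def sum_log_prime_eq using assms
  by (intro Max_ge image_eqI[of _ _ a]) auto

lemma liouville_discrepancy_ge:
  assumes "a < q" "y \<le> N"
  shows "\<bar>\<Sum>m | m \<in> {1..y} \<and> m mod q = a. rliouville m\<bar> \<le> liouville_discrepancy N q"
proof -
  have "(\<Sum>m | m \<in> {1..y} \<and> m mod q = a. rliouville m)
      = real_of_int (\<Sum>n | 1 \<le> n \<and> n \<le> y \<and> [n = a] (mod q). liouville n)"
    using assms by (simp add: cong_def conj_ac)
  then show ?thesis
    unfolding liouville_discrepancy_def using assms
    by (intro Max_ge image_eqI[of _ _ "(y, a)"]) auto
qed

lemma coprime_residue_exists:
  assumes "1 \<le> (q::nat)"
  shows "\<exists>a<q. coprime a q"
proof (cases "q = 1")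
  case False
  then show ?thesis using assms by (intro exI[of _ 1]) auto
qed auto

lemma prime_discrepancy_nonneg: "1 \<le> q \<Longrightarrow> 0 \<le> prime_discrepancy N q"
  using coprime_residue_exists[of q] prime_discrepancy_ge abs_ge_zero order_trans by meson

lemma liouville_discrepancy_nonneg: "1 \<le> q \<Longrightarrow> 0 \<le> liouville_discrepancy N q"
  using liouville_discrepancy_ge[of 0 q 0 N] by auto

lemma prime_discrepancy_le:
  assumes q: "1 \<le> q" and N: "1 \<le> N"
  shows "prime_discrepancy N q \<le> (real N / real q + 3) * ln (real N) + real N / real (totient q)"
  unfolding prime_discrepancy_def
proof (rule Max.boundedI)
  show "(\<lambda>a. \<bar>(\<Sum>p | prime p \<and> p \<le> N \<and> [p = a] (mod q). ln (real p)) - real N / real (totient q)\<bar>)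
      ` {a. a < q \<and> coprime a q} \<noteq> {}" using coprime_residue_exists[OF q] by auto
next
  fix z assume "z \<in> (\<lambda>a. \<bar>(\<Sum>p | prime p \<and> p \<le> N \<and> [p = a] (mod q). ln (real p)) - real N / real (totient q)\<bar>)
      ` {a. a < q \<and> coprime a q}"
  then obtain a where a: "a < q" and
    z: "z = \<bar>(\<Sum>m | m \<in> {1..N} \<and> m mod q = a. log_prime m) - real N / real (totient q)\<bar>"
    by (auto simp: sum_log_prime_eq)
  have "(\<Sum>m | m \<in> {1..N} \<and> m mod q = a. log_prime m) \<le> (\<Sum>m | m \<in> {1..N} \<and> m mod q = a. ln (real N))"
    by (intro sum_mono) (auto simp: log_prime_def)
  also have "\<dots> = real (card {m. m \<in> {1..N} \<and> m mod q = a}) * ln (real N)" by simp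
  also have "\<dots> \<le> (real N / real q + 3) * ln (real N)"
    using card_class_atLeastAtMost[OF a, of N] N by (intro mult_right_mono) auto
  finally have "(\<Sum>m | m \<in> {1..N} \<and> m mod q = a. log_prime m) \<le> (real N / real q + 3) * ln (real N)" .
  moreover have "0 \<le> (\<Sum>m | m \<in> {1..N} \<and> m mod q = a. log_prime m)" by (intro sum_nonneg) auto
  moreover have "0 \<le> real N / real (totient q)" by simp
  ultimately show "z \<le> (real N / real q + 3) * ln (real N) + real N / real (totient q)"
    unfolding z by linarith
qed simp

lemma liouville_discrepancy_le:
  assumes q: "1 \<le> q"
  shows "liouville_discrepancy N q \<le> real N / real q + 3"
  unfolding liouville_discrepancy_def
proof (rule Max.boundedI)
  fix z assume "z \<in> (\<lambda>(y, a). \<bar>real_of_int (\<Sum>n | 1 \<le> n \<and> n \<le> y \<and> [n = a] (mod q). liouville n)\<bar>)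
      ` ({..N} \<times> {..<q})"
  then obtain y a where ya: "y \<le> N" "a < q"
    and z: "z = \<bar>real_of_int (\<Sum>n | 1 \<le> n \<and> n \<le> y \<and> [n = a] (mod q). liouville n)\<bar>" by auto
  have "z = \<bar>\<Sum>m | m \<in> {1..y} \<and> m mod q = a. rliouville m\<bar>"
    unfolding z using ya by (simp add: cong_def conj_ac)
  also have "\<dots> \<le> (\<Sum>m | m \<in> {1..y} \<and> m mod q = a. 1)"
    by (intro order_trans[OF sum_abs] sum_mono) simp
  also have "\<dots> = real (card {m. m \<in> {1..y} \<and> m mod q = a})" by simp
  also have "\<dots> \<le> real y / real q + 3" using card_class_atLeastAtMost[OF ya(2), of y] by linarith
  also have "\<dots> \<le> real N / real q + 3" using ya by (intro add_mono divide_right_mono) auto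
  finally show "z \<le> real N / real q + 3" .
qed (use q in \<open>auto simp: lessThan_empty_iff\<close>)

lemma totient_mult_prod_primes:
  assumes "finite U" "\<And>p. p \<in> U \<Longrightarrow> prime p \<and> coprime p W"
  shows "totient (W * \<Prod>U) = totient W * (\<Prod>p\<in>U. p - 1)"
  using assms
proof (induction U)
  case (insert p U)
  have p: "prime p" "coprime p W" using insert by auto
  have "coprime (\<Prod>U) p"
  proof (rule prod_coprime_left)
    fix q assume "q \<in> U"
    then show "coprime q p" using insert p by (intro primes_coprime) auto
  qed
  then have "coprime (W * \<Prod>U) p" using p by (simp add: coprime_commute)
  then have "totient (W * \<Prod>U * p) = totient (W * \<Prod>U) * (p - 1)"
    using p by (simp add: totient_mult_coprime totient_prime)
  then show ?case using insert by (simp add: mult_ac)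
qed simp

section \<open>Main terms and errors for the sieved sums\<close>

context
  fixes H U :: "nat set" and W v M N :: nat
  assumes U: "finite U" "\<And>p. p \<in> U \<Longrightarrow> prime p \<and> coprime p W"
    and W: "v < W" and MN: "M \<le> N"
    and H: "\<And>p h. p \<in> U \<Longrightarrow> h \<in> H \<Longrightarrow> h < p"
begin

lemma modulus_pos: "0 < W * \<Prod>U"
proof -
  have "0 < \<Prod>U" using U by (intro prod_primes_pos) auto
  then show ?thesis using W by simp
qed

lemma sieve_sum_one:
  "\<bar>(\<Sum>n\<in>sifted H W v {M<..N} U. 1)
      - real N / real W * (\<Prod>p\<in>U. real (card H) / real p)\<bar> \<le> real (card H) ^ card U * (real M + 3)"
proof -
  let ?q = "W * \<Prod>U" and ?B = "sieve_classes H W v U"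
  have cls: "\<bar>(\<Sum>n | n \<in> {M<..N} \<and> n mod ?q = b. 1) - real N / real ?q\<bar> \<le> real M + 3" if "b \<in> ?B" for b
  proof -
    have b: "b < ?q" using that by (simp add: sieve_classes_def)
    have "\<bar>(\<Sum>n | n \<in> {M<..N} \<and> n mod ?q = b. 1) - (\<Sum>m | m \<in> {1..N} \<and> m mod ?q = (b + 0) mod ?q. (1::real))\<bar>
        \<le> (real M + 2 * real 0) * 1"
      by (rule shifted_class_sum[where f = "\<lambda>_. 1" and h = 0, OF _ b MN]) simp
    moreover have "\<bar>real (card {m. m \<in> {1..N} \<and> m mod ?q = b}) - real N / real ?q\<bar> \<le> 3"
      by (rule card_class_atLeastAtMost[OF b])
    ultimately show ?thesis using b by simp
  qed
  have main: "real N / real W * (\<Prod>p\<in>U. real (card H) / real p) = (\<Sum>b\<in>?B. real N / real ?q)"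
    by (simp add: card_sieve_classes[OF U W H] prod_dividef mult.commute)
  have "(\<Sum>n\<in>sifted H W v {M<..N} U. 1)
      - real N / real W * (\<Prod>p\<in>U. real (card H) / real p)
     = (\<Sum>b\<in>?B. (\<Sum>n | n \<in> {M<..N} \<and> n mod ?q = b. 1) - real N / real ?q)"
    unfolding main sum_subtractf using U W by (subst sum_sieve_classes) auto
  also have "\<bar>\<dots>\<bar> \<le> (\<Sum>b\<in>?B. real M + 3)"
    by (intro order_trans[OF sum_abs] sum_mono cls)
  also have "\<dots> = real (card H) ^ card U * (real M + 3)"
    by (simp add: card_sieve_classes[OF U W H])
  finally show ?thesis .
qed

lemma sieve_sum_liouville:
  "\<bar>\<Sum>n\<in>sifted H W v {M<..N} U. rliouville (n + d)\<bar>
     \<le> real (card H) ^ card U * (liouville_discrepancy N (W * \<Prod>U) + (real M + 2 * real d))"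
proof -
  let ?q = "W * \<Prod>U" and ?B = "sieve_classes H W v U"
  let ?C = "liouville_discrepancy N ?q + (real M + 2 * real d)"
  have cls: "\<bar>\<Sum>n | n \<in> {M<..N} \<and> n mod ?q = b. rliouville (n + d)\<bar> \<le> ?C" if "b \<in> ?B" for b
  proof -
    have b: "b < ?q" using that by (simp add: sieve_classes_def)
    have "\<bar>(\<Sum>n | n \<in> {M<..N} \<and> n mod ?q = b. rliouville (n + d))
        - (\<Sum>m | m \<in> {1..N} \<and> m mod ?q = (b + d) mod ?q. rliouville m)\<bar>
        \<le> (real M + 2 * real d) * 1"
      by (rule shifted_class_sum[where f = "\<lambda>m. rliouville m", OF _ b MN]) simp
    moreover have "\<bar>\<Sum>m | m \<in> {1..N} \<and> m mod ?q = (b + d) mod ?q. rliouville m\<bar>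
        \<le> liouville_discrepancy N ?q"
      using modulus_pos by (intro liouville_discrepancy_ge) auto
    moreover have "\<bar>x - z\<bar> \<le> s * 1 \<Longrightarrow> \<bar>z\<bar> \<le> t \<Longrightarrow> \<bar>x\<bar> \<le> t + s" for x z s t :: real by linarith
    ultimately show ?thesis by blast
  qed
  have "(\<Sum>n\<in>sifted H W v {M<..N} U. rliouville (n + d))
     = (\<Sum>b\<in>?B. (\<Sum>n | n \<in> {M<..N} \<and> n mod ?q = b. rliouville (n + d)))"
    using U W by (intro sum_sieve_classes) auto
  also have "\<bar>\<dots>\<bar> \<le> (\<Sum>b\<in>?B. ?C)"
    by (intro order_trans[OF sum_abs] sum_mono cls)
  also have "\<dots> = real (card H) ^ card U * ?C"
    by (simp add: card_sieve_classes[OF U W H])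
  finally show ?thesis .
qed

text \<open>Reduced classes are governed by (A). Every other class holds at most one prime, which is
  the extra 1 in the boundary term.\<close>

lemma sieve_sum_primes:
  assumes i: "i \<in> H" "finite H" "coprime (v + i) W" and N: "1 \<le> N"
  shows "\<bar>(\<Sum>n\<in>sifted H W v {M<..N} U. log_prime (n + i))
      - real N / real (totient W) * (\<Prod>p\<in>U. (real (card H) - 1) / (real p - 1))\<bar>
     \<le> real (card H) ^ card U
        * (prime_discrepancy N (W * \<Prod>U) + (real M + 2 * real i + 1) * ln (real (N + i)))"
proof -
  let ?q = "W * \<Prod>U" and ?B = "sieve_classes H W v U"
  let ?C = "prime_discrepancy N ?q + (real M + 2 * real i + 1) * ln (real (N + i))"
  let ?B1 = "{b \<in> ?B. coprime (b + i) ?q}"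
  have lnN: "0 \<le> ln (real (N + i))" using N by simp
  have D0: "0 \<le> prime_discrepancy N ?q" using modulus_pos by (intro prime_discrepancy_nonneg) simp
  define A where "A = (\<lambda>b. \<Sum>n | n \<in> {M<..N} \<and> n mod ?q = b. log_prime (n + i))"
  define G where "G = (\<lambda>b. if coprime (b + i) ?q then real N / real (totient ?q) else 0)"
  have cls: "\<bar>A b - G b\<bar> \<le> ?C" if "b \<in> ?B" for b
  proof (cases "coprime (b + i) ?q")
    case True
    have b: "b < ?q" using that by (simp add: sieve_classes_def)
    have "\<bar>A b - (\<Sum>m | m \<in> {1..N} \<and> m mod ?q = (b + i) mod ?q. log_prime m)\<bar>
        \<le> (real M + 2 * real i) * ln (real (N + i))"
      unfolding A_def by (rule shifted_class_sum[OF _ b MN]) (auto simp: log_prime_def)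
    moreover have "\<bar>(\<Sum>m | m \<in> {1..N} \<and> m mod ?q = (b + i) mod ?q. log_prime m) - real N / real (totient ?q)\<bar>
        \<le> prime_discrepancy N ?q"
    proof (rule prime_discrepancy_ge)
      show "coprime ((b + i) mod ?q) ?q"
        using coprime_mod_left_iff[of ?q "b + i"] True modulus_pos by blast
    qed (use modulus_pos in auto)
    ultimately have "\<bar>A b - G b\<bar> \<le> prime_discrepancy N ?q + (real M + 2 * real i) * ln (real (N + i))"
      using True by (simp add: G_def)
    also have "\<dots> \<le> ?C" using lnN by (simp add: algebra_simps)
    finally show ?thesis .
  next
    case False
    define T where "T = {n. n \<in> {M<..N} \<and> n mod ?q = b \<and> prime (n + i)}"
    \<comment> \<open>A prime n + i that shares a factor with the modulus equals the gcd, and the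
      gcd depends only on the class b.\<close>
    have eq: "n + i = gcd (b + i) ?q" if n: "n \<in> T" for n
    proof -
      have b: "b = n mod ?q" using n by (simp add: T_def)
      have "(b + i) mod ?q = (n + i) mod ?q" unfolding b by (rule mod_add_left_eq)
      then have "gcd (b + i) ?q = gcd (n + i) ?q"
        by (metis gcd_red_nat gcd.commute)
      moreover have p: "prime (n + i)" using n by (simp add: T_def)
      moreover have "gcd (b + i) ?q \<noteq> 1" using False by (simp only: coprime_iff_gcd_eq_1 not_False_eq_True)
      moreover have "gcd (n + i) ?q dvd n + i" by simp
      ultimately show ?thesis using p unfolding prime_nat_iff by metis
    qed
    have T: "card T \<le> Suc 0" "finite T"
    proof -
      show fin: "finite T" by (auto simp: T_def)
      have "n = m" if "n \<in> T" "m \<in> T" for n m using eq[OF that(1)] eq[OF that(2)] by simp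
      then show "card T \<le> Suc 0" using fin by (auto simp: card_le_Suc0_iff_eq)
    qed
    have "A b = (\<Sum>n\<in>T. log_prime (n + i))"
      unfolding A_def T_def by (rule sum.mono_neutral_right) (auto simp: log_prime_def)
    also have "\<dots> \<le> (\<Sum>n\<in>T. ln (real (N + i)))"
      by (intro sum_mono) (auto simp: log_prime_def T_def)
    also have "\<dots> = real (card T) * ln (real (N + i))" by simp
    also have "\<dots> \<le> 1 * ln (real (N + i))"
      using T lnN by (intro mult_right_mono) auto
    also have "\<dots> \<le> (real M + 2 * real i + 1) * ln (real (N + i))"
      using lnN by (intro mult_right_mono) auto
    finally have "A b \<le> ?C" using D0 by linarith
    moreover have "0 \<le> A b" by (auto simp: A_def intro: sum_nonneg)
    moreover have "G b = 0" using False by (auto simp: G_def)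
    ultimately show ?thesis by simp
  qed
  have main: "real N / real (totient W) * (\<Prod>p\<in>U. (real (card H) - 1) / (real p - 1)) = (\<Sum>b\<in>?B. G b)"
  proof -
    have "real (card H - 1) = real (card H) - 1"
      using i by (metis One_nat_def Suc_leI card_gt_0_iff empty_iff of_nat_1 of_nat_diff)
    moreover have "real (\<Prod>p\<in>U. p - 1) = (\<Prod>p\<in>U. real p - 1)"
      unfolding of_nat_prod
    proof (intro prod.cong refl)
      fix p assume "p \<in> U"
      then have "1 \<le> p" using U(2)[of p] prime_ge_1_nat[of p] by blast
      then show "real (p - 1) = real p - 1" by (simp add: of_nat_diff)
    qed
    moreover have "(\<Sum>b\<in>?B. G b) = real (card ?B1) * (real N / real (totient ?q))"
    proof -
      have "(\<Sum>b\<in>?B. G b) = (\<Sum>b\<in>?B1. real N / real (totient ?q))"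
        unfolding G_def by (rule sum.mono_neutral_cong_right) auto
      then show ?thesis by (simp only: sum_constant)
    qed
    moreover have "card ?B1 = (card H - 1) ^ card U"
      by (rule card_coprime_sieve_classes[OF U W H i])
    moreover have "real (totient ?q) = real (totient W) * real (\<Prod>p\<in>U. p - 1)"
      using totient_mult_prod_primes[of U W] U by (metis of_nat_mult)
    ultimately show ?thesis by (simp add: prod_dividef mult.commute)
  qed
  have "(\<Sum>n\<in>sifted H W v {M<..N} U. log_prime (n + i)) = (\<Sum>b\<in>?B. A b)"
    unfolding A_def using U W by (intro sum_sieve_classes) auto
  then have "(\<Sum>n\<in>sifted H W v {M<..N} U. log_prime (n + i))
      - real N / real (totient W) * (\<Prod>p\<in>U. (real (card H) - 1) / (real p - 1))
     = (\<Sum>b\<in>?B. A b - G b)" unfolding main sum_subtractf by simp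
  also have "\<bar>\<dots>\<bar> \<le> (\<Sum>b\<in>?B. ?C)"
    by (intro order_trans[OF sum_abs] sum_mono cls)
  also have "\<dots> = real (card H) ^ card U * ?C"
    by (simp add: card_sieve_classes[OF U W H])
  finally show ?thesis .
qed

end

section \<open>Errors summed over all moduli\<close>

text \<open>One error function for all three sieved sums (total, Liouville, primes), so that a
  single remainder has to be estimated; c collects the boundary terms.\<close>

definition discrepancy :: "real \<Rightarrow> nat \<Rightarrow> nat \<Rightarrow> nat \<Rightarrow> real" where
  "discrepancy c d N q = prime_discrepancy N q + liouville_discrepancy N q + c * ln (real (N + d))"

lemma finite_moduli [simp]: "finite (moduli N e)"
proof -
  have "moduli N e \<subseteq> {..nat \<lfloor>real N powr e\<rfloor>}"
    by (auto simp: moduli_def le_nat_floor)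
  then show ?thesis using finite_subset by blast
qed

lemma card_moduli_le: "real (card (moduli N e)) \<le> real N powr e"
proof -
  have "moduli N e \<subseteq> {1..nat \<lfloor>real N powr e\<rfloor>}"
    by (auto simp: moduli_def le_nat_floor)
  then have "card (moduli N e) \<le> nat \<lfloor>real N powr e\<rfloor>"
    using card_mono[of "{1..nat \<lfloor>real N powr e\<rfloor>}" "moduli N e"] by simp
  then show ?thesis by (metis of_nat_floor of_nat_le_iff order_trans powr_ge_zero)
qed

lemma discrepancy_sum_bigo:
  assumes A: "condA \<theta>" and B: "condB \<theta>" and \<eta>: "\<eta> < \<theta>" "0 < \<eta>" "\<eta> < 1" and a: "a > 0" and c: "0 \<le> c"
  shows "(\<lambda>N. \<Sum>q\<in>moduli N \<eta>. discrepancy c d N q) \<in> O(\<lambda>N. real N / ln (real N) powr a)"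
proof -
  have "(\<lambda>N. \<Sum>q\<in>moduli N \<eta>. prime_discrepancy N q) \<in> O(\<lambda>N. real N / ln (real N) powr a)"
    using A[unfolded condA_def, rule_format, of "\<theta> - \<eta>" a] \<eta> a
    unfolding prime_discrepancy_def by simp
  moreover have "(\<lambda>N. \<Sum>q\<in>moduli N \<eta>. liouville_discrepancy N q) \<in> O(\<lambda>N. real N / ln (real N) powr a)"
    using B[unfolded condB_def, rule_format, of "\<theta> - \<eta>" a] \<eta> a
    unfolding liouville_discrepancy_def by simp
  \<comment> \<open>Boundary terms cost a logarithm per modulus, N^\<eta> log N in all; this is
    where \<eta> < 1 enters.\<close>
  moreover have "(\<lambda>N. \<Sum>q\<in>moduli N \<eta>. c * ln (real (N + d))) \<in> O(\<lambda>N. real N / ln (real N) powr a)"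
  proof -
    have "(\<lambda>N. \<Sum>q\<in>moduli N \<eta>. c * ln (real (N + d))) \<in> O(\<lambda>N::nat. real N powr \<eta> * ln (real N + real d))"
    proof (rule bigoI[of _ c], rule eventually_mono[OF eventually_gt_at_top[of 0]])
      fix N :: nat assume N: "0 < N"
      then have l: "0 \<le> ln (real N + real d)" by simp
      have "real (card (moduli N \<eta>)) * (c * ln (real N + real d)) \<le> real N powr \<eta> * (c * ln (real N + real d))"
        using l c by (intro mult_right_mono card_moduli_le) auto
      then show "norm (\<Sum>q\<in>moduli N \<eta>. c * ln (real (N + d))) \<le> c * norm (real N powr \<eta> * ln (real N + real d))"
        using l c by (simp add: abs_mult mult_ac)
    qed
    also have "(\<lambda>N::nat. real N powr \<eta> * ln (real N + real d)) \<in> O(\<lambda>N. real N / ln (real N) powr a)"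
      using \<eta> a by real_asymp
    finally show ?thesis .
  qed
  ultimately show ?thesis
    unfolding discrepancy_def sum.distrib by (intro sum_in_bigo) auto
qed

lemma discrepancy_nonneg:
  assumes "1 \<le> q" "1 \<le> N" "0 \<le> c"
  shows "0 \<le> discrepancy c d N q"
  unfolding discrepancy_def using assms
  by (intro add_nonneg_nonneg prime_discrepancy_nonneg liouville_discrepancy_nonneg mult_nonneg_nonneg ln_ge_zero) auto

text \<open>The trivial bound. The factor 2^|U| comes from p <= 2 (p - 1), which trades phi for the
  modulus; the condition that the modulus be at most N lets constants be absorbed into N/q.\<close>

lemma discrepancy_le:
  assumes U: "finite U" "\<And>p. p \<in> U \<Longrightarrow> prime p \<and> coprime p W" and W: "1 \<le> W"
    and q: "W * \<Prod>U \<le> N" and N: "3 \<le> N" "d \<le> N" and c: "0 \<le> c"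
  shows "discrepancy c d N (W * \<Prod>U) \<le> (9 + 2 * c) * real N * ln (real N) * (2 ^ card U / rprod U)"
proof -
  let ?q = "W * \<Prod>U" and ?X = "2 ^ card U / rprod U :: real"
  have Upos: "0 < \<Prod>U" using U by (intro prod_primes_pos) auto
  then have q1: "1 \<le> ?q" using W by (simp add: Suc_leI)
  have "0 < real (\<Prod>U)" using Upos by (simp only: of_nat_0_less_iff)
  then have Upos': "0 < rprod U" by simp
  have "exp 1 \<le> real N" using exp_le N by linarith
  then have l: "1 \<le> ln (real N)" using N by (simp add: ln_ge_iff)
  have Nq: "real N / real ?q \<le> real N * ?X"
  proof -
    have "rprod U = real (\<Prod>U)" by simp
    also have "\<dots> \<le> real ?q" using W Upos by (simp del: of_nat_prod)
    finally have "real N / real ?q \<le> real N * 1 / rprod U"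
      using Upos' q1 by (simp add: frac_le)
    also have "\<dots> \<le> real N * 2 ^ card U / rprod U"
      using Upos' by (intro divide_right_mono mult_left_mono) auto
    finally show ?thesis by simp
  qed
  have one: "1 \<le> real N / real ?q" using q q1 by (simp add: le_divide_eq del: of_nat_mult of_nat_prod)
  have Nphi: "real N / real (totient ?q) \<le> real N * ?X"
  proof -
    have tW: "1 \<le> totient W" using W by (simp add: Suc_leI)
    have "rprod U \<le> (\<Prod>p\<in>U. 2 * real (p - 1))"
    proof (intro prod_mono conjI)
      fix p assume "p \<in> U"
      then have "2 \<le> p" using U prime_ge_2_nat by blast
      then show "real p \<le> 2 * real (p - 1)" by linarith
    qed auto
    also have "\<dots> = 2 ^ card U * real (\<Prod>p\<in>U. p - 1)" by (simp add: prod.distrib)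
    also have "\<dots> \<le> 2 ^ card U * real (totient ?q)"
      using tW totient_mult_prod_primes[OF U] by (intro mult_left_mono) (auto simp del: of_nat_prod simp flip: of_nat_mult)
    finally have "rprod U / 2 ^ card U \<le> real (totient ?q)" by (simp add: divide_le_eq mult.commute)
    then have "real N / real (totient ?q) \<le> real N / (rprod U / 2 ^ card U)"
      using Upos' q1 by (intro divide_left_mono mult_pos_pos) auto
    then show ?thesis by simp
  qed
  have X0: "0 \<le> real N * ?X" using Upos' by simp
  have "prime_discrepancy N ?q \<le> (real N / real ?q + 3) * ln (real N) + real N / real (totient ?q)"
    using q1 N by (intro prime_discrepancy_le) auto
  also have "\<dots> \<le> (4 * (real N * ?X)) * ln (real N) + real N * ?X * ln (real N)"
  proof (intro add_mono mult_right_mono)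
    show "real N / real ?q + 3 \<le> 4 * (real N * ?X)" using Nq one by linarith
    have "real N * ?X * 1 \<le> real N * ?X * ln (real N)" using X0 l by (intro mult_left_mono) auto
    then show "real N / real (totient ?q) \<le> real N * ?X * ln (real N)" using Nphi by linarith
  qed (use l in auto)
  finally have 1: "prime_discrepancy N ?q \<le> 5 * (real N * ?X * ln (real N))" by (simp add: algebra_simps)
  have "liouville_discrepancy N ?q \<le> 4 * (real N * ?X) * 1"
    using liouville_discrepancy_le[OF q1, of N] Nq one by linarith
  also have "\<dots> \<le> 4 * (real N * ?X) * ln (real N)" using X0 l by (intro mult_left_mono) auto
  finally have 2: "liouville_discrepancy N ?q \<le> 4 * (real N * ?X * ln (real N))" by (simp add: algebra_simps)
  have "ln (real (N + d)) \<le> ln (real N * real N)"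
  proof -
    have "real (N + d) \<le> 3 * real N" using N by simp
    also have "\<dots> \<le> real N * real N" using N by (intro mult_right_mono) auto
    finally show ?thesis using N by (subst ln_le_cancel_iff) auto
  qed
  also have "\<dots> = 1 * (2 * ln (real N))" using N by (simp add: ln_mult)
  also have "\<dots> \<le> (real N * ?X) * (2 * ln (real N))" using one Nq l by (intro mult_right_mono) auto
  finally have "c * ln (real (N + d)) \<le> c * ((real N * ?X) * (2 * ln (real N)))"
    using c by (intro mult_left_mono)
  then have 3: "c * ln (real (N + d)) \<le> 2 * c * (real N * ?X * ln (real N))" by (simp add: mult_ac)
  have "discrepancy c d N ?q \<le> 5 * (real N * ?X * ln (real N)) + 4 * (real N * ?X * ln (real N)) + 2 * c * (real N * ?X * ln (real N))"
    unfolding discrepancy_def using 1 2 3 by (intro add_mono)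
  also have "\<dots> = (9 + 2 * c) * real N * ln (real N) * ?X" by (simp add: algebra_simps)
  finally show ?thesis .
qed

text \<open>
  Replaces the usual Cauchy--Schwarz step: a large divisor-type factor \<open>x\<close> is traded either for a
  power \<open>B\<close> of the logarithm or for its square against the trivial bound.
\<close>

lemma power_le_add_square_div:
  fixes x B :: real
  assumes "0 < B" "0 \<le> x"
  shows "x \<le> B + x\<^sup>2 / B"
proof (cases "x \<le> B")
  case False
  then have "x * B \<le> x * x" using assms by (intro mult_left_mono) auto
  then have "x \<le> x\<^sup>2 / B" using assms by (simp add: le_divide_eq power2_eq_square)
  then show ?thesis using assms by linarith
qed (use assms in \<open>simp add: add_increasing2\<close>)

lemma weighted_discrepancy_tendsto_0:
  fixes P :: "nat \<Rightarrow> nat set"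
  assumes A: "condA \<theta>" and B: "condB \<theta>" and \<theta>: "0 < \<theta>0" "\<theta>0 < \<theta>" "\<theta>0 < 1" and c: "0 \<le> c"
    and P: "\<And>N. finite (P N)" "\<And>N p. p \<in> P N \<Longrightarrow> prime p \<and> coprime p W" and W: "1 \<le> W"
  shows "(\<lambda>N. ln (real N) ^ a * (\<Sum>U | U \<subseteq> P N \<and> rprod U \<le> real N powr \<theta>0.
            real \<kappa> ^ card U * discrepancy c d N (W * \<Prod>U)) / real N) \<longlonglongrightarrow> 0"
proof -
  \<comment> \<open>Strictly between \<theta>0 and min(\<theta>, 1): moduli W * U with U <=
    N^\<theta>0 eventually stay below N^\<eta>, which is still below the level of (A) and
    (B).\<close>
  define \<eta> where "\<eta> = min ((\<theta>0 + \<theta>) / 2) ((\<theta>0 + 1) / 2)"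
  have \<eta>: "\<theta>0 < \<eta>" "\<eta> < \<theta>" "\<eta> < 1" "0 < \<eta>" using \<theta> by (auto simp: \<eta>_def min_def)
  \<comment> \<open>\<kappa>^2 from the squared divisor factor, times 2 from the trivial bound, is
    the coefficient at each prime; so the second sum is of order L^k2.\<close>
  define k2 where "k2 = 2 * \<kappa>\<^sup>2"
  \<comment> \<open>The split at L^j leaves L^(a + j) / L^(a + j + 1) from the conditions and L^(a +
    1 + k2 - j) from the trivial bound; both are 1/L.\<close>
  define j where "j = a + k2 + 2"
  \<comment> \<open>A crude choice resting only on phi(W) >= 1; it may be large, as W is fixed while
    log N grows.\<close>
  define K where "K = real W * (real W + 1)"
  have tW: "1 \<le> totient W" using W by (simp add: Suc_leI)
  have K: "real W + 1 \<le> real (totient W) / real W * K"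
  proof -
    have "1 * (real W + 1) \<le> real (totient W) * (real W + 1)" using tW by (intro mult_right_mono) auto
    then show ?thesis using W by (simp add: K_def)
  qed
  let ?D = "discrepancy c d"
  let ?I = "\<lambda>N. {U. U \<subseteq> P N \<and> rprod U \<le> real N powr \<theta>0}"
  have "(\<lambda>N. \<Sum>q\<in>moduli N \<eta>. ?D N q) \<in> O(\<lambda>N. real N / ln (real N) powr (real (a + j + 1)))"
    using \<eta> A B c by (intro discrepancy_sum_bigo) auto
  then obtain C where C: "0 < C"
    and ev1: "eventually (\<lambda>N. norm (\<Sum>q\<in>moduli N \<eta>. ?D N q) \<le> C * norm (real N / ln (real N) powr (real (a + j + 1)))) sequentially"
    by (rule landau_o.bigE)
  have ev2: "eventually (\<lambda>N::nat. real W * real N powr \<theta>0 \<le> real N powr \<eta>) sequentially"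
    using \<eta> by real_asymp
  have ev3: "eventually (\<lambda>N::nat. real N powr \<eta> \<le> real N) sequentially"
    using \<eta> by real_asymp
  have ev4: "eventually (\<lambda>N::nat. real k2 * K \<le> ln (real N)) sequentially" by real_asymp
  have ev5: "eventually (\<lambda>N::nat. 3 \<le> N \<and> d \<le> N) sequentially"
    by (auto intro: eventually_conj eventually_ge_at_top)
  define C' where "C' = C + (9 + 2 * c) * 2 ^ k2"
  have main: "eventually (\<lambda>N. norm (ln (real N) ^ a * (\<Sum>U\<in>?I N. real \<kappa> ^ card U * ?D N (W * \<Prod>U)) / real N)
      \<le> C' / ln (real N)) sequentially"
    using ev1 ev2 ev3 ev4 ev5
  proof eventually_elim
    case (elim N)
    define L where "L = ln (real N)"
    have N: "3 \<le> N" "d \<le> N" using elim by auto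
    have "exp 1 \<le> real N" using exp_le N by linarith
    then have L: "1 \<le> L" using N by (simp add: ln_ge_iff L_def)
    have finI: "finite (?I N)" using P(1)[of N] by (auto intro: finite_subset[of _ "Pow (P N)"])
    have U: "finite U" "\<And>p. p \<in> U \<Longrightarrow> prime p \<and> coprime p W" "0 < \<Prod>U"
      "real (W * \<Prod>U) \<le> real N powr \<eta>" "W * \<Prod>U \<le> N" "1 \<le> W * \<Prod>U" if "U \<in> ?I N" for U
    proof -
      show "finite U" using that P(1)[of N] finite_subset by auto
      show pr: "\<And>p. p \<in> U \<Longrightarrow> prime p \<and> coprime p W" using that P(2) by blast
      show pos: "0 < \<Prod>U" using pr by (intro prod_primes_pos) auto
      have "real (W * \<Prod>U) = real W * rprod U" by simp
      also have "\<dots> \<le> real W * real N powr \<theta>0" using that by (intro mult_left_mono) auto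
      also have "\<dots> \<le> real N powr \<eta>" using elim by simp
      finally show le: "real (W * \<Prod>U) \<le> real N powr \<eta>" .
      then have "real (W * \<Prod>U) \<le> real N" using elim by linarith
      then show "W * \<Prod>U \<le> N" by (simp only: of_nat_le_iff)
      show "1 \<le> W * \<Prod>U" using pos W by (simp add: Suc_leI)
    qed
    have D0: "0 \<le> ?D N q" if "1 \<le> q" for q using that N c by (intro discrepancy_nonneg) auto
    have S1: "(\<Sum>U\<in>?I N. ?D N (W * \<Prod>U)) \<le> C * (real N / L ^ (a + j + 1))"
    proof -
      have inj: "inj_on (\<lambda>U. W * \<Prod>U) (?I N)"
      proof (rule inj_onI)
        fix S T assume ST: "S \<in> ?I N" "T \<in> ?I N" "W * \<Prod>S = W * \<Prod>T"
        then have "\<Prod>S = \<Prod>T" using W by simp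
        moreover have "inj_on \<Prod> (Pow (P N))" using P by (intro inj_on_prod_primes) auto
        ultimately show "S = T" using ST by (auto dest: inj_onD)
      qed
      have "(\<Sum>U\<in>?I N. ?D N (W * \<Prod>U)) = (\<Sum>q\<in>(\<lambda>U. W * \<Prod>U) ` ?I N. ?D N q)"
        by (simp add: sum.reindex[OF inj])
      also have "\<dots> \<le> (\<Sum>q\<in>moduli N \<eta>. ?D N q)"
      proof (rule sum_mono2)
        show "(\<lambda>U. W * \<Prod>U) ` ?I N \<subseteq> moduli N \<eta>"
          using U(4,6) unfolding moduli_def by blast
        fix q assume "q \<in> moduli N \<eta> - (\<lambda>U. W * \<Prod>U) ` ?I N"
        then show "0 \<le> ?D N q" by (intro D0) (simp add: moduli_def)
      qed simp
      also have "\<dots> \<le> C * norm (real N / ln (real N) powr (real (a + j + 1)))" using elim by simp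
      also have "ln (real N) powr (real (a + j + 1)) = L ^ (a + j + 1)"
        unfolding L_def[symmetric] by (rule powr_realpow) (use L in simp)
      finally show ?thesis using L by simp
    qed
    have S2: "(\<Sum>U\<in>?I N. real \<kappa> ^ (2 * card U) * ?D N (W * \<Prod>U)) \<le> (9 + 2 * c) * real N * L * (2 * L) ^ k2"
    proof -
      have "(\<Sum>U\<in>?I N. real \<kappa> ^ (2 * card U) * ?D N (W * \<Prod>U))
          \<le> (\<Sum>U\<in>?I N. real \<kappa> ^ (2 * card U) * ((9 + 2 * c) * real N * L * (2 ^ card U / rprod U)))"
      proof (intro sum_mono mult_left_mono)
        fix U assume i: "U \<in> ?I N"
        show "?D N (W * \<Prod>U) \<le> (9 + 2 * c) * real N * L * (2 ^ card U / rprod U)"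
          unfolding L_def by (rule discrepancy_le[OF U(1)[OF i] U(2)[OF i] W U(5)[OF i] N c])
      qed simp
      also have "\<dots> = (9 + 2 * c) * real N * L * (\<Sum>U\<in>?I N. (\<Prod>p\<in>U. real k2 / real p))"
        unfolding sum_distrib_left
        by (intro sum.cong refl) (simp add: k2_def power_mult prod_dividef power_mult_distrib)
      finally have 1: "(\<Sum>U\<in>?I N. real \<kappa> ^ (2 * card U) * ?D N (W * \<Prod>U))
          \<le> (9 + 2 * c) * real N * L * (\<Sum>U\<in>?I N. (\<Prod>p\<in>U. real k2 / real p))" .
      have "(\<Sum>U\<in>?I N. (\<Prod>p\<in>U. real k2 / real p)) = subset_sum (\<lambda>p. real k2 / real p) (P N) (plog 0) (real N powr \<theta>0)"
        unfolding subset_sum_def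
      proof (rule sum.mono_neutral_cong_left)
        show "\<forall>i\<in>Pow (P N) - ?I N. (\<Prod>p\<in>i. real k2 / real p) * plog 0 (real N powr \<theta>0 / rprod i) = 0"
        proof
          fix i assume i: "i \<in> Pow (P N) - ?I N"
          then have "1 \<le> rprod i" using P(2) by (intro prod_primes_ge_1) auto
          then show "(\<Prod>p\<in>i. real k2 / real p) * plog 0 (real N powr \<theta>0 / rprod i) = 0"
            using i by (auto simp: plog_def le_divide_eq)
        qed
        fix U assume i: "U \<in> ?I N"
        then have "1 \<le> rprod U" using P(2) by (intro prod_primes_ge_1) auto
        then show "(\<Prod>p\<in>U. real k2 / real p) = (\<Prod>p\<in>U. real k2 / real p) * plog 0 (real N powr \<theta>0 / rprod U)"
          using i by (auto simp: plog_def le_divide_eq)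
      qed (use P in auto)
      also have "\<dots> \<le> (real (totient W) / real W) ^ k2 * (fact 0 / fact (0 + k2)) * plog (0 + k2) (real N powr \<theta>0 * exp (real k2 * K))"
        using P W K by (intro subset_sum_plog_le) auto
      also have "\<dots> \<le> 1 * 1 * (2 * L) ^ k2"
      proof (intro mult_mono)
        show "(real (totient W) / real W) ^ k2 \<le> 1" using W by (intro power_le_one) (auto simp: totient_le)
        show "(fact 0 / fact (0 + k2) :: real) \<le> 1" by simp
        have "ln (real N powr \<theta>0 * exp (real k2 * K)) = \<theta>0 * L + real k2 * K"
          using N by (simp add: ln_mult ln_powr L_def)
        also have "\<dots> \<le> 2 * L"
        proof -
          have "\<theta>0 * L \<le> 1 * L" using \<theta> L by (intro mult_right_mono) auto
          moreover have "real k2 * K \<le> L" using elim by (simp add: L_def)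
          ultimately show ?thesis by linarith
        qed
        finally have "ln (real N powr \<theta>0 * exp (real k2 * K)) ^ k2 \<le> (2 * L) ^ k2"
          if "1 \<le> real N powr \<theta>0 * exp (real k2 * K)"
          using that by (intro power_mono) auto
        moreover have "0 \<le> (2 * L) ^ k2" using L by simp
        ultimately show "plog (0 + k2) (real N powr \<theta>0 * exp (real k2 * K)) \<le> (2 * L) ^ k2"
          by (simp only: plog_def add_0 split: if_split) blast
      qed auto
      finally have "(\<Sum>U\<in>?I N. (\<Prod>p\<in>U. real k2 / real p)) \<le> (2 * L) ^ k2" by simp
      then have "(9 + 2 * c) * real N * L * (\<Sum>U\<in>?I N. (\<Prod>p\<in>U. real k2 / real p))
          \<le> (9 + 2 * c) * real N * L * (2 * L) ^ k2"
        using L c by (intro mult_left_mono) auto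
      with 1 show ?thesis by (rule order_trans)
    qed
    have Lj: "0 < L ^ j" using L by simp
    have "(\<Sum>U\<in>?I N. real \<kappa> ^ card U * ?D N (W * \<Prod>U))
        \<le> (\<Sum>U\<in>?I N. (L ^ j + real \<kappa> ^ (2 * card U) / L ^ j) * ?D N (W * \<Prod>U))"
    proof (intro sum_mono mult_right_mono)
      fix U assume i: "U \<in> ?I N"
      show "0 \<le> ?D N (W * \<Prod>U)" by (rule D0[OF U(6)[OF i]])
      show "real \<kappa> ^ card U \<le> L ^ j + real \<kappa> ^ (2 * card U) / L ^ j"
        using power_le_add_square_div[OF Lj, of "real \<kappa> ^ card U"] by (simp add: power_mult[symmetric] mult.commute)
    qed
    also have "\<dots> = L ^ j * (\<Sum>U\<in>?I N. ?D N (W * \<Prod>U)) + (\<Sum>U\<in>?I N. real \<kappa> ^ (2 * card U) * ?D N (W * \<Prod>U)) / L ^ j"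
      by (simp add: distrib_right sum.distrib sum_distrib_left sum_divide_distrib)
    also have "\<dots> \<le> L ^ j * (C * (real N / L ^ (a + j + 1))) + (9 + 2 * c) * real N * L * (2 * L) ^ k2 / L ^ j"
      using S1 S2 Lj by (intro add_mono mult_left_mono divide_right_mono) auto
    finally have S: "(\<Sum>U\<in>?I N. real \<kappa> ^ card U * ?D N (W * \<Prod>U))
       \<le> L ^ j * (C * (real N / L ^ (a + j + 1))) + (9 + 2 * c) * real N * L * (2 * L) ^ k2 / L ^ j" .
    have nn: "0 \<le> (\<Sum>U\<in>?I N. real \<kappa> ^ card U * ?D N (W * \<Prod>U))"
      using D0[OF U(6)] by (intro sum_nonneg mult_nonneg_nonneg) auto
    have "L ^ a * (\<Sum>U\<in>?I N. real \<kappa> ^ card U * ?D N (W * \<Prod>U)) / real N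
       \<le> L ^ a * (L ^ j * (C * (real N / L ^ (a + j + 1))) + (9 + 2 * c) * real N * L * (2 * L) ^ k2 / L ^ j) / real N"
      using S L N by (intro divide_right_mono mult_left_mono) auto
    also have "\<dots> = C' / L"
      using L N unfolding C'_def j_def
      by (simp add: power_add power_mult_distrib field_simps power2_eq_square)
    finally show ?case using nn L N unfolding L_def[symmetric] by simp
  qed
  have "(\<lambda>N::nat. C' / ln (real N)) \<longlonglongrightarrow> 0" by real_asymp
  then show ?thesis by (rule Lim_null_comparison[OF main])
qed

subsection \<open>The sieve weights\<close>

lemma plog_mult: "plog m x * plog n x = plog (m + n) x"
  by (simp add: plog_def power_add)

lemma subset_sum_linear:
  "subset_sum a P (\<lambda>t. \<alpha> * f t + \<beta> * g t) x = \<alpha> * subset_sum a P f x + \<beta> * subset_sum a P g x"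
  unfolding subset_sum_def sum_distrib_left sum.distrib[symmetric]
  by (intro sum.cong refl) (simp add: algebra_simps)

lemma sum_inverse_squares_le:
  fixes D :: nat
  assumes "1 \<le> D"
  shows "(\<Sum>n\<in>{D<..m}. 1 / (real n)\<^sup>2) \<le> 1 / real D"
proof (cases "D \<le> m")
  case True
  have "(\<Sum>n\<in>{D<..D + j}. 1 / (real n)\<^sup>2) \<le> 1 / real D - 1 / real (D + j)" for j
  proof (induction j)
    case (Suc j)
    have "{D<..D + Suc j} = insert (D + Suc j) {D<..D + j}" by auto
    then have "(\<Sum>n\<in>{D<..D + Suc j}. 1 / (real n)\<^sup>2) = 1 / (real (D + Suc j))\<^sup>2 + (\<Sum>n\<in>{D<..D + j}. 1 / (real n)\<^sup>2)"
      by simp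
    also have "\<dots> \<le> 1 / (real (D + Suc j))\<^sup>2 + (1 / real D - 1 / real (D + j))" using Suc by simp
    also have "1 / (real (D + Suc j))\<^sup>2 \<le> 1 / real (D + j) - 1 / real (D + Suc j)"
    proof -
      define x where "x = real (D + j)"
      have x: "0 < x" using assms by (simp add: x_def)
      have "1 / (x + 1)\<^sup>2 \<le> 1 / (x * (x + 1))"
        using x by (intro divide_left_mono) (auto simp: power2_eq_square)
      also have "\<dots> = 1 / x - 1 / (x + 1)" using x by (simp add: field_simps)
      finally show ?thesis by (simp add: x_def add_ac)
    qed
    finally show ?case by simp
  qed simp
  from this[of "m - D"] True have "(\<Sum>n\<in>{D<..m}. 1 / (real n)\<^sup>2) \<le> 1 / real D - 1 / real m" by simp
  also have "\<dots> \<le> 1 / real D" by simp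
  finally show ?thesis .
qed simp

text \<open>For \<kappa> = k - 1 the right side is (k - 1)/(p - k), the coefficient in the
  diagonalized prime form, whereas the left side is the one with an error-free lower bound.
  Bernoulli's inequality gives slightly more, the denominator p - \<kappa>.\<close>

lemma power_ratio_le:
  fixes p :: real
  assumes "real \<kappa> + 1 < p"
  shows "(p / (p - 1)) ^ \<kappa> - 1 \<le> real \<kappa> / (p - (real \<kappa> + 1))"
proof -
  have p: "1 < p" using assms by linarith
  have "1 + real \<kappa> * (- 1 / p) \<le> (1 + (- 1 / p)) ^ \<kappa>"
    using p by (intro Bernoulli_inequality) (simp add: field_simps)
  then have le: "(p - real \<kappa>) / p \<le> ((p - 1) / p) ^ \<kappa>" using p by (simp add: field_simps)
  have pos: "0 < (p - real \<kappa>) / p" using assms p by simp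
  have "(p / (p - 1)) ^ \<kappa> = 1 / ((p - 1) / p) ^ \<kappa>" using p by (simp add: power_divide)
  also have "\<dots> \<le> 1 / ((p - real \<kappa>) / p)" using le pos by (intro divide_left_mono mult_pos_pos) auto
  also have "\<dots> = 1 + real \<kappa> / (p - real \<kappa>)" using assms p by (simp add: field_simps)
  also have "\<dots> \<le> 1 + real \<kappa> / (p - (real \<kappa> + 1))"
    using assms by (intro add_mono divide_left_mono mult_pos_pos) auto
  finally show ?thesis by simp
qed

text \<open>
  With \<open>u = 1 - s\<close>, these are the integrals over \<open>0 \<le> s \<le> 1\<close> of
  \<open>(1 + 2 b u)\<^sup>2 s\<^sup>k\<^sup>-\<^sup>1 / (k-1)!\<close> and of \<open>(u + b u\<^sup>2)\<^sup>2 s\<^sup>k\<^sup>-\<^sup>2 / (k-2)!\<close>; here \<open>u + b u\<^sup>2\<close> is the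
  antiderivative of \<open>1 + 2 b u\<close>.
\<close>

definition sieve_total :: "nat \<Rightarrow> real \<Rightarrow> real" where
  "sieve_total k b = 1 / fact k + 4 * b / fact (k + 1) + 8 * b\<^sup>2 / fact (k + 2)"

definition prime_total :: "nat \<Rightarrow> real \<Rightarrow> real" where
  "prime_total k b = 2 / fact (k + 1) + 12 * b / fact (k + 2) + 24 * b\<^sup>2 / fact (k + 3)"

section \<open>The sieve and its two quadratic forms\<close>

text \<open>The bounds on D0 place every sifting prime above all shifts, so the roots modulo p are
  distinct, and above 2k, so p - k >= p/2. The class v modulo W excludes all small prime factors of
  the numbers n + h.\<close>

locale gpy_sieve =
  fixes H :: "nat set" and D0 W v d :: nat and b :: real
  assumes finite_H: "finite H" and card_H: "2 \<le> card H"
    and H_less: "\<And>h. h \<in> H \<Longrightarrow> h < d" and d_le: "d \<le> D0" and D0_ge: "2 * card H \<le> D0"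
    and W_eq: "W = \<Prod>{p. prime p \<and> p \<le> D0}"
    and v_less: "v < W" and v_coprime: "\<And>h. h \<in> H \<Longrightarrow> coprime (v + h) W"
    and b_nonneg: "0 \<le> b"
begin

definition sift :: "real \<Rightarrow> nat set" where
  "sift R = {p. prime p \<and> p \<le> nat \<lfloor>R\<rfloor>} - {p. prime p \<and> p \<le> D0}"

definition density :: real where
  "density = real (totient W) / real W"

text \<open>The profile of the diagonal variables y, not of the weights themselves: at t = R/d the
  ratio log t / log R is u = 1 - log d / log R.\<close>

definition cutoff :: "real \<Rightarrow> real \<Rightarrow> real" where
  "cutoff R t = plog 0 t + 2 * b / ln R * plog 1 t"

definition weight :: "real \<Rightarrow> nat set \<Rightarrow> real" where
  "weight R = sieve_weight (\<lambda>p. real (card H) / real p) (\<lambda>p. real (card H) / (real p - real (card H)))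
     (\<lambda>V. cutoff R (R / rprod V)) (sift R)"

abbreviation quadratic_form :: "real \<Rightarrow> (nat \<Rightarrow> real) \<Rightarrow> real" where
  "quadratic_form R \<omega>' \<equiv> (\<Sum>S\<in>Pow (sift R). \<Sum>T\<in>Pow (sift R). weight R S * weight R T * (\<Prod>p\<in>S \<union> T. \<omega>' p))"

definition sieve :: "real \<Rightarrow> nat \<Rightarrow> real" where
  "sieve R n = (\<Sum>S | S \<subseteq> sift R \<and> (\<forall>p\<in>S. hit H p n). weight R S)\<^sup>2"

definition weight_bound :: "real \<Rightarrow> real" where
  "weight_bound R = (1 + 2 * b) * subset_sum (\<lambda>p. real (card H) / (real p - real (card H))) (sift R) (plog 0) R"

definition remainder :: "real \<Rightarrow> real \<Rightarrow> nat \<Rightarrow> real" where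
  "remainder c R N = (weight_bound R)\<^sup>2 * (\<Sum>U | U \<subseteq> sift R \<and> rprod U \<le> R\<^sup>2.
     real (3 * card H) ^ card U * discrepancy c d N (W * \<Prod>U))"

definition shift_const :: real where
  "shift_const = real W * (real W + 1)"

abbreviation shifted_log :: "real \<Rightarrow> real" where
  "shifted_log R \<equiv> ln R + real (card H) * shift_const"

abbreviation sift_loss :: real where
  "sift_loss \<equiv> exp (2 * (real (card H))\<^sup>2 / real D0)"

lemma W_ge_1: "1 \<le> W"
  using v_less by simp

lemma density_pos: "0 < density"
  using W_ge_1 by (simp add: density_def)

lemma shift_const: "real W + 1 \<le> density * shift_const" "0 \<le> shift_const"
proof -
  have "1 \<le> totient W" using W_ge_1 by (simp add: Suc_leI)
  then have "1 * (real W + 1) \<le> real (totient W) * (real W + 1)" by (intro mult_right_mono) auto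
  then show "real W + 1 \<le> density * shift_const"
    using W_ge_1 by (simp add: density_def shift_const_def)
qed (simp add: shift_const_def)

lemma density_eq: "density = (\<Prod>p | prime p \<and> p \<le> D0. 1 - 1 / real p)"
proof -
  let ?Q = "{p::nat. prime p \<and> p \<le> D0}"
  have "totient (1 * \<Prod>?Q) = totient 1 * (\<Prod>p\<in>?Q. p - 1)"
    by (rule totient_mult_prod_primes) auto
  then have "real (totient W) = (\<Prod>p\<in>?Q. real (p - 1))" by (simp flip: W_eq)
  moreover have "real W = (\<Prod>p\<in>?Q. real p)" by (subst W_eq) simp
  ultimately have "density = (\<Prod>p\<in>?Q. real (p - 1)) / (\<Prod>p\<in>?Q. real p)"
    unfolding density_def by simp
  also have "\<dots> = (\<Prod>p\<in>?Q. real (p - 1) / real p)" by (simp add: prod_dividef)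
  also have "\<dots> = (\<Prod>p\<in>?Q. 1 - 1 / real p)"
  proof (intro prod.cong refl)
    fix p assume "p \<in> ?Q"
    then have "1 \<le> p" using prime_ge_1_nat by blast
    then show "real (p - 1) / real p = 1 - 1 / real p" by (simp add: of_nat_diff field_simps)
  qed
  finally show ?thesis .
qed

lemma finite_sift [simp]: "finite (sift R)"
  by (simp add: sift_def)

lemma sift_props:
  assumes "p \<in> sift R"
  shows "prime p" "D0 < p" "coprime p W" "2 * card H < p" "d < p" "1 < p"
    "real (card H) < real p" "2 \<le> real (card H)" "2 * real (card H) < real p"
proof -
  show p: "prime p" "D0 < p" using assms by (auto simp: sift_def)
  have "\<not> p dvd W"
  proof
    assume "p dvd W"
    then obtain q where "prime q" "q \<le> D0" "p dvd q"
      using p unfolding W_eq by (subst (asm) prime_dvd_prod_iff) auto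
    then have "p = q" using p by (simp add: primes_dvd_imp_eq)
    then show False using p \<open>q \<le> D0\<close> by simp
  qed
  then show "coprime p W" using p by (intro prime_imp_coprime) auto
  show "2 * card H < p" "d < p" using p D0_ge d_le by auto
  then show "real (card H) < real p" "2 * real (card H) < real p" by linarith+
  show "2 \<le> real (card H)" using card_H by simp
  show "1 < p" using p prime_gt_1_nat by blast
qed

text \<open>The excess of k/(p - k) over k/p is at most 2 k^2/p^2 because p > 2k. Over p > D0 the
  product of 1 plus the excesses is at most exp(2 k^2/D0), which is
  \<open>sift_loss\<close>.\<close>

lemma subset_sum_sift_le:
  assumes R: "1 \<le> R"
  shows "subset_sum (\<lambda>p. real (card H) / (real p - real (card H))) (sift R) (plog m) R
     \<le> sift_loss * (density ^ card H * (fact m / fact (m + card H))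
         * shifted_log R ^ (m + card H))"
proof -
  let ?k = "real (card H)"
  define \<rho> where "\<rho> = (\<lambda>p. ?k\<^sup>2 / (real p * (real p - ?k)))"
  have "subset_sum (\<lambda>p. ?k / (real p - ?k)) (sift R) (plog m) R
      = subset_sum (\<lambda>p. ?k / real p + \<rho> p) (sift R) (plog m) R"
  proof (rule subset_sum_cong)
    fix p assume "p \<in> sift R"
    note s = sift_props[OF this]
    have "?k / real p + \<rho> p = (?k * (real p - ?k) + ?k\<^sup>2) / (real p * (real p - ?k))"
      unfolding \<rho>_def using s by (simp add: add_divide_distrib)
    also have "\<dots> = (real p * ?k) / (real p * (real p - ?k))" by (simp add: algebra_simps power2_eq_square)
    also have "\<dots> = ?k / (real p - ?k)" using s by simp
    finally show "?k / (real p - ?k) = ?k / real p + \<rho> p" by simp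
  qed
  also have "\<dots> \<le> (\<Prod>p\<in>sift R. 1 + \<rho> p) * subset_sum (\<lambda>p. ?k / real p) (sift R) (plog m) R"
  proof (rule subset_sum_perturb)
    fix p assume "p \<in> sift R"
    note s = sift_props[OF this]
    show "0 \<le> ?k / real p \<and> 0 \<le> \<rho> p \<and> 1 \<le> p" using s by (simp add: \<rho>_def)
  qed (use R mono_plog in auto)
  also have "\<dots> \<le> exp (2 * ?k\<^sup>2 / real D0) * (density ^ card H * (fact m / fact (m + card H))
         * plog (m + card H) (R * exp (?k * shift_const)))"
  proof (intro mult_mono)
    have "(\<Prod>p\<in>sift R. 1 + \<rho> p) \<le> (\<Prod>p\<in>sift R. exp (2 * ?k\<^sup>2 * (1 / (real p)\<^sup>2)))"
    proof (intro prod_mono conjI)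
      fix p assume "p \<in> sift R"
      note s = sift_props[OF this]
      show "0 \<le> 1 + \<rho> p" using s by (simp add: \<rho>_def)
      have "\<rho> p \<le> ?k\<^sup>2 / (real p * (real p / 2))"
        unfolding \<rho>_def using s by (intro divide_left_mono mult_left_mono mult_pos_pos) auto
      also have "\<dots> = 2 * ?k\<^sup>2 * (1 / (real p)\<^sup>2)" by (simp add: power2_eq_square)
      finally have "1 + \<rho> p \<le> 1 + 2 * ?k\<^sup>2 * (1 / (real p)\<^sup>2)" by simp
      then show "1 + \<rho> p \<le> exp (2 * ?k\<^sup>2 * (1 / (real p)\<^sup>2))"
        using exp_ge_add_one_self order_trans by blast
    qed
    also have "\<dots> = exp (2 * ?k\<^sup>2 * (\<Sum>p\<in>sift R. 1 / (real p)\<^sup>2))"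
      by (simp add: exp_sum sum_distrib_left)
    also have "\<dots> \<le> exp (2 * ?k\<^sup>2 * (1 / real D0))"
    proof -
      have "(\<Sum>p\<in>sift R. 1 / (real p)\<^sup>2) \<le> (\<Sum>n\<in>{D0<..nat \<lfloor>R\<rfloor>}. 1 / (real n)\<^sup>2)"
        by (intro sum_mono2) (auto simp: sift_def)
      also have "\<dots> \<le> 1 / real D0" using D0_ge card_H by (intro sum_inverse_squares_le) auto
      finally show ?thesis by (simp only: exp_le_cancel_iff) (intro mult_left_mono, auto)
    qed
    finally show "(\<Prod>p\<in>sift R. 1 + \<rho> p) \<le> exp (2 * ?k\<^sup>2 / real D0)" by simp
    show "subset_sum (\<lambda>p. ?k / real p) (sift R) (plog m) R
        \<le> density ^ card H * (fact m / fact (m + card H)) * plog (m + card H) (R * exp (?k * shift_const))"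
      unfolding density_def
      by (rule subset_sum_plog_le) (use sift_props W_ge_1 shift_const R in \<open>auto simp: density_def\<close>)
    show "0 \<le> subset_sum (\<lambda>p. ?k / real p) (sift R) (plog m) R"
      by (intro subset_sum_nonneg) auto
  qed auto
  also have "plog (m + card H) (R * exp (?k * shift_const)) = (ln R + ?k * shift_const) ^ (m + card H)"
  proof -
    have "1 * 1 \<le> R * exp (?k * shift_const)" using R shift_const by (intro mult_mono) auto
    then show ?thesis using R by (simp add: plog_def ln_mult)
  qed
  finally show ?thesis .
qed

text \<open>Form and weights share the density k/p, so only U = {} survives in each inner sum. What
  is left is a k-dimensional sum of the squared cutoff, with coefficient (p - k)/k * (k/(p - k))^2 =
  k/(p - k).\<close>

lemma weight_diagonal_one:
  assumes R: "1 < R"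
  shows "quadratic_form R (\<lambda>p. real (card H) / real p)
     \<le> sift_loss * density ^ card H
        * (shifted_log R ^ card H / fact (card H)
          + 4 * b / ln R * (shifted_log R ^ (card H + 1) / fact (card H + 1))
          + 8 * b\<^sup>2 / (ln R)\<^sup>2 * (shifted_log R ^ (card H + 2) / fact (card H + 2)))"
proof -
  let ?k = "real (card H)"
  let ?a = "\<lambda>p. ?k / (real p - ?k)"
  let ?X = "ln R + ?k * shift_const"
  let ?s = "\<lambda>V U. cutoff R (R / rprod (V \<union> U)) * (\<Prod>p\<in>U. ?a p * (1 - (?k / real p) / (?k / real p)))"
  let ?E = "exp (2 * ?k\<^sup>2 / real D0)"
  have L: "0 < ln R" using R by simp
  have "quadratic_form R (\<lambda>p. ?k / real p)
     = (\<Sum>V\<in>Pow (sift R). (\<Prod>p\<in>V. (1 / (?k / real p) - 1) * ((?k / real p) / (?k / real p) * ?a p)\<^sup>2)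
         * (\<Sum>U\<in>Pow (sift R - V). ?s V U)\<^sup>2)"
    unfolding weight_def
  proof (rule selberg_diagonalization)
    fix p assume "p \<in> sift R"
    from sift_props[OF this] show "?k / real p \<noteq> 0" by simp
  qed simp
  also have "\<dots> = subset_sum ?a (sift R) (\<lambda>t. (cutoff R t)\<^sup>2) R"
    unfolding subset_sum_def
  proof (intro sum.cong refl arg_cong2[of _ _ _ _ "(*)"])
    fix V assume V: "V \<in> Pow (sift R)"
    show "(\<Prod>p\<in>V. (1 / (?k / real p) - 1) * ((?k / real p) / (?k / real p) * ?a p)\<^sup>2) = (\<Prod>p\<in>V. ?a p)"
    proof (intro prod.cong refl)
      fix p assume "p \<in> V"
      then have "p \<in> sift R" using V by auto
      note s = sift_props[OF this]
      have "1 / (?k / real p) - 1 = (real p - ?k) / ?k" using s by (simp add: field_simps)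
      moreover have "(?k / real p) / (?k / real p) = 1" using s by simp
      ultimately show "(1 / (?k / real p) - 1) * ((?k / real p) / (?k / real p) * ?a p)\<^sup>2 = ?a p"
        using s by (simp add: power2_eq_square)
    qed
    have "(\<Sum>U\<in>Pow (sift R - V). ?s V U)
       = (\<Sum>U\<in>{{}}. ?s V U)"
    proof (rule sum.mono_neutral_right)
      show "\<forall>U\<in>Pow (sift R - V) - {{}}. ?s V U = 0"
      proof
        fix U assume U: "U \<in> Pow (sift R - V) - {{}}"
        then obtain p where p: "p \<in> U" "p \<in> sift R" by auto
        have fin: "finite U" using U finite_subset[of U "sift R"] by auto
        have "?a p * (1 - (?k / real p) / (?k / real p)) = 0" using sift_props[OF p(2)] by simp
        then have "(\<Prod>p\<in>U. ?a p * (1 - (?k / real p) / (?k / real p))) = 0"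
          by (intro prod_zero[OF fin] bexI[OF _ p(1)])
        then show "?s V U = 0"
          by simp
      qed
    qed auto
    then show "(\<Sum>U\<in>Pow (sift R - V). ?s V U)\<^sup>2
       = (cutoff R (R / rprod V))\<^sup>2" by simp
  qed
  \<comment> \<open>The coefficient of \<open>plog 2\<close> is 4 b^2 / (ln R)^2; the factor fact 2
    in its estimate makes this the 8 b^2 of the claim.\<close>
  also have "(\<lambda>t. (cutoff R t)\<^sup>2) = (\<lambda>t. 1 * plog 0 t + 1 * ((4 * b / ln R) * plog 1 t + (4 * b\<^sup>2 / (ln R)\<^sup>2) * plog 2 t))"
  proof
    fix t
    have "(cutoff R t)\<^sup>2 = plog 0 t * plog 0 t + 4 * b / ln R * (plog 0 t * plog 1 t) + 4 * b\<^sup>2 / (ln R)\<^sup>2 * (plog 1 t * plog 1 t)"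
      unfolding cutoff_def by (simp add: power2_eq_square algebra_simps)
    then show "(cutoff R t)\<^sup>2 = 1 * plog 0 t + 1 * ((4 * b / ln R) * plog 1 t + (4 * b\<^sup>2 / (ln R)\<^sup>2) * plog 2 t)"
      unfolding plog_mult by (simp add: numeral_2_eq_2)
  qed
  also have "subset_sum ?a (sift R) \<dots> R = subset_sum ?a (sift R) (plog 0) R
      + (4 * b / ln R * subset_sum ?a (sift R) (plog 1) R + 4 * b\<^sup>2 / (ln R)\<^sup>2 * subset_sum ?a (sift R) (plog 2) R)"
    unfolding subset_sum_linear by simp
  also have "\<dots> \<le> ?E * (density ^ card H * (fact 0 / fact (0 + card H)) * ?X ^ (0 + card H))
      + (4 * b / ln R * (?E * (density ^ card H * (fact 1 / fact (1 + card H)) * ?X ^ (1 + card H)))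
        + 4 * b\<^sup>2 / (ln R)\<^sup>2 * (?E * (density ^ card H * (fact 2 / fact (2 + card H)) * ?X ^ (2 + card H))))"
    using R L b_nonneg by (intro add_mono mult_left_mono subset_sum_sift_le) auto
  also have "\<dots> = ?E * density ^ card H * (?X ^ card H / fact (card H)
          + 4 * b / ln R * (?X ^ (card H + 1) / fact (card H + 1))
          + 8 * b\<^sup>2 / (ln R)\<^sup>2 * (?X ^ (card H + 2) / fact (card H + 2)))"
    by (simp only: distrib_left add.commute[of _ "card H"] fact_0 fact_1 fact_2) (simp add: mult_ac)
  finally show ?thesis .
qed

text \<open>The inner sum of the prime form is one-dimensional and integrates the cutoff once,
  turning 1 + 2 b u into u + b u^2. The absent primes, those up to D0 and those in V, cost the
  stated product.\<close>

lemma sift_diff_sum_ge: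
  assumes R: "1 < R" "real D0 \<le> R" and V: "V \<subseteq> sift R"
  shows "(\<Prod>p\<in>V. 1 - 1 / real p) * density
       * (plog 1 (R / rprod V) + b / ln R * plog 2 (R / rprod V))
     \<le> totient_sum (sift R - V) (cutoff R) (R / rprod V)"
proof -
  let ?Q = "{p::nat. prime p \<and> p \<le> D0}" and ?P0 = "{p::nat. prime p \<and> p \<le> nat \<lfloor>R\<rfloor>}"
  define t where "t = R / rprod V"
  have fin: "finite V" by (rule finite_subset[OF V finite_sift])
  have V1: "1 \<le> rprod V" using V sift_props(1) by (intro prod_primes_ge_1) auto
  have t0: "0 \<le> t" using R V1 by (simp add: t_def)
  have "t \<le> R" using R V1 divide_left_mono[of 1 "rprod V" R] by (simp add: t_def)
  then have tR: "t < real (Suc (nat \<lfloor>R\<rfloor>))" using R by linarith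
  have sub: "?Q \<union> V \<subseteq> ?P0"
    using V R by (auto simp: sift_def le_nat_floor)
  have seteq: "?P0 - (?Q \<union> V) = sift R - V" by (auto simp: sift_def)
  have prodeq: "(\<Prod>p\<in>?Q \<union> V. 1 - 1 / real p) = (\<Prod>p\<in>V. 1 - 1 / real p) * density"
    unfolding density_eq using V fin
    by (subst prod.union_disjoint) (auto simp: sift_def mult.commute)
  have coeff: "subset_sum (\<lambda>p. (real p / (real p - 1)) ^ 1 - 1) (sift R - V) f t
      = totient_sum (sift R - V) f t" for f
  proof (rule subset_sum_cong)
    fix p assume "p \<in> sift R - V"
    then have "1 < p" using sift_props(6) by blast
    then show "(real p / (real p - 1)) ^ 1 - 1 = 1 / (real p - 1)" by (simp add: field_simps)
  qed
  have ge: "(\<Prod>p\<in>V. 1 - 1 / real p) * density * (fact m / fact (m + 1)) * plog (m + 1) t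
      \<le> totient_sum (sift R - V) (plog m) t" for m
    using subset_sum_plog_ge[OF sub t0 tR, of 1 m] unfolding seteq prodeq coeff by simp
  have cut: "cutoff R = (\<lambda>t. 1 * plog 0 t + 2 * b / ln R * plog 1 t)" by (auto simp: cutoff_def fun_eq_iff)
  let ?F = "(\<Prod>p\<in>V. 1 - 1 / real p) * density"
  have "?F * (plog 1 t + b / ln R * plog 2 t)
     = 1 * (?F * (fact 0 / fact (0 + 1)) * plog (0 + 1) t) + 2 * b / ln R * (?F * (fact 1 / fact (1 + 1)) * plog (1 + 1) t)"
    by (simp add: algebra_simps numeral_2_eq_2)
  also have "\<dots> \<le> totient_sum (sift R - V) (cutoff R) t"
    unfolding cut subset_sum_linear using R b_nonneg by (intro add_mono mult_left_mono ge) auto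
  finally show ?thesis unfolding t_def .
qed

lemma subset_sum_sift_ge:
  assumes R: "1 < R" "real D0 \<le> R"
  shows "density ^ (card H - 1) * (fact m / fact (m + (card H - 1))) * ln R ^ (m + (card H - 1))
     \<le> subset_sum (\<lambda>p. (real (card H) - 1) / (real p - real (card H))) (sift R) (plog m) R"
proof -
  let ?\<kappa> = "card H - 1"
  have k: "real (card H) = real ?\<kappa> + 1" using card_H by simp
  have "density ^ ?\<kappa> * (fact m / fact (m + ?\<kappa>)) * plog (m + ?\<kappa>) R
      \<le> subset_sum (\<lambda>p. (real p / (real p - 1)) ^ ?\<kappa> - 1) (sift R) (plog m) R"
    unfolding density_eq sift_def
  proof (rule subset_sum_plog_ge)
    show "{p. prime p \<and> p \<le> D0} \<subseteq> {p. prime p \<and> p \<le> nat \<lfloor>R\<rfloor>}"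
      using R by (auto simp: le_nat_floor)
    show "R < real (Suc (nat \<lfloor>R\<rfloor>))" using R by linarith
  qed (use R in auto)
  also have "\<dots> \<le> subset_sum (\<lambda>p. (real (card H) - 1) / (real p - real (card H))) (sift R) (plog m) R"
  proof (rule subset_sum_mono_coeff)
    fix p assume "p \<in> sift R"
    note s = sift_props[OF this]
    have "1 \<le> real p / (real p - 1)" using s by simp
    then have "1 \<le> (real p / (real p - 1)) ^ ?\<kappa>" by (rule one_le_power)
    moreover have "(real p / (real p - 1)) ^ ?\<kappa> - 1 \<le> real ?\<kappa> / (real p - (real ?\<kappa> + 1))"
    proof (rule power_ratio_le)
      show "real ?\<kappa> + 1 < real p" using s(7) k by linarith
    qed
    moreover have "real ?\<kappa> = real (card H) - 1" using k by linarith
    moreover have "real ?\<kappa> + 1 = real (card H)" using k by linarith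
    ultimately show "0 \<le> (real p / (real p - 1)) ^ ?\<kappa> - 1 \<and>
        (real p / (real p - 1)) ^ ?\<kappa> - 1 \<le> (real (card H) - 1) / (real p - real (card H))"
      by (metis diff_ge_0_iff_ge)
  qed simp
  finally show ?thesis using R by (simp add: plog_def)
qed

text \<open>Of the k + 1 powers of \<open>density\<close> and of \<open>ln R\<close>, the squared
  inner sum supplies two and the outer (k - 1)-dimensional sum the others. The coefficients 2, 12 b
  and 24 b^2 are fact 2, 2 b * fact 3 and b^2 * fact 4.\<close>

lemma weight_diagonal_primes:
  assumes R: "1 < R" "real D0 \<le> R"
  shows "density ^ (card H + 1) * ln R ^ (card H + 1)
        * prime_total (card H) b
     \<le> quadratic_form R (\<lambda>p. (real (card H) - 1) / (real p - 1))"
proof -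
  let ?k = "real (card H)"
  let ?a = "\<lambda>p. ?k / (real p - ?k)" and ?w = "\<lambda>p. ?k / real p" and ?w' = "\<lambda>p. (?k - 1) / (real p - 1)"
  let ?h = "\<lambda>p. (?k - 1) / (real p - ?k)"
  let ?s = "\<lambda>V U. cutoff R (R / rprod (V \<union> U)) * (\<Prod>p\<in>U. ?a p * (1 - ?w' p / ?w p))"
  let ?c = "\<lambda>V. \<Prod>p\<in>V. (1 / ?w' p - 1) * (?w' p / ?w p * ?a p)\<^sup>2"
  define g where "g = (\<lambda>t. plog 1 t + b / ln R * plog 2 t)"
  have L: "0 < ln R" using R by simp
  have g0: "0 \<le> g t" for t using L b_nonneg by (simp add: g_def)
  obtain \<kappa> where \<kappa>: "card H = Suc \<kappa>" using card_H by (cases "card H") auto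
  have "density ^ (card H + 1) * ln R ^ (card H + 1)
        * prime_total (card H) b
     = density\<^sup>2 * (1 * (density ^ \<kappa> * (fact 2 / fact (2 + \<kappa>)) * ln R ^ (2 + \<kappa>))
         + 1 * (2 * b / ln R * (density ^ \<kappa> * (fact 3 / fact (3 + \<kappa>)) * ln R ^ (3 + \<kappa>))
         + b\<^sup>2 / (ln R)\<^sup>2 * (density ^ \<kappa> * (fact 4 / fact (4 + \<kappa>)) * ln R ^ (4 + \<kappa>))))"
  proof -
    have 1: "ln R ^ (3 + \<kappa>) = ln R * ln R ^ (2 + \<kappa>)" "ln R ^ (4 + \<kappa>) = (ln R)\<^sup>2 * ln R ^ (2 + \<kappa>)"
      "ln R ^ (card H + 1) = ln R ^ (2 + \<kappa>)" "density ^ (card H + 1) = density\<^sup>2 * density ^ \<kappa>"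
      by (auto simp: \<kappa> power_add[symmetric] power2_eq_square numeral_eq_Suc)
    have 2: "card H + 1 = 2 + \<kappa>" "card H + 2 = 3 + \<kappa>" "card H + 3 = 4 + \<kappa>" using \<kappa> by auto
    have 3: "fact 2 = (2::real)" "fact 3 = (6::real)" "fact 4 = (24::real)" by (auto simp: fact_numeral)
    show ?thesis
      unfolding prime_total_def 1 2 3 using L by (simp add: distrib_left mult_ac power2_eq_square)
  qed
  also have "\<dots> \<le> density\<^sup>2 * (1 * subset_sum ?h (sift R) (plog 2) R
         + 1 * (2 * b / ln R * subset_sum ?h (sift R) (plog 3) R
         + b\<^sup>2 / (ln R)\<^sup>2 * subset_sum ?h (sift R) (plog 4) R))"
  proof -
    have ge: "density ^ \<kappa> * (fact m / fact (m + \<kappa>)) * ln R ^ (m + \<kappa>) \<le> subset_sum ?h (sift R) (plog m) R" for m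
      using subset_sum_sift_ge[OF R, of m] \<kappa> by simp
    show ?thesis using L b_nonneg by (intro mult_left_mono add_mono ge) auto
  qed
  also have "\<dots> = density\<^sup>2 * subset_sum ?h (sift R) (\<lambda>t. (g t)\<^sup>2) R"
  proof -
    have "(\<lambda>t. (g t)\<^sup>2) = (\<lambda>t. 1 * plog 2 t + 1 * (2 * b / ln R * plog 3 t + b\<^sup>2 / (ln R)\<^sup>2 * plog 4 t))"
    proof
      fix t
      have "(g t)\<^sup>2 = plog 1 t * plog 1 t + 2 * b / ln R * (plog 1 t * plog 2 t) + b\<^sup>2 / (ln R)\<^sup>2 * (plog 2 t * plog 2 t)"
        unfolding g_def by (simp add: power2_eq_square algebra_simps)
      then show "(g t)\<^sup>2 = 1 * plog 2 t + 1 * (2 * b / ln R * plog 3 t + b\<^sup>2 / (ln R)\<^sup>2 * plog 4 t)"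
        unfolding plog_mult by (simp add: numeral_eq_Suc)
    qed
    then show ?thesis by (simp only: subset_sum_linear)
  qed
  also have "\<dots> = (\<Sum>V\<in>Pow (sift R). ?c V
         * ((\<Prod>p\<in>V. 1 - 1 / real p) * density * g (R / rprod V))\<^sup>2)"
    unfolding subset_sum_def sum_distrib_left
  proof (intro sum.cong refl)
    fix V assume V: "V \<in> Pow (sift R)"
    \<comment> \<open>The loss (1 - 1/p)^2 from the squared inner sum fits exactly: it turns the
      diagonal coefficient into (k - 1)/(p - k).\<close>
    have "?c V * (\<Prod>p\<in>V. 1 - 1 / real p)\<^sup>2 = (\<Prod>p\<in>V. ?h p)"
      unfolding prod_power_distrib prod.distrib[symmetric]
    proof (intro prod.cong refl)
      fix p assume "p \<in> V"
      then have "p \<in> sift R" using V by auto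
      note s = sift_props[OF this]
      define x where "x = real p"
      define k where "k = ?k"
      have x: "k < x" "2 \<le> k" "1 < x" using s by (auto simp: x_def k_def)
      have 1: "1 / ?w' p - 1 = (x - k) / (k - 1)" using x unfolding x_def[symmetric] k_def[symmetric] by (simp add: field_simps)
      have "1 - 1 / x = (x - 1) / x" using x by (simp add: field_simps)
      then have 2: "?w' p / ?w p * ?a p * (1 - 1 / real p) = (k - 1) / (x - k)"
        using x unfolding x_def[symmetric] k_def[symmetric] by simp
      have "(1 / ?w' p - 1) * (?w' p / ?w p * ?a p)\<^sup>2 * (1 - 1 / real p)\<^sup>2
          = (1 / ?w' p - 1) * (?w' p / ?w p * ?a p * (1 - 1 / real p))\<^sup>2"
        by (simp only: power_mult_distrib mult.assoc)
      also have "\<dots> = (x - k) / (k - 1) * ((k - 1) / (x - k))\<^sup>2" unfolding 1 2 ..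
      also have "\<dots> = (k - 1) / (x - k)" using x by (simp add: power2_eq_square)
      finally show "(1 / ?w' p - 1) * (?w' p / ?w p * ?a p)\<^sup>2 * (1 - 1 / real p)\<^sup>2 = ?h p"
        by (simp add: x_def k_def)
    qed
    then show "density\<^sup>2 * ((\<Prod>p\<in>V. ?h p) * (g (R / rprod V))\<^sup>2)
       = ?c V
         * ((\<Prod>p\<in>V. 1 - 1 / real p) * density * g (R / rprod V))\<^sup>2"
      by (simp only: power_mult_distrib flip: mult.assoc) (simp only: mult_ac)
  qed
  also have "\<dots> \<le> (\<Sum>V\<in>Pow (sift R). ?c V
         * (\<Sum>U\<in>Pow (sift R - V). ?s V U)\<^sup>2)"
  \<comment> \<open>Squaring a lower bound is legitimate because it is nonnegative; the coefficients
    are nonnegative since 1/\<omega>' - 1 = (p - k)/(k - 1).\<close>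
  proof (intro sum_mono mult_left_mono power_mono)
    fix V assume V: "V \<in> Pow (sift R)"
    have fin: "finite V" using V finite_subset[of V "sift R"] by auto
    have "(\<Sum>U\<in>Pow (sift R - V). ?s V U)
       = totient_sum (sift R - V) (cutoff R) (R / rprod V)"
      unfolding subset_sum_def
    proof (intro sum.cong refl)
      fix U assume U: "U \<in> Pow (sift R - V)"
      have "finite U" using U finite_subset[of U "sift R"] by auto
      then have "rprod (V \<union> U) = rprod V * rprod U"
        using U fin by (intro prod.union_disjoint) auto
      moreover have "(\<Prod>p\<in>U. ?a p * (1 - ?w' p / ?w p)) = (\<Prod>p\<in>U. 1 / (real p - 1))"
      proof (intro prod.cong refl)
        fix p assume "p \<in> U"
        then have "p \<in> sift R" using U by auto
        note s = sift_props[OF this]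
        define x where "x = real p"
        define k where "k = ?k"
        have x: "k < x" "2 \<le> k" "1 < x" using s by (auto simp: x_def k_def)
        have "1 - ?w' p / ?w p = (x - k) / (k * (x - 1))"
          using x unfolding x_def[symmetric] k_def[symmetric] by (simp add: field_simps)
        then show "?a p * (1 - ?w' p / ?w p) = 1 / (real p - 1)"
          using x unfolding x_def[symmetric] k_def[symmetric] by simp
      qed
      ultimately show "?s V U
         = (\<Prod>p\<in>U. 1 / (real p - 1)) * cutoff R (R / rprod V / rprod U)"
        by (simp add: mult.commute)
    qed
    then show "(\<Prod>p\<in>V. 1 - 1 / real p) * density * g (R / rprod V)
       \<le> (\<Sum>U\<in>Pow (sift R - V). ?s V U)"
      using sift_diff_sum_ge[OF R, of V] V by (simp add: g_def)
    show "0 \<le> (\<Prod>p\<in>V. 1 - 1 / real p) * density * g (R / rprod V)"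
    proof (intro mult_nonneg_nonneg g0 prod_nonneg)
      fix p assume "p \<in> V"
      then have "1 < p" using V sift_props(6) by blast
      then show "0 \<le> 1 - 1 / real p" by simp
    qed (use density_pos in simp)
    show "0 \<le> ?c V"
    proof (intro prod_nonneg mult_nonneg_nonneg)
      fix p assume "p \<in> V"
      then have "p \<in> sift R" using V by auto
      note s = sift_props[OF this]
      show "0 \<le> 1 / ?w' p - 1" using s by (simp add: field_simps)
    qed auto
  qed
  also have "\<dots> = quadratic_form R (\<lambda>p. ?w' p)"
    unfolding weight_def
  proof (rule selberg_diagonalization[symmetric])
    fix p assume "p \<in> sift R"
    from sift_props[OF this] show "?w' p \<noteq> 0" by simp
  qed simp
  finally show ?thesis .
qed

lemma abs_weight_le:
  assumes R: "1 < R" and S: "S \<subseteq> sift R"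
  shows "\<bar>weight R S\<bar> \<le> weight_bound R * plog 0 (R / rprod S)"
  unfolding weight_def weight_bound_def
proof (rule abs_sieve_weight_le[OF _ _ S])
  fix p assume "p \<in> sift R"
  note s = sift_props[OF this]
  show "prime p" by (fact s)
  show "0 < real (card H) / real p \<and> 0 \<le> real (card H) / (real p - real (card H)) \<and>
      real (card H) / (real p - real (card H)) / (real (card H) / real p) = 1 + real (card H) / (real p - real (card H))"
    using s by (auto simp: field_simps)
next
  fix V assume V: "V \<subseteq> sift R"
  let ?t = "R / rprod V"
  have V1: "1 \<le> rprod V" using V sift_props(1) by (intro prod_primes_ge_1) auto
  then have t: "?t \<le> R" using R divide_left_mono[of 1 "rprod V" R] by simp
  have L: "0 < ln R" using R by simp
  have "plog 1 ?t \<le> ln R * plog 0 ?t"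
    using t by (auto simp: plog_def)
  then have "2 * b / ln R * plog 1 ?t \<le> 2 * b / ln R * (ln R * plog 0 ?t)"
    using b_nonneg L by (intro mult_left_mono) auto
  also have "\<dots> = 2 * b * plog 0 ?t" using L by simp
  finally show "0 \<le> cutoff R ?t \<and> cutoff R ?t \<le> (1 + 2 * b) * plog 0 ?t"
    using b_nonneg L by (auto simp: cutoff_def algebra_simps)
qed (use R b_nonneg in auto)

lemma weight_bound_nonneg: "0 \<le> weight_bound R"
  unfolding weight_bound_def
proof (intro mult_nonneg_nonneg subset_sum_nonneg)
  fix p assume "p \<in> sift R"
  from sift_props[OF this] show "0 \<le> real (card H) / (real p - real (card H))" by simp
qed (use b_nonneg in auto)

lemma remainder_nonneg: "1 \<le> N \<Longrightarrow> 0 \<le> c \<Longrightarrow> 0 \<le> remainder c R N"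
  unfolding remainder_def
proof (intro mult_nonneg_nonneg sum_nonneg discrepancy_nonneg)
  fix U assume "U \<in> {U. U \<subseteq> sift R \<and> rprod U \<le> R\<^sup>2}"
  then have "0 < \<Prod>U" using sift_props(1) by (intro prod_primes_pos) auto
  then show "1 \<le> W * \<Prod>U" using W_ge_1 by (simp add: Suc_leI)
qed auto

lemma sieved_sum_remainder:
  fixes f :: "nat \<Rightarrow> real"
  assumes R: "1 < R" and N: "1 \<le> N" and c: "0 \<le> c"
    and approx: "\<And>U. U \<subseteq> sift R \<Longrightarrow>
      \<bar>(\<Sum>n\<in>sifted H W v {M<..N} U. f n) - Y * (\<Prod>p\<in>U. \<omega>' p)\<bar>
        \<le> real (card H) ^ card U * discrepancy c d N (W * \<Prod>U)"
  shows "\<bar>(\<Sum>n | n \<in> {M<..N} \<and> n mod W = v. f n * sieve R n)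
      - Y * quadratic_form R \<omega>'\<bar>
      \<le> remainder c R N"
proof -
  let ?e = "\<lambda>U. real (card H) ^ card U * discrepancy c d N (W * \<Prod>U)"
  have e0: "0 \<le> ?e U" if "U \<subseteq> sift R" for U
  proof -
    have "0 < \<Prod>U" using that sift_props(1) by (intro prod_primes_pos) auto
    then have "1 \<le> W * \<Prod>U" using W_ge_1 by (simp add: Suc_leI)
    then show ?thesis using N c by (intro mult_nonneg_nonneg discrepancy_nonneg) auto
  qed
  have "\<bar>(\<Sum>n | n \<in> {M<..N} \<and> n mod W = v. f n * sieve R n)
      - Y * quadratic_form R \<omega>'\<bar>
      \<le> (\<Sum>S\<in>Pow (sift R). \<Sum>T\<in>Pow (sift R). \<bar>weight R S * weight R T\<bar> * ?e (S \<union> T))"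
    unfolding sieve_def by (rule sieved_sum_approx[OF _ _ approx]) auto
  also have "\<dots> \<le> (weight_bound R)\<^sup>2 * (\<Sum>U | U \<subseteq> sift R \<and> rprod U \<le> R\<^sup>2. 3 ^ card U * ?e U)"
    by (rule sieve_remainder_le[OF _ _ abs_weight_le[OF R] e0]) (use sift_props(1) R weight_bound_nonneg in auto)
  also have "\<dots> = remainder c R N"
    unfolding remainder_def by (simp add: power_mult_distrib mult.assoc)
  finally show ?thesis .
qed

subsection \<open>Comparing primes with the Liouville function\<close>

text \<open>\<open>bad\<close> negates the desired conclusion pointwise; it is averaged against the
  sieve and both sides are evaluated. The constant c dominates the boundary counts M + 3, M + 2 d
  and M + 2 i + 1 of the three sums.\<close>

lemma sieve_inequality:
  assumes R: "1 < R" "real D0 \<le> R" and N: "3 \<le> N" "M \<le> N"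
    and c: "c = real M + 2 * real d + 3"
    and bad: "\<And>n. M < n \<Longrightarrow> (\<Sum>h\<in>H. of_bool (prime (n + h))) \<le> (1 + rliouville (n + d)) / 2"
  shows "real (card H) * (real N / real (totient W) * (density ^ (card H + 1) * ln R ^ (card H + 1)
        * prime_total (card H) b) - remainder c R N)
    \<le> ln (real (N + d)) / 2 * (real N / real W * (sift_loss * density ^ card H
        * (shifted_log R ^ card H / fact (card H)
          + 4 * b / ln R * (shifted_log R ^ (card H + 1) / fact (card H + 1))
          + 8 * b\<^sup>2 / (ln R)\<^sup>2 * (shifted_log R ^ (card H + 2) / fact (card H + 2))))
        + 2 * remainder c R N)"
    (is "real (card H) * (real N / real (totient W) * ?J - ?r) \<le> ln (real (N + d)) / 2 * (real N / real W * ?I + 2 * ?r)")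
proof -
  let ?Z = "{n. n \<in> {M<..N} \<and> n mod W = v}"
  have c0: "0 \<le> c" and N1: "1 \<le> N" using c N by auto
  have "exp 1 \<le> real (N + d)" using exp_le N by (simp add: order_trans)
  then have l1: "1 \<le> ln (real (N + d))" using N by (subst ln_ge_iff) auto
  have U: "finite U" "\<And>p. p \<in> U \<Longrightarrow> prime p \<and> coprime p W" "\<And>p h. p \<in> U \<Longrightarrow> h \<in> H \<Longrightarrow> h < p"
    "1 \<le> W * \<Prod>U" if "U \<subseteq> sift R" for U
  proof -
    show "finite U" by (rule finite_subset[OF that finite_sift])
    show pr: "\<And>p. p \<in> U \<Longrightarrow> prime p \<and> coprime p W" using that sift_props(1,3) by blast
    show "h < p" if "p \<in> U" "h \<in> H" for p h
      using H_less[OF that(2)] sift_props(5)[of p R] that(1) \<open>U \<subseteq> sift R\<close> by auto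
    have "0 < \<Prod>U" using pr by (intro prod_primes_pos) auto
    then show "1 \<le> W * \<Prod>U" using W_ge_1 by (simp add: Suc_leI)
  qed
  have disc: "prime_discrepancy N (W * \<Prod>U) + c * ln (real (N + d)) \<le> discrepancy c d N (W * \<Prod>U)"
    "liouville_discrepancy N (W * \<Prod>U) + c * ln (real (N + d)) \<le> discrepancy c d N (W * \<Prod>U)"
    "c * ln (real (N + d)) \<le> discrepancy c d N (W * \<Prod>U)" if "U \<subseteq> sift R" for U
    using prime_discrepancy_nonneg[OF U(4)[OF that], of N] liouville_discrepancy_nonneg[OF U(4)[OF that], of N]
    by (auto simp: discrepancy_def)
  have cl: "x \<le> c * ln (real (N + d))" if "x \<le> c" for x
    using mult_mono[OF that l1] c0 by simp
  have one: "\<bar>(\<Sum>n\<in>?Z. 1 * sieve R n) - real N / real W * quadratic_form R (\<lambda>p. real (card H) / real p)\<bar> \<le> ?r"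
  proof (rule sieved_sum_remainder[OF R(1) N1 c0])
    fix U assume s: "U \<subseteq> sift R"
    have "\<bar>(\<Sum>n\<in>sifted H W v {M<..N} U. 1)
      - real N / real W * (\<Prod>p\<in>U. real (card H) / real p)\<bar> \<le> real (card H) ^ card U * (real M + 3)"
      by (rule sieve_sum_one[OF U(1)[OF s] U(2)[OF s] v_less N(2) U(3)[OF s]])
    also have "\<dots> \<le> real (card H) ^ card U * discrepancy c d N (W * \<Prod>U)"
      using cl[of "real M + 3"] disc(3)[OF s] c by (intro mult_left_mono) auto
    finally show "\<bar>(\<Sum>n\<in>sifted H W v {M<..N} U. 1)
      - real N / real W * (\<Prod>p\<in>U. real (card H) / real p)\<bar> \<le> \<dots>" .
  qed
  \<comment> \<open>The Liouville sum is treated as a sieved sum whose main term is 0, so that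
    condition (B) enters only through the remainder.\<close>
  have lam: "\<bar>(\<Sum>n\<in>?Z. rliouville (n + d) * sieve R n) - 0 * quadratic_form R (\<lambda>_. 0)\<bar> \<le> ?r"
  proof (rule sieved_sum_remainder[OF R(1) N1 c0])
    fix U assume s: "U \<subseteq> sift R"
    have "\<bar>\<Sum>n\<in>sifted H W v {M<..N} U. rliouville (n + d)\<bar>
      \<le> real (card H) ^ card U * (liouville_discrepancy N (W * \<Prod>U) + (real M + 2 * real d))"
      by (rule sieve_sum_liouville[OF U(1)[OF s] U(2)[OF s] v_less N(2) U(3)[OF s]])
    also have "\<dots> \<le> real (card H) ^ card U * discrepancy c d N (W * \<Prod>U)"
      using cl[of "real M + 2 * real d"] disc(2)[OF s] c by (intro mult_left_mono) auto
    finally show "\<bar>(\<Sum>n\<in>sifted H W v {M<..N} U. rliouville (n + d))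
      - 0 * (\<Prod>p\<in>U. 0)\<bar> \<le> \<dots>" by simp
  qed
  have primes: "\<bar>(\<Sum>n\<in>?Z. log_prime (n + i) * sieve R n)
      - real N / real (totient W) * quadratic_form R (\<lambda>p. (real (card H) - 1) / (real p - 1))\<bar> \<le> ?r" if i: "i \<in> H" for i
  proof (rule sieved_sum_remainder[OF R(1) N1 c0])
    fix U assume s: "U \<subseteq> sift R"
    have "\<bar>(\<Sum>n\<in>sifted H W v {M<..N} U. log_prime (n + i))
      - real N / real (totient W) * (\<Prod>p\<in>U. (real (card H) - 1) / (real p - 1))\<bar>
      \<le> real (card H) ^ card U * (prime_discrepancy N (W * \<Prod>U) + (real M + 2 * real i + 1) * ln (real (N + i)))"
      by (rule sieve_sum_primes[OF U(1)[OF s] U(2)[OF s] v_less N(2) U(3)[OF s] i finite_H v_coprime[OF i] N1])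
    also have "\<dots> \<le> real (card H) ^ card U * discrepancy c d N (W * \<Prod>U)"
    proof (intro mult_left_mono)
      have "(real M + 2 * real i + 1) * ln (real (N + i)) \<le> c * ln (real (N + d))"
        using H_less[OF i] N1 c by (intro mult_mono) auto
      then show "prime_discrepancy N (W * \<Prod>U) + (real M + 2 * real i + 1) * ln (real (N + i))
          \<le> discrepancy c d N (W * \<Prod>U)" using disc(1)[OF s] by linarith
    qed simp
    finally show "\<bar>(\<Sum>n\<in>sifted H W v {M<..N} U. log_prime (n + i))
      - real N / real (totient W) * (\<Prod>p\<in>U. (real (card H) - 1) / (real p - 1))\<bar> \<le> \<dots>" .
  qed
  have "real N / real (totient W) * ?J - ?r \<le> (\<Sum>n\<in>?Z. log_prime (n + i) * sieve R n)" if i: "i \<in> H" for i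
  proof -
    have "real N / real (totient W) * ?J \<le> real N / real (totient W) * quadratic_form R (\<lambda>p. (real (card H) - 1) / (real p - 1))"
      by (intro mult_left_mono weight_diagonal_primes R) auto
    then show ?thesis using primes[OF i] by linarith
  qed
  then have "(\<Sum>i\<in>H. real N / real (totient W) * ?J - ?r) \<le> (\<Sum>i\<in>H. \<Sum>n\<in>?Z. log_prime (n + i) * sieve R n)"
    by (intro sum_mono)
  also have "\<dots> = (\<Sum>n\<in>?Z. \<Sum>i\<in>H. log_prime (n + i) * sieve R n)" by (rule sum.swap)
  \<comment> \<open>Each prime counts with at most ln(N + d), which turns log weights into
    indicators so that \<open>bad\<close> applies; nonnegativity of the square keeps the
    direction.\<close>
  also have "\<dots> \<le> (\<Sum>n\<in>?Z. ln (real (N + d)) * ((1 + rliouville (n + d)) / 2) * sieve R n)"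
  proof (intro sum_mono)
    fix n assume n: "n \<in> ?Z"
    have "(\<Sum>i\<in>H. log_prime (n + i)) \<le> (\<Sum>i\<in>H. ln (real (N + d)) * of_bool (prime (n + i)))"
    proof (intro sum_mono)
      fix i assume i: "i \<in> H"
      have "ln (real (n + i)) \<le> ln (real (N + d))"
        using n H_less[OF i] by (subst ln_le_cancel_iff) auto
      then show "log_prime (n + i) \<le> ln (real (N + d)) * of_bool (prime (n + i))"
        by (simp add: log_prime_def)
    qed
    also have "\<dots> = ln (real (N + d)) * (\<Sum>i\<in>H. of_bool (prime (n + i)))" by (simp add: sum_distrib_left)
    also have "\<dots> \<le> ln (real (N + d)) * ((1 + rliouville (n + d)) / 2)"
      using l1 bad[of n] n by (intro mult_left_mono) auto
    finally show "(\<Sum>i\<in>H. log_prime (n + i) * sieve R n)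
        \<le> ln (real (N + d)) * ((1 + rliouville (n + d)) / 2) * sieve R n"
      unfolding sum_distrib_right[symmetric] by (rule mult_right_mono) (simp add: sieve_def)
  qed
  also have "\<dots> = ln (real (N + d)) / 2 * ((\<Sum>n\<in>?Z. 1 * sieve R n) + (\<Sum>n\<in>?Z. rliouville (n + d) * sieve R n))"
    unfolding sum.distrib[symmetric] sum_distrib_left by (intro sum.cong refl) (simp add: algebra_simps)
  also have "\<dots> \<le> ln (real (N + d)) / 2 * (real N / real W * ?I + 2 * ?r)"
  proof (intro mult_left_mono)
    have "real N / real W * quadratic_form R (\<lambda>p. real (card H) / real p) \<le> real N / real W * ?I"
      by (intro mult_left_mono weight_diagonal_one R) auto
    moreover have "q \<le> i \<Longrightarrow> \<bar>x - q\<bar> \<le> r \<Longrightarrow> \<bar>y - 0 * z\<bar> \<le> r \<Longrightarrow> x + y \<le> i + 2 * r"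
      for q i x y z r :: real by simp
    ultimately show "(\<Sum>n\<in>?Z. 1 * sieve R n) + (\<Sum>n\<in>?Z. rliouville (n + d) * sieve R n)
        \<le> real N / real W * ?I + 2 * ?r"
      using one lam by blast
  qed (use l1 in auto)
  finally show ?thesis by simp
qed

text \<open>The weights are bounded by a multiple of (log N)^k, so their products cost (log N)^(2k),
  which the arbitrary power of the logarithm saved by (A) and (B) outweighs.\<close>

lemma remainder_tendsto_0:
  assumes A: "condA \<theta>" and B: "condB \<theta>" and \<theta>: "0 < \<theta>0" "\<theta>0 < \<theta>" "\<theta>0 < 1" and c: "0 \<le> c"
  shows "(\<lambda>N. remainder c (real N powr (\<theta>0 / 2)) N / real N) \<longlonglongrightarrow> 0"
proof -
  let ?R = "\<lambda>N::nat. real N powr (\<theta>0 / 2)"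
  let ?S = "\<lambda>N. \<Sum>U | U \<subseteq> sift (?R N) \<and> rprod U \<le> real N powr \<theta>0.
     real (3 * card H) ^ card U * discrepancy c d N (W * \<Prod>U)"
  define C where "C = (1 + 2 * b) * (sift_loss * (density ^ card H * (fact 0 / fact (0 + card H))))"
  have C0: "0 \<le> C" using b_nonneg density_pos by (simp add: C_def)
  have "(\<lambda>N. ln (real N) ^ (2 * card H) * ?S N / real N) \<longlonglongrightarrow> 0"
    by (rule weighted_discrepancy_tendsto_0[OF A B \<theta> c]) (use sift_props W_ge_1 in auto)
  then have lim: "(\<lambda>N. C\<^sup>2 * (ln (real N) ^ (2 * card H) * ?S N / real N)) \<longlonglongrightarrow> 0"
    by (rule tendsto_mult_right_zero)
  have ev: "eventually (\<lambda>N::nat. \<theta>0 / 2 * ln (real N) + real (card H) * shift_const \<le> ln (real N)) sequentially"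
  proof -
    have "0 < 1 - \<theta>0 / 2" using \<theta> by simp
    then have "eventually (\<lambda>N::nat. real (card H) * shift_const \<le> (1 - \<theta>0 / 2) * ln (real N)) sequentially"
      by real_asymp
    then show ?thesis by eventually_elim (simp add: algebra_simps)
  qed
  have "eventually (\<lambda>N. norm (remainder c (?R N) N / real N) \<le> C\<^sup>2 * (ln (real N) ^ (2 * card H) * ?S N / real N)) sequentially"
    using ev eventually_ge_at_top[of "3::nat"]
  proof eventually_elim
    case (elim N)
    have R1: "1 \<le> ?R N" using elim \<theta> by (intro ge_one_powr_ge_zero) auto
    have lnR: "ln (?R N) = \<theta>0 / 2 * ln (real N)" using elim by (simp add: ln_powr)
    have sq: "(?R N)\<^sup>2 = real N powr \<theta>0" using elim
      by (simp add: power2_eq_square flip: powr_add)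
    have lnN: "0 \<le> ln (real N)" using elim by simp
    have "weight_bound (?R N) \<le> (1 + 2 * b) * (sift_loss * (density ^ card H * (fact 0 / fact (0 + card H))
         * shifted_log (?R N) ^ (0 + card H)))"
      unfolding weight_bound_def using b_nonneg by (intro mult_left_mono subset_sum_sift_le R1) auto
    also have "\<dots> = C * (\<theta>0 / 2 * ln (real N) + real (card H) * shift_const) ^ card H"
      unfolding C_def lnR by (simp add: mult.assoc)
    also have "\<dots> \<le> C * ln (real N) ^ card H"
    proof (intro mult_left_mono power_mono C0)
      show "0 \<le> \<theta>0 / 2 * ln (real N) + real (card H) * shift_const"
        using \<theta> lnN shift_const(2) by (intro add_nonneg_nonneg mult_nonneg_nonneg) auto
    qed (use elim in simp)
    finally have wb: "(weight_bound (?R N))\<^sup>2 \<le> (C * ln (real N) ^ card H)\<^sup>2"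
      using weight_bound_nonneg by (intro power_mono)
    have S0: "0 \<le> ?S N"
    proof (intro sum_nonneg mult_nonneg_nonneg discrepancy_nonneg)
      fix U assume "U \<in> {U. U \<subseteq> sift (?R N) \<and> rprod U \<le> real N powr \<theta>0}"
      then have "0 < \<Prod>U" using sift_props(1) by (intro prod_primes_pos) auto
      then show "1 \<le> W * \<Prod>U" using W_ge_1 by (simp add: Suc_leI)
    qed (use elim c in auto)
    have "remainder c (?R N) N / real N = (weight_bound (?R N))\<^sup>2 * ?S N / real N"
      unfolding remainder_def sq ..
    also have "\<dots> \<le> (C * ln (real N) ^ card H)\<^sup>2 * ?S N / real N"
      using wb S0 by (intro divide_right_mono mult_right_mono) auto
    also have "\<dots> = C\<^sup>2 * (ln (real N) ^ (2 * card H) * ?S N / real N)"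
      by (simp add: power_mult_distrib power_mult[symmetric] mult.commute)
    finally have "remainder c (?R N) N / real N \<le> C\<^sup>2 * (ln (real N) ^ (2 * card H) * ?S N / real N)" .
    moreover have "0 \<le> remainder c (?R N) N / real N"
      using elim c by (intro divide_nonneg_nonneg remainder_nonneg) auto
    ultimately show ?case by simp
  qed
  then show ?thesis using lim by (rule Lim_null_comparison)
qed

text \<open>Dividing the sieve inequality by N A L^(k+1), with L = log R, leaves quantities that
  converge for fixed W. The limit contradicts the assumed strict inequality.\<close>

lemma prime_or_liouville_bias:
  assumes A: "condA \<theta>" and B: "condB \<theta>" and \<theta>: "0 < \<theta>0" "\<theta>0 < \<theta>" "\<theta>0 < 1"
    and ineq: "sift_loss
          * sieve_total (card H) b
        < \<theta>0 * real (card H) * prime_total (card H) b"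
  shows "\<exists>n>M. (\<Sum>h\<in>H. of_bool (prime (n + h))) > (1 + rliouville (n + d)) / 2"
proof (rule ccontr)
  assume "\<not> ?thesis"
  then have bad: "(\<Sum>h\<in>H. of_bool (prime (n + h))) \<le> (1 + rliouville (n + d)) / 2" if "M < n" for n
    using that by (meson not_less)
  define k where "k = card H"
  define J :: real where "J = prime_total k b"
  define I :: real where "I = sieve_total k b"
  define E where "E = exp (2 * (real k)\<^sup>2 / real D0)"
  define c where "c = real M + 2 * real d + 3"
  define K where "K = real k * shift_const"
  define A where "A = density ^ k / real W"
  define L where "L = (\<lambda>N::nat. \<theta>0 / 2 * ln (real N))"
  \<comment> \<open>The shift of log R is a constant for fixed W, so its relative effect X tends to
    1.\<close>
  define X where "X = (\<lambda>N. (L N + K) / L N)"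
  define T where "T = (\<lambda>N. remainder c (real N powr (\<theta>0 / 2)) N / real N)"
  define \<beta> where "\<beta> = (\<lambda>N. X N ^ k / fact k + 4 * b * (X N ^ (k + 1) / fact (k + 1)) + 8 * b\<^sup>2 * (X N ^ (k + 2) / fact (k + 2)))"
  \<comment> \<open>The largest weight of a prime compared with log R. Its limit 2/\<theta>0 is the
    origin of \<theta>0 in the numerical criterion.\<close>
  define r where "r = (\<lambda>N::nat. ln (real (N + d)) / L N)"
  have A0: "0 < A" using density_pos W_ge_1 by (simp add: A_def)
  have T: "T \<longlonglongrightarrow> 0" unfolding T_def
    by (rule remainder_tendsto_0[OF assms(1,2) \<theta>]) (simp add: c_def)
  have invL: "(\<lambda>N. inverse (L N)) \<longlonglongrightarrow> 0"
    unfolding L_def using \<theta> by real_asymp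
  have X: "X \<longlonglongrightarrow> 1"
    unfolding X_def L_def using \<theta> by real_asymp
  have r: "r \<longlonglongrightarrow> 2 / \<theta>0"
    unfolding r_def L_def using \<theta> by real_asymp
  have \<beta>: "\<beta> \<longlonglongrightarrow> 1 ^ k / fact k + 4 * b * (1 ^ (k + 1) / fact (k + 1)) + 8 * b\<^sup>2 * (1 ^ (k + 2) / fact (k + 2))"
    unfolding \<beta>_def by (intro tendsto_intros X) auto
  then have \<beta>: "\<beta> \<longlonglongrightarrow> I" by (simp add: I_def sieve_total_def)
  have Tk: "(\<lambda>N. T N / A * inverse (L N) ^ j) \<longlonglongrightarrow> 0 / A * 0 ^ j" for j
    using A0 by (intro tendsto_intros T invL) auto
  have lhs: "(\<lambda>N. real k * (J - T N / A * inverse (L N) ^ (k + 1))) \<longlonglongrightarrow> real k * (J - 0)"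
    using Tk[of "k + 1"] by (intro tendsto_intros) simp_all
  have rhs: "(\<lambda>N. r N / 2 * (E * \<beta> N + 2 * (T N / A * inverse (L N) ^ k))) \<longlonglongrightarrow> (2 / \<theta>0) / 2 * (E * I + 2 * 0)"
    using Tk[of k] by (intro tendsto_intros r \<beta>) simp_all
  have ev1: "eventually (\<lambda>N::nat. real D0 \<le> real N powr (\<theta>0 / 2)) sequentially" using \<theta> by real_asymp
  have "eventually (\<lambda>N. real k * (J - T N / A * inverse (L N) ^ (k + 1))
      \<le> r N / 2 * (E * \<beta> N + 2 * (T N / A * inverse (L N) ^ k))) sequentially"
    using ev1 eventually_ge_at_top[of 3] eventually_ge_at_top[of M]
  proof eventually_elim
    case (elim N)
    let ?R = "real N powr (\<theta>0 / 2)"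
    have lnR: "ln ?R = L N" using elim by (simp add: ln_powr L_def)
    have L0: "0 < L N" using elim \<theta> by (simp add: L_def)
    have R1: "1 < ?R" using elim \<theta> by (intro gr_one_powr) auto
    have N0: "0 < real N" using elim by simp
    have rem: "remainder c ?R N = real N * T N" using N0 by (simp add: T_def)
    have LX: "L N + real k * shift_const = L N * X N" using L0 by (simp add: X_def K_def)
    \<comment> \<open>Primes have density 1/phi(W) in the class, integers 1/W; the extra power of
      \<open>density\<close> in the prime form makes up the difference, so W cancels.\<close>
    have dW: "density / real (totient W) = 1 / real W" using W_ge_1 by (simp add: density_def)
    have I: "density ^ k * ((L N * X N) ^ k / fact k
          + 4 * b / L N * ((L N * X N) ^ (k + 1) / fact (k + 1))
          + 8 * b\<^sup>2 / (L N)\<^sup>2 * ((L N * X N) ^ (k + 2) / fact (k + 2))) = density ^ k * (L N ^ k * \<beta> N)"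
    proof -
      have "4 * b / L N * ((L N * X N) ^ (k + 1) / fact (k + 1)) = L N ^ k * (4 * b * (X N ^ (k + 1) / fact (k + 1)))"
        using L0 by (simp only: power_mult_distrib power_add power_one_right) simp
      moreover have "8 * b\<^sup>2 / (L N)\<^sup>2 * ((L N * X N) ^ (k + 2) / fact (k + 2)) = L N ^ k * (8 * b\<^sup>2 * (X N ^ (k + 2) / fact (k + 2)))"
        using L0 by (simp only: power_mult_distrib power_add) simp
      ultimately show ?thesis by (simp add: \<beta>_def distrib_left power_mult_distrib)
    qed
    have "real k * (real N / real (totient W) * (density ^ (k + 1) * L N ^ (k + 1) * J) - real N * T N)
        \<le> ln (real (N + d)) / 2 * (real N / real W * (E * density ^ k
          * ((L N * X N) ^ k / fact k
          + 4 * b / L N * ((L N * X N) ^ (k + 1) / fact (k + 1))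
          + 8 * b\<^sup>2 / (L N)\<^sup>2 * ((L N * X N) ^ (k + 2) / fact (k + 2)))) + 2 * (real N * T N))"
      using sieve_inequality[OF R1 elim(1) elim(2,3) c_def bad]
      unfolding lnR rem k_def[symmetric] J_def[symmetric] E_def[symmetric] LX by blast
    also have "\<dots> = ln (real (N + d)) / 2 * (real N / real W * (E * (density ^ k * (L N ^ k * \<beta> N))) + 2 * (real N * T N))"
      unfolding mult.assoc I ..
    finally have 1: "real k * (real N / real (totient W) * (density ^ (k + 1) * L N ^ (k + 1) * J) - real N * T N) \<le> \<dots>" .
    have 2: "real N / real (totient W) * (density ^ (k + 1) * L N ^ (k + 1) * J) = real N * (A * L N ^ (k + 1) * J)"
    proof -
      have "real N / real (totient W) * (density ^ (k + 1) * L N ^ (k + 1) * J)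
          = real N * (density / real (totient W) * density ^ k * L N ^ (k + 1) * J)" by simp
      also have "\<dots> = real N * (A * L N ^ (k + 1) * J)" unfolding dW A_def by simp
      finally show ?thesis .
    qed
    have 3: "ln (real (N + d)) = r N * L N" using L0 by (simp add: r_def)
    have "real k * (J - T N / A * inverse (L N) ^ (k + 1)) * (real N * A * L N ^ (k + 1))
        = real k * (real N * (A * L N ^ (k + 1) * J) - real N * T N)"
    proof -
      have "inverse (L N) ^ (k + 1) * L N ^ (k + 1) = 1" using L0 by (simp add: power_inverse del: power_Suc)
      then have "T N / A * inverse (L N) ^ (k + 1) * (real N * A * L N ^ (k + 1)) = real N * T N"
        using A0 by (metis (no_types, opaque_lifting) mult.commute mult.left_commute mult.right_neutral nonzero_eq_divide_eq less_irrefl)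
      then show ?thesis by (simp only: left_diff_distrib right_diff_distrib mult.assoc) (simp only: mult_ac)
    qed
    also have "\<dots> \<le> r N * L N / 2 * (real N / real W * (E * (density ^ k * (L N ^ k * \<beta> N))) + 2 * (real N * T N))"
      using 1 unfolding 2 3 .
    also have "\<dots> = r N / 2 * (E * \<beta> N + 2 * (T N / A * inverse (L N) ^ k)) * (real N * A * L N ^ (k + 1))"
    proof -
      have i: "inverse (L N) ^ k * L N ^ k = 1" using L0 by (simp add: power_inverse)
      have "T N / A * inverse (L N) ^ k * (real N * A * L N ^ k) = (T N / A * A) * real N * (inverse (L N) ^ k * L N ^ k)"
        by (simp only: mult_ac)
      then have t: "T N / A * inverse (L N) ^ k * (real N * A * L N ^ k) = real N * T N"
        unfolding i using A0 by simp
      have "r N / 2 * (E * \<beta> N + 2 * (T N / A * inverse (L N) ^ k)) * (real N * A * L N ^ (k + 1))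
         = r N * L N / 2 * (E * \<beta> N * (real N * A * L N ^ k) + 2 * (T N / A * inverse (L N) ^ k * (real N * A * L N ^ k)))"
        by (simp only: power_add power_one_right) (simp add: algebra_simps)
      also have "\<dots> = r N * L N / 2 * (real N / real W * (E * (density ^ k * (L N ^ k * \<beta> N))) + 2 * (real N * T N))"
        unfolding t by (simp add: A_def mult_ac)
      finally show ?thesis by (rule sym)
    qed
    finally show ?case
      by (rule mult_right_le_imp_le) (use N0 A0 L0 in simp)
  qed
  then have "real k * (J - 0) \<le> (2 / \<theta>0) / 2 * (E * I + 2 * 0)"
    by (intro tendsto_le[OF _ rhs lhs]) auto
  then have "\<theta>0 * real k * J \<le> E * I" using \<theta> by (simp add: field_simps)
  then show False using ineq by (simp add: k_def J_def I_def E_def)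
qed

end

section \<open>Choice of the small primes and of the residue class\<close>

text \<open>The strict inequality survives the factor exp(2 k^2/D0) once D0 is large, and
  admissibility gives a class v modulo the primes up to D0.\<close>

lemma prime_liouville_bias:
  assumes H: "finite H" "2 \<le> card H" "\<And>h. h \<in> H \<Longrightarrow> h < d"
    and adm: "\<And>p. prime p \<Longrightarrow> \<exists>r. \<forall>h\<in>H. \<not> p dvd r + h"
    and A: "condA \<theta>" and B: "condB \<theta>" and \<theta>: "0 < \<theta>0" "\<theta>0 < \<theta>" "\<theta>0 < 1" and b: "0 \<le> b"
    and ineq: "sieve_total (card H) b
        < \<theta>0 * real (card H) * prime_total (card H) b"
  shows "\<exists>n>M. (\<Sum>h\<in>H. of_bool (prime (n + h))) > (1 + rliouville (n + d)) / 2"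
proof -
  let ?I = "sieve_total (card H) b"
  let ?J = "\<theta>0 * real (card H) * prime_total (card H) b"
  have "(\<lambda>n::nat. 2 * (real (card H))\<^sup>2 / real n) \<longlonglongrightarrow> 0" by real_asymp
  then have "(\<lambda>n::nat. exp (2 * (real (card H))\<^sup>2 / real n) * ?I) \<longlonglongrightarrow> exp 0 * ?I"
    by (intro tendsto_intros)
  then have "eventually (\<lambda>n::nat. exp (2 * (real (card H))\<^sup>2 / real n) * ?I < ?J) sequentially"
    using ineq by (intro order_tendstoD) auto
  then have "eventually (\<lambda>n::nat. exp (2 * (real (card H))\<^sup>2 / real n) * ?I < ?J \<and> d \<le> n \<and> 2 * card H \<le> n) sequentially"
    by (intro eventually_conj eventually_ge_at_top)
  from eventually_happens'[OF sequentially_bot this]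
  obtain D0 where D0: "exp (2 * (real (card H))\<^sup>2 / real D0) * ?I < ?J" "d \<le> D0" "2 * card H \<le> D0"
    by (elim exE conjE)
  define Q where "Q = {p::nat. prime p \<and> p \<le> D0}"
  have Q: "finite Q" "\<And>p. p \<in> Q \<Longrightarrow> prime p" by (auto simp: Q_def)
  \<comment> \<open>The Chinese remainder count with modulus 1 and a trivial predicate: a positive
    number of suitable classes yields v.\<close>
  have "card {x. x < 1 * \<Prod>Q \<and> True \<and> (\<forall>p\<in>Q. \<forall>h\<in>H. \<not> p dvd x mod p + h)}
      = card {x::nat. x < 1 \<and> True} * (\<Prod>p\<in>Q. card {r. r < p \<and> (\<forall>h\<in>H. \<not> p dvd r + h)})"
    by (rule card_residues_prod_primes) (use Q in auto)
  also have "\<dots> > 0"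
  proof -
    have "0 < card {r. r < p \<and> (\<forall>h\<in>H. \<not> p dvd r + h)}" if p: "p \<in> Q" for p
    proof -
      obtain r where r: "\<forall>h\<in>H. \<not> p dvd r + h" using adm Q(2)[OF p] by blast
      have "r mod p < p" using Q(2)[OF p] prime_gt_0_nat by (intro mod_less_divisor) auto
      then have "r mod p \<in> {r. r < p \<and> (\<forall>h\<in>H. \<not> p dvd r + h)}" using r by (simp add: dvd_mod_add_iff)
      then show ?thesis by (subst card_gt_0_iff) auto
    qed
    then have "0 < (\<Prod>p\<in>Q. card {r. r < p \<and> (\<forall>h\<in>H. \<not> p dvd r + h)})" by (intro prod_pos) auto
    then show ?thesis by simp
  qed
  finally have "{x. x < 1 * \<Prod>Q \<and> True \<and> (\<forall>p\<in>Q. \<forall>h\<in>H. \<not> p dvd x mod p + h)} \<noteq> {}"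
    by (simp only: card_gt_0_iff) blast
  then obtain v where v: "v < \<Prod>Q" "\<forall>p\<in>Q. \<forall>h\<in>H. \<not> p dvd v + h"
    unfolding dvd_mod_add_iff mult_1 by blast
  have "gpy_sieve H D0 (\<Prod>Q) v d b"
  proof
    fix h assume h: "h \<in> H"
    show "coprime (v + h) (\<Prod>Q)"
    proof (rule prod_coprime_right)
      fix p assume p: "p \<in> Q"
      then have "coprime p (v + h)" using v(2) h Q(2) by (intro prime_imp_coprime) auto
      then show "coprime (v + h) p" by (simp add: coprime_commute)
    qed
  qed (use H D0 b v in \<open>auto simp: Q_def\<close>)
  then show ?thesis
    by (rule gpy_sieve.prime_or_liouville_bias[OF _ A B \<theta> D0(1)])
qed

section \<open>Liouville signs, admissible tuples and the four cases\<close>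

lemma liouville_prime: "prime p \<Longrightarrow> liouville p = -1"
  by (simp add: liouville_def bigOmega_def prime_factorization_prime)

lemma liouville_cases: "liouville n = 1 \<or> liouville n = -1"
  unfolding liouville_def by (cases "even (bigOmega n)") auto

text \<open>All four tuples are initial segments of this one. The shift r = 1 gives 1, 3, 7, 9, 13
  and fails only for p = 3, 7 and 13; these get r = 5, 11 and 3 instead.\<close>

lemma quintuple_admissible:
  assumes "prime (p::nat)" "H \<subseteq> {0, 2, 6, 8, 12}"
  shows "\<exists>r. \<forall>h\<in>H. \<not> p dvd r + h"
proof -
  have "\<exists>r. \<forall>h\<in>{0, 2, 6, 8, 12}. \<not> p dvd r + h"
  proof (cases "p < 17")
    case False
    then show ?thesis by (intro exI[of _ 1]) (auto dest: dvd_imp_le)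
  next
    case True
    have "p \<noteq> 0" "p \<noteq> 1" using assms(1) by auto
    with True have "2 dvd p \<or> 3 dvd p \<or> p = 5 \<or> p = 11 \<or> p = 7 \<or> p = 13" by presburger
    then consider "2 dvd p" | "3 dvd p" | "p \<in> {5, 11}" | "p = 7" | "p = 13" by blast
    then show ?thesis
    proof cases
      case 1
      then have *: "\<not> p dvd 1 + h" if "even h" for h using that dvd_trans[of 2 p "1 + h"] by auto
      show ?thesis by (intro exI[of _ 1] ballI *) auto
    next
      case 2
      then have *: "\<not> p dvd x" if "\<not> 3 dvd x" for x using that dvd_trans by blast
      show ?thesis by (intro exI[of _ 5] ballI *) auto
    next
      case 3
      then show ?thesis by (intro exI[of _ 1]) auto
    next
      case 4
      then show ?thesis by (intro exI[of _ 11]) auto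
    next
      case 5
      then show ?thesis by (intro exI[of _ 3]) auto
    qed
  qed
  then show ?thesis using assms(2) by blast
qed

lemma exists_shift_from_tuple:
  assumes H: "H \<subseteq> {0, 2, 6, 8, 12}" "2 \<le> card H" "\<And>h. h \<in> H \<Longrightarrow> h \<le> D" and D: "even D"
    and A: "condA \<theta>" and B: "condB \<theta>" and \<theta>: "0 < \<theta>0" "\<theta>0 < \<theta>" "\<theta>0 < 1" and b: "0 \<le> b"
    and ineq: "sieve_total (card H) b
        < \<theta>0 * real (card H) * prime_total (card H) b"
  shows "\<exists>d::nat. d > 0 \<and> even d \<and> d \<le> D + 2 \<and> infinite {p::nat. prime p \<and> liouville (p + d) = -1}"
proof (rule ccontr)
  assume contra: "\<not> ?thesis"
  define F where "F = (\<Union>d\<in>{d. d > 0 \<and> even d \<and> d \<le> D + 2}. {p::nat. prime p \<and> liouville (p + d) = -1})"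
  have "finite {d. d > 0 \<and> even d \<and> d \<le> D + 2}" by (rule finite_subset[of _ "{..D + 2}"]) auto
  then have "finite F" unfolding F_def using contra by (intro finite_UN_I) auto
  then obtain M where M: "\<forall>p\<in>F. p \<le> M" using finite_nat_set_iff_bounded_le by blast
  have plus: "liouville (p + e) = 1" if "prime p" "M < p" "e > 0" "even e" "e \<le> D + 2" for p e
  proof (rule ccontr)
    assume "liouville (p + e) \<noteq> 1"
    then have "p \<in> F" using that liouville_cases[of "p + e"] by (auto simp: F_def)
    then show False using M that by auto
  qed
  have finH: "finite H" using H(1) by (rule finite_subset) simp
  have evH: "even h" if "h \<in> H" for h using that H(1) by auto
  obtain n where n: "M < n" "(\<Sum>h\<in>H. of_bool (prime (n + h))) > (1 + rliouville (n + (D + 2))) / 2"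
    using prime_liouville_bias[OF finH H(2) _ quintuple_admissible[OF _ H(1)] A B \<theta> b ineq, of "D + 2" M] H(3)
    by (force simp: less_Suc_eq_le)
  have uniq: False if "h \<in> H" "g \<in> H" "h < g" "prime (n + h)" "prime (n + g)" for h g
  proof -
    have "liouville (n + h + (g - h)) = 1"
      using that n(1) evH H(3)[of g] by (intro plus) auto
    then show False using that liouville_prime[of "n + g"] by simp
  qed
  show False
  \<comment> \<open>Both cases refute the strict inequality: with a prime present it would read 1 >
    1, and without one 0 > (1 + \<lambda>)/2, which is 0 or 1 on the right.\<close>
  proof (cases "\<exists>h\<in>H. prime (n + h)")
    case True
    then obtain h where h: "h \<in> H" "prime (n + h)" by auto
    have "(\<Sum>g\<in>H. of_bool (prime (n + g))) = (\<Sum>g\<in>{h}. of_bool (prime (n + g)) :: real)"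
    proof (rule sum.mono_neutral_right)
      show "\<forall>g\<in>H - {h}. of_bool (prime (n + g)) = (0::real)"
        using uniq h by (metis DiffE insertI1 linorder_neqE_nat of_bool_eq(1))
    qed (use h finH in auto)
    \<comment> \<open>As h may equal D, the shift D + 2 rather than D keeps the difference
      positive.\<close>
    moreover have "liouville (n + h + (D + 2 - h)) = 1"
      using h n(1) evH[of h] H(3)[of h] D by (intro plus) auto
    moreover have "n + h + (D + 2 - h) = n + (D + 2)" using H(3)[OF h(1)] by simp
    ultimately show False using n(2) h by simp
  next
    case False
    then have "(\<Sum>g\<in>H. of_bool (prime (n + g))) = (0::real)" by simp
    then show False using n(2) liouville_cases[of "n + (D + 2)"] by auto
  qed
qed

theorem theorem7:
  fixes \<theta>0 \<theta> :: real and D :: nat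
  assumes "(\<theta>0, D) \<in> {(0.729, 2), (0.616, 6), (0.554, 8), (0.515, 12)}"
    and "\<theta> > \<theta>0"
    and "condA \<theta>"
    and "condB \<theta>"
  shows "\<exists>d::nat. d > 0 \<and> even d \<and> d \<le> D + 2 \<and>
           infinite {p::nat. prime p \<and> liouville (p + d) = -1}"
proof -
  consider "\<theta>0 = 0.729" "D = 2" | "\<theta>0 = 0.616" "D = 6" | "\<theta>0 = 0.554" "D = 8" | "\<theta>0 = 0.515" "D = 12"
    using assms(1) by auto
  then show ?thesis
  proof cases
    \<comment> \<open>The chosen b make I/(k J) equal to 55/76, 68/111, 203/368 and 141/275 for k =
      2, 3, 4, 5, just below the four values of \<theta>0. The constant cutoff b = 0 would give (k +
      1)/(2 k), which is above \<theta>0 in every case.\<close>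
    case 1
    show ?thesis
      by (rule exists_shift_from_tuple[where H = "{0, 2}" and b = "1 / 2", OF _ _ _ _ assms(3,4) _ assms(2)])
        (use 1 in \<open>auto simp: sieve_total_def prime_total_def fact_numeral power2_eq_square\<close>)
  next
    case 2
    show ?thesis
      by (rule exists_shift_from_tuple[where H = "{0, 2, 6}" and b = "3 / 2", OF _ _ _ _ assms(3,4) _ assms(2)])
        (use 2 in \<open>auto simp: sieve_total_def prime_total_def fact_numeral power2_eq_square\<close>)
  next
    case 3
    show ?thesis
      by (rule exists_shift_from_tuple[where H = "{0, 2, 6, 8}" and b = 3, OF _ _ _ _ assms(3,4) _ assms(2)])
        (use 3 in \<open>auto simp: sieve_total_def prime_total_def fact_numeral power2_eq_square\<close>)
  next
    case 4
    show ?thesis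
      by (rule exists_shift_from_tuple[where H = "{0, 2, 6, 8, 12}" and b = 4, OF _ _ _ _ assms(3,4) _ assms(2)])
        (use 4 in \<open>auto simp: sieve_total_def prime_total_def fact_numeral power2_eq_square\<close>)
  qed
qed

end
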